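(* Let $(V,\omega)$ be a complex symplectic Hilbert space of finite dimension $m$, and let $J\in \mathrm{GL}(V)$ be such that $\omega(x,y)=\langle Jx,y\rangle$ for all $x,y\in V$. Let $M$ be a compact Hausdorff space with a continuous flow $\varphi:\mathbb R\times M\to M$ and a $\varphi$-invariant Borel measure $\mu$ with $\mu(M)\in(0,+\infty)$. Let $B:M\to\mathcal B^{sa}(V)$ be a continuous map. For $\xi\in M$ let $\gamma_\xi$ be the fundamental solution (with $\gamma_\xi(0)=I_V$) of the linear system $\dot x=-J^{-1}B(\varphi(t,\xi))x$, and for $\tau>0$ put $i_\tau(\xi):=i_1(\gamma_\xi|_{[0,\tau]})$. Then there is a Borel function $F:M\to\mathbb R$ such that $$F\circ\varphi(t,\cdot)=F\quad\text{for all }t\ge 0,$$ and $$\frac{i_\tau}{\tau}\to F\quad\text{as }\tau\to+\infty,$$ the convergence being in $L^1(M,\mu)$ and $\mu$-almost everywhere.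
   Context: A symplectic form on a finite-dimensional complex vector space $V$ is a non-degenerate skew-Hermitian (sesquilinear, linear in the first variable) form $\omega$; $\mathrm{Sp}(V)$ is the group of invertible linear maps preserving $\omega$. A subspace is Lagrangian if it equals its $\omega$-annihilator. $\mathcal B^{sa}(V)$ is the set of self-adjoint operators on the Hilbert space $V$. The paths $\gamma_\xi$ take values in $\mathrm{Sp}(V)$. Maslov index. Let $(X,\Omega)$ be a complex symplectic vector space of dimension $2N$ possessing Lagrangian subspaces. Choose an inner product (linear in the first variable) and $J_X\in \mathrm{GL}(X)$ with $\Omega(x,y)=\langle J_Xx,y\rangle$; $iJ_X$ is self-adjoint. Let $X^-$ (resp. $X^+$) be the span of eigenvectors of $iJ_X$ with positive (resp. negative) eigenvalues. For a continuous path $(\lambda(s),\mu(s))$, $s\in[a,b]$, of pairs of Lagrangian subspaces, write them as graphs of $U_\lambda(s),U_\mu(s):X^-\to X^+$; the operators $U_\lambda(s)U_\mu(s)^{-1}$ are unitary on $(X^+,-i\Omega|_{X^+})$ with eigenvalues $e^{i\theta_j(s)}$, $\theta_j$ continuous real, $j=1,\dots,N$. With $E(x)$ the smallest integer $\ge x$, $\mathrm{Mas}\{\lambda,\mu\}:=\sum_j\big(E(\theta_j(b)/2\pi)-E(\theta_j(a)/2\pi)\big)$ (independent of choices). A single Lagrangian in place of a path means the constant path. Maslov-type index. $V\oplus V$ carries the symplectic form $(-\omega)\oplus\omega$; for $A\in \mathrm{Sp}(V)$ the graph $\mathrm{Gr}(A)=\{(x,Ax)\}$ is Lagrangian. For a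 path $\gamma$ in $\mathrm{Sp}(V)$, $i_1(\gamma):=\mathrm{Mas}\{\mathrm{Gr}\circ\gamma,\mathrm{Gr}(I_V)\}$. *)

theory Defs
  imports "HOL-Analysis.Analysis"
begin

section \<open>Complex vector spaces and complex inner product spaces\<close>

class complex_vector = real_vector +
  fixes scaleC :: "complex \<Rightarrow> 'a \<Rightarrow> 'a" (infixr \<open>*\<^sub>C\<close> 75)
  assumes scaleC_add_right: "a *\<^sub>C (x + y) = a *\<^sub>C x + a *\<^sub>C y"
    and scaleC_add_left: "(a + b) *\<^sub>C x = a *\<^sub>C x + b *\<^sub>C x"
    and scaleC_scaleC: "a *\<^sub>C b *\<^sub>C x = (a * b) *\<^sub>C x"
    and scaleC_one: "1 *\<^sub>C x = x"
    and scaleR_scaleC: "r *\<^sub>R x = complex_of_real r *\<^sub>C x"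

global_interpretation complex_vector: vector_space "scaleC :: complex \<Rightarrow> 'a \<Rightarrow> 'a::complex_vector"
  by unfold_locales (simp_all add: scaleC_add_right scaleC_add_left scaleC_scaleC scaleC_one)

abbreviation cspan :: "'a::complex_vector set \<Rightarrow> 'a set"
  where "cspan \<equiv> complex_vector.span"

abbreviation cdim :: "'a::complex_vector set \<Rightarrow> nat"
  where "cdim \<equiv> complex_vector.dim"

abbreviation clinear :: "('a::complex_vector \<Rightarrow> 'b::complex_vector) \<Rightarrow> bool"
  where "clinear \<equiv> Vector_Spaces.linear scaleC scaleC"

text \<open>The inner product is linear in the first variable. Positive definiteness follows from
  the last axiom, since the norm is positive definite.\<close>

class complex_inner = complex_vector + real_normed_vector +
  fixes cinner :: "'a \<Rightarrow> 'a \<Rightarrow> complex"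
  assumes cinner_add_left: "cinner (x + y) z = cinner x z + cinner y z"
    and cinner_scaleC_left: "cinner (c *\<^sub>C x) y = c * cinner x y"
    and cinner_commute: "cinner y x = cnj (cinner x y)"
    and norm_eq_sqrt_cinner: "norm x = sqrt (Re (cinner x x))"

instantiation complex :: complex_inner
begin

definition scaleC_complex :: "complex \<Rightarrow> complex \<Rightarrow> complex"
  where "scaleC_complex c x = c * x"

definition cinner_complex :: "complex \<Rightarrow> complex \<Rightarrow> complex"
  where "cinner_complex x y = x * cnj y"

instance
  by standard
    (auto simp: scaleC_complex_def cinner_complex_def algebra_simps scaleR_conv_of_real
      cmod_def power2_eq_square)

end

instantiation prod :: (complex_vector, complex_vector) complex_vector
begin

definition scaleC_prod :: "complex \<Rightarrow> 'a \<times> 'b \<Rightarrow> 'a \<times> 'b"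
  where "scaleC_prod c p = (c *\<^sub>C fst p, c *\<^sub>C snd p)"

instance
  by standard
    (simp_all add: scaleC_prod_def prod_eq_iff scaleC_add_right scaleC_add_left scaleC_scaleC
      scaleC_one scaleR_scaleC)

end

instantiation vec :: (complex_vector, finite) complex_vector
begin

definition scaleC_vec :: "complex \<Rightarrow> 'a ^ 'b \<Rightarrow> 'a ^ 'b"
  where "scaleC_vec c x = (\<chi> i. c *\<^sub>C (x $ i))"

instance
  by standard
    (simp_all add: scaleC_vec_def vec_eq_iff scaleC_add_right scaleC_add_left scaleC_scaleC
      scaleC_one scaleR_scaleC)

end

lemma Re_cinner_self: "Re (cinner x x) = (norm x)\<^sup>2" for x :: "'a::complex_inner"
  by (metis norm_eq_sqrt_cinner norm_ge_zero real_sqrt_ge_0_iff real_sqrt_pow2)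

instantiation vec :: (complex_inner, finite) complex_inner
begin

definition cinner_vec :: "'a ^ 'b \<Rightarrow> 'a ^ 'b \<Rightarrow> complex"
  where "cinner_vec x y = (\<Sum>i\<in>UNIV. cinner (x $ i) (y $ i))"

instance
proof
  fix x y z :: "'a ^ 'b" and c :: complex
  show "cinner (x + y) z = cinner x z + cinner y z"
    by (simp add: cinner_vec_def cinner_add_left sum.distrib)
  show "cinner (c *\<^sub>C x) y = c * cinner x y"
    by (simp add: cinner_vec_def scaleC_vec_def cinner_scaleC_left sum_distrib_left)
  show "cinner y x = cnj (cinner x y)"
    unfolding cinner_vec_def cnj_sum by (rule sum.cong[OF refl], rule cinner_commute)
  show "norm x = sqrt (Re (cinner x x))"
    by (simp add: cinner_vec_def norm_vec_def L2_set_def Re_cinner_self)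
qed

end

definition self_adjoint :: "('v::complex_inner \<Rightarrow> 'v) \<Rightarrow> bool"
  where "self_adjoint T \<longleftrightarrow> clinear T \<and> (\<forall>x y. cinner (T x) y = cinner x (T y))"


section \<open>Forms\<close>

definition sesquilinear :: "('x::complex_vector \<Rightarrow> 'x \<Rightarrow> complex) \<Rightarrow> bool"
  where "sesquilinear f \<longleftrightarrow>
    (\<forall>x x' y. f (x + x') y = f x y + f x' y) \<and> (\<forall>c x y. f (c *\<^sub>C x) y = c * f x y) \<and>
    (\<forall>x y y'. f x (y + y') = f x y + f x y') \<and> (\<forall>c x y. f x (c *\<^sub>C y) = cnj c * f x y)"

definition inner_product :: "('x::complex_vector \<Rightarrow> 'x \<Rightarrow> complex) \<Rightarrow> bool"
  where "inner_product G \<longleftrightarrow>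
    sesquilinear G \<and> (\<forall>x y. G y x = cnj (G x y)) \<and> (\<forall>x. x \<noteq> 0 \<longrightarrow> 0 < Re (G x x))"

definition symplectic_form :: "('x::complex_vector \<Rightarrow> 'x \<Rightarrow> complex) \<Rightarrow> bool"
  where "symplectic_form \<Omega> \<longleftrightarrow>
    sesquilinear \<Omega> \<and> (\<forall>x y. \<Omega> y x = - cnj (\<Omega> x y)) \<and> (\<forall>x. (\<forall>y. \<Omega> x y = 0) \<longrightarrow> x = 0)"

definition direct_sum_form ::
    "('v::complex_vector \<Rightarrow> 'v \<Rightarrow> complex) \<Rightarrow> 'v \<times> 'v \<Rightarrow> 'v \<times> 'v \<Rightarrow> complex"
  where "direct_sum_form \<omega> p q = - \<omega> (fst p) (fst q) + \<omega> (snd p) (snd q)"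

definition Gr :: "('v \<Rightarrow> 'v) \<Rightarrow> ('v \<times> 'v) set"
  where "Gr A = {(x, A x) | x. True}"


section \<open>The Maslov index\<close>

text \<open>Throughout, \<^term>\<open>\<Omega>\<close> is a symplectic form on the complex vector space carried by the type
  of its arguments, and \<^term>\<open>G\<close> is the inner product chosen on that space.\<close>

definition form_op ::
    "('x::complex_vector \<Rightarrow> 'x \<Rightarrow> complex) \<Rightarrow> ('x \<Rightarrow> 'x \<Rightarrow> complex) \<Rightarrow> 'x \<Rightarrow> 'x"
  where "form_op G \<Omega> = (THE J. clinear J \<and> bij J \<and> (\<forall>x y. \<Omega> x y = G (J x) y))"

definition Xminus ::
    "('x::complex_vector \<Rightarrow> 'x \<Rightarrow> complex) \<Rightarrow> ('x \<Rightarrow> 'x \<Rightarrow> complex) \<Rightarrow> 'x set"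
  where "Xminus G \<Omega> =
    cspan {v. v \<noteq> 0 \<and> (\<exists>r::real. r > 0 \<and> \<i> *\<^sub>C form_op G \<Omega> v = complex_of_real r *\<^sub>C v)}"

definition Xplus ::
    "('x::complex_vector \<Rightarrow> 'x \<Rightarrow> complex) \<Rightarrow> ('x \<Rightarrow> 'x \<Rightarrow> complex) \<Rightarrow> 'x set"
  where "Xplus G \<Omega> =
    cspan {v. v \<noteq> 0 \<and> (\<exists>r::real. r < 0 \<and> \<i> *\<^sub>C form_op G \<Omega> v = complex_of_real r *\<^sub>C v)}"

text \<open>A Lagrangian subspace \<^term>\<open>L\<close> is the graph of a unique linear map from
  \<^term>\<open>Xminus G \<Omega>\<close> to \<^term>\<open>Xplus G \<Omega>\<close>, that is,
  the set of all sums of a vector of \<^term>\<open>Xminus G \<Omega>\<close> and its image. The function below is that map;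
  only its values on \<^term>\<open>Xminus G \<Omega>\<close> are meaningful.\<close>

definition lag_map ::
    "('x::complex_vector \<Rightarrow> 'x \<Rightarrow> complex) \<Rightarrow> ('x \<Rightarrow> 'x \<Rightarrow> complex) \<Rightarrow> 'x set \<Rightarrow> 'x \<Rightarrow> 'x"
  where "lag_map G \<Omega> L x = (THE y. y \<in> Xplus G \<Omega> \<and> x + y \<in> L)"

definition lag_pair_op ::
    "('x::complex_vector \<Rightarrow> 'x \<Rightarrow> complex) \<Rightarrow> ('x \<Rightarrow> 'x \<Rightarrow> complex) \<Rightarrow> 'x set \<Rightarrow> 'x set \<Rightarrow> 'x \<Rightarrow> 'x"
  where "lag_pair_op G \<Omega> L L' z =
    lag_map G \<Omega> L (inv_into (Xminus G \<Omega>) (lag_map G \<Omega> L') z)"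

text \<open>The functions \<^term>\<open>\<theta> 1\<close>, \dots, \<^term>\<open>\<theta> N\<close> are continuous arguments of the eigenvalues
  of the operators \<^term>\<open>\<lambda>s. lag_pair_op G \<Omega> (lam s) (mu s)\<close> on \<^term>\<open>Xplus G \<Omega>\<close>, listed with
  multiplicity. These operators are unitary, so multiplicities are dimensions of eigenspaces.\<close>

definition eigen_angles ::
    "('x::complex_vector \<Rightarrow> 'x \<Rightarrow> complex) \<Rightarrow> ('x \<Rightarrow> 'x \<Rightarrow> complex) \<Rightarrow> nat \<Rightarrow> real \<Rightarrow> real \<Rightarrow>
      (real \<Rightarrow> 'x set) \<Rightarrow> (real \<Rightarrow> 'x set) \<Rightarrow> (nat \<Rightarrow> real \<Rightarrow> real) \<Rightarrow> bool"
  where "eigen_angles G \<Omega> N a b lam mu \<theta> \<longleftrightarrow>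
    (\<forall>j\<in>{1..N}. continuous_on {a..b} (\<theta> j)) \<and>
    (\<forall>s\<in>{a..b}. \<forall>z::complex.
       card {j\<in>{1..N}. exp (\<i> * complex_of_real (\<theta> j s)) = z} =
       cdim {x \<in> Xplus G \<Omega>. lag_pair_op G \<Omega> (lam s) (mu s) x = z *\<^sub>C x})"

text \<open>The sum below does not depend on the choice of the angles, hence the definite description.
  It does not depend on \<^term>\<open>G\<close> either, but \<^term>\<open>G\<close> is kept as a parameter and no
  independence is built in. The value is meaningful for continuous paths of Lagrangian
  subspaces.\<close>

definition maslov_index ::
    "('x::complex_vector \<Rightarrow> 'x \<Rightarrow> complex) \<Rightarrow> ('x \<Rightarrow> 'x \<Rightarrow> complex) \<Rightarrow> real \<Rightarrow> real \<Rightarrow>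
      (real \<Rightarrow> 'x set) \<Rightarrow> (real \<Rightarrow> 'x set) \<Rightarrow> int"
  where "maslov_index G \<Omega> a b lam mu =
    (let N = cdim (UNIV :: 'x set) div 2 in
     (THE k. \<exists>\<theta>. eigen_angles G \<Omega> N a b lam mu \<theta> \<and>
        k = (\<Sum>j=1..N. \<lceil>\<theta> j b / (2 * pi)\<rceil> - \<lceil>\<theta> j a / (2 * pi)\<rceil>)))"

text \<open>Here \<^term>\<open>G\<close> is an inner product on the direct sum of two copies of the space.\<close>

definition maslov_i1 ::
    "('v \<times> 'v \<Rightarrow> 'v \<times> 'v \<Rightarrow> complex) \<Rightarrow> ('v::complex_vector \<Rightarrow> 'v \<Rightarrow> complex) \<Rightarrow> real \<Rightarrow> real \<Rightarrow>
      (real \<Rightarrow> 'v \<Rightarrow> 'v) \<Rightarrow> int"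
  where "maslov_i1 G \<omega> a b \<gamma> =
    maslov_index G (direct_sum_form \<omega>) a b (\<lambda>s. Gr (\<gamma> s)) (\<lambda>s. Gr id)"


section \<open>Flows and linear systems\<close>

definition continuous_flow :: "(real \<Rightarrow> 'm::topological_space \<Rightarrow> 'm) \<Rightarrow> bool"
  where "continuous_flow \<phi> \<longleftrightarrow>
    continuous_on UNIV (\<lambda>p. \<phi> (fst p) (snd p)) \<and>
    (\<forall>\<xi>. \<phi> 0 \<xi> = \<xi>) \<and> (\<forall>s t \<xi>. \<phi> (s + t) \<xi> = \<phi> s (\<phi> t \<xi>))"

definition fundamental_solution ::
    "(real \<Rightarrow> 'v \<Rightarrow> 'v) \<Rightarrow> (real \<Rightarrow> 'v::complex_inner \<Rightarrow> 'v) \<Rightarrow> bool"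
  where "fundamental_solution A \<gamma> \<longleftrightarrow>
    \<gamma> 0 = id \<and> (\<forall>t. clinear (\<gamma> t)) \<and>
    (\<forall>t x. ((\<lambda>s. \<gamma> s x) has_vector_derivative A t (\<gamma> t x)) (at t))"

end

theory Submission
  imports Defs "Jordan_Normal_Form.Determinant"
    "HOL-Computational_Algebra.Fundamental_Theorem_Algebra"
begin

text \<open>Over \<open>Xplus\<close> the pair \<open>(Gr (\<gamma> t), Gr id)\<close> is described by a unitary operator \<open>W t\<close> with
  \<open>W 0 = 1\<close>. Let \<open>angle \<xi> t\<close> be the continuous argument of \<open>det (W t)\<close> that vanishes at \<open>t = 0\<close>.
  The eigenvalues of \<open>W t\<close> have unique arguments
  \<open>\<theta> 0 \<le> \<dots> \<le> \<theta> (N - 1) \<le> \<theta> 0 + 2 \<pi>\<close> with sum \<open>angle \<xi> t\<close>; by uniqueness and compactness they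
  depend continuously on \<open>(\<xi>, t)\<close>. Hence the index is the sum of the \<open>\<lceil>\<theta> j / 2 \<pi>\<rceil>\<close>, it is a Borel
  function of \<open>\<xi>\<close>, and it differs from \<open>angle \<xi> t / 2 \<pi>\<close> by at most \<open>N\<close>.

  By the cocycle identity, the path \<open>\<gamma> \<xi> (s + t)\<close> in \<open>t\<close> is \<open>\<alpha> t \<circ> A\<close> with \<open>\<alpha> = \<gamma> (\<phi> s \<xi>)\<close> and
  \<open>A = \<gamma> \<xi> s\<close>. As \<open>Gr (\<alpha> t \<circ> A) \<inter> Gr (\<alpha> t)\<close> has constant dimension, the unitary operator of this pair
  has no eigenvalue crossing 1, so its total angle varies by at most \<open>2 \<pi> N\<close>. This makes \<open>angle\<close>
  quasi-additive along the flow. A quasi-additive function is compared with the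
  Birkhoff sums of \<open>angle \<xi> k / k\<close> up to an error \<open>O(1 / k)\<close> per unit time, so Birkhoff's theorem
  gives convergence almost everywhere, and dominated convergence gives it in \<open>L1\<close>.\<close>

text \<open>HOL-Algebra's notation for inverses in a monoid would otherwise capture the inverse function
  in the theorem.\<close>

unbundle no m_inv_syntax

section \<open>Orthonormal systems and eigenbases\<close>

text \<open>The form behind the construction is \<open>- \<i> * \<Omega>\<close>. It is Hermitian,
  positive definite on \<open>Xplus\<close>, negative definite on \<open>Xminus\<close>, and these
  two subspaces are orthogonal for it. A Lagrangian subspace is null for this form, hence the graph
  of an isometry, and a pair of them gives a unitary operator. The obstacle is that eigenvalues on a
  circle have no canonical continuous labelling once they collide or wind around. Ordering their
  arguments inside a window of length 2 \<pi> leaves one ambiguity, the cyclic shift that moves the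
  least argument to the top. This shift changes the sum by 2 \<pi>, so prescribing the sum removes
  it, and the lift of the determinant from time 0 is what prescribes it. The ergodic argument is run
  on the angle rather than on the index, because the angle is continuous in the base point and
  therefore bounded on [0, 1] by compactness, uniformly in \<xi>. The index, an integer,
  jumps.\<close>

locale hermitian_form =
  fixes h :: "'x::complex_vector \<Rightarrow> 'x \<Rightarrow> complex"
  assumes sesquilinear: "sesquilinear h"
    and hermitian: "h y x = cnj (h x y)"
begin

lemma add_left: "h (x + x') y = h x y + h x' y"
  and scale_left: "h (c *\<^sub>C x) y = c * h x y"
  and add_right: "h x (y + y') = h x y + h x y'"
  and scale_right: "h x (c *\<^sub>C y) = cnj c * h x y"
  using sesquilinear unfolding sesquilinear_def by blast+

lemma zero_left [simp]: "h 0 y = 0"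
  using add_left[of 0 0 y] by simp

lemma zero_right [simp]: "h x 0 = 0"
  using add_right[of x 0 0] by simp

lemma diff_left: "h (x - x') y = h x y - h x' y"
  using add_left[of "x - x'" x' y] by simp

lemma diff_right: "h x (y - y') = h x y - h x y'"
  using add_right[of x "y - y'" y'] by simp

lemma sum_left: "h (\<Sum>i\<in>I. f i) y = (\<Sum>i\<in>I. h (f i) y)"
  by (induction I rule: infinite_finite_induct) (simp_all add: add_left)

lemma sum_right: "h x (\<Sum>i\<in>I. f i) = (\<Sum>i\<in>I. h x (f i))"
  by (induction I rule: infinite_finite_induct) (simp_all add: add_right)

lemma Im_self [simp]: "Im (h x x) = 0"
  using arg_cong[OF hermitian[of x x], of Im] by simp

lemma Re_self_eq: "h x x = complex_of_real (Re (h x x))"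
  by (simp add: complex_eq_iff)

definition orthonormal :: "nat \<Rightarrow> (nat \<Rightarrow> 'x) \<Rightarrow> bool"
  where "orthonormal N b \<longleftrightarrow> (\<forall>i<N. \<forall>j<N. h (b i) (b j) = (if i = j then 1 else 0))"

text \<open>Completeness is stated as the Fourier expansion, the form in which every later
  coordinate computation uses it.\<close>

definition onb :: "'x set \<Rightarrow> nat \<Rightarrow> (nat \<Rightarrow> 'x) \<Rightarrow> bool"
  where "onb Y N b \<longleftrightarrow> orthonormal N b \<and> (\<forall>i<N. b i \<in> Y) \<and>
    (\<forall>x\<in>Y. x = (\<Sum>i<N. h x (b i) *\<^sub>C b i))"

lemma orthonormal_sum:
  assumes "orthonormal N b" "J \<subseteq> {..<N}" "j < N"
  shows "h (\<Sum>i\<in>J. c i *\<^sub>C b i) (b j) = (if j \<in> J then c j else 0)"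
proof -
  have "h (\<Sum>i\<in>J. c i *\<^sub>C b i) (b j) = (\<Sum>i\<in>J. if i = j then c i else 0)"
    unfolding sum_left scale_left
    using assms by (intro sum.cong) (auto simp: orthonormal_def)
  also have "\<dots> = (if j \<in> J then c j else 0)"
    using finite_subset[OF assms(2)] by (simp add: sum.delta)
  finally show ?thesis .
qed

lemma orthonormal_inj_on:
  assumes "orthonormal N b"
  shows "inj_on b {..<N}"
proof (rule inj_onI)
  fix i j assume "i \<in> {..<N}" "j \<in> {..<N}" "b i = b j"
  then show "i = j"
    using assms unfolding orthonormal_def by (metis lessThan_iff zero_neq_one)
qed

lemma orthonormal_independent:
  assumes "orthonormal N b" "J \<subseteq> {..<N}"
  shows "complex_vector.independent (b ` J)" "card (b ` J) = card J"
proof -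
  have inj: "inj_on b J"
    using orthonormal_inj_on[OF assms(1)] assms(2) by (rule inj_on_subset)
  then show "card (b ` J) = card J"
    by (rule card_image)
  have fin: "finite J"
    using assms(2) finite_subset by blast
  show "complex_vector.independent (b ` J)"
  proof (rule complex_vector.independent_if_scalars_zero)
    show "finite (b ` J)"
      using fin by simp
    fix f x assume f: "(\<Sum>x\<in>b ` J. f x *\<^sub>C x) = 0" and "x \<in> b ` J"
    then obtain j where j: "j \<in> J" "x = b j"
      by auto
    have "(\<Sum>i\<in>J. f (b i) *\<^sub>C b i) = 0"
      using f by (simp add: sum.reindex[OF inj])
    with orthonormal_sum[OF assms, of j "\<lambda>i. f (b i)"] j assms(2) show "f x = 0"
      by auto
  qed
qed

lemma onb_dim:
  assumes "onb Y N b" "complex_vector.subspace Y"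
  shows "cdim Y = N"
proof (rule complex_vector.dim_unique)
  show "b ` {..<N} \<subseteq> Y" "complex_vector.independent (b ` {..<N})" "card (b ` {..<N}) = N"
    using assms orthonormal_independent[of N b "{..<N}"] by (auto simp: onb_def)
  show "Y \<subseteq> cspan (b ` {..<N})"
  proof
    fix x assume "x \<in> Y"
    then have "x = (\<Sum>i<N. h x (b i) *\<^sub>C b i)"
      using assms by (auto simp: onb_def)
    also have "\<dots> \<in> cspan (b ` {..<N})"
      by (intro complex_vector.span_sum complex_vector.span_scale complex_vector.span_base) auto
    finally show "x \<in> cspan (b ` {..<N})" .
  qed
qed

lemma onb_inner:
  assumes "onb Y N b" "x \<in> Y"
  shows "h x y = (\<Sum>i<N. h x (b i) * cnj (h y (b i)))"
proof -
  have "x = (\<Sum>i<N. h x (b i) *\<^sub>C b i)"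
    using assms unfolding onb_def by blast
  then have "h x y = h (\<Sum>i<N. h x (b i) *\<^sub>C b i) y"
    by (rule arg_cong)
  also have "\<dots> = (\<Sum>i<N. h x (b i) * cnj (h y (b i)))"
    unfolding sum_left scale_left by (intro sum.cong) (auto simp: hermitian[of y])
  finally show ?thesis .
qed

lemma onb_norm:
  assumes "onb Y N b" "x \<in> Y"
  shows "Re (h x x) = (\<Sum>i<N. (cmod (h x (b i)))\<^sup>2)"
  using arg_cong[OF onb_inner[OF assms, of x], of Re]
  by (simp only: complex_norm_square[symmetric] Re_sum Re_complex_of_real)

lemma onb_coeff_le:
  assumes "onb Y N b" "x \<in> Y" "i < N"
  shows "(cmod (h x (b i)))\<^sup>2 \<le> Re (h x x)"
  using member_le_sum[of i "{..<N}" "\<lambda>i. (cmod (h x (b i)))\<^sup>2"] assms(3)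
  by (simp add: onb_norm[OF assms(1,2)])

end

text \<open>Linearity is relative to \<open>Y\<close> because the operators of Lagrangian pairs come
  from definite descriptions and are controlled only on \<open>Y\<close>.\<close>

definition clinear_on :: "'x::complex_vector set \<Rightarrow> ('x \<Rightarrow> 'x) \<Rightarrow> bool"
  where "clinear_on Y T \<longleftrightarrow>
    (\<forall>x\<in>Y. \<forall>y\<in>Y. T (x + y) = T x + T y) \<and> (\<forall>c. \<forall>x\<in>Y. T (c *\<^sub>C x) = c *\<^sub>C T x)"

lemma clinear_on_0: "clinear_on Y T \<Longrightarrow> complex_vector.subspace Y \<Longrightarrow> T 0 = 0"
  unfolding clinear_on_def
  by (metis complex_vector.scale_zero_left complex_vector.subspace_0)

lemma clinear_on_sum:
  assumes "clinear_on Y T" "complex_vector.subspace Y" "\<And>i. i \<in> I \<Longrightarrow> f i \<in> Y"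
  shows "T (\<Sum>i\<in>I. c i *\<^sub>C f i) = (\<Sum>i\<in>I. c i *\<^sub>C T (f i))"
  using assms(3)
proof (induction I rule: infinite_finite_induct)
  case (insert j I)
  have "(\<Sum>i\<in>I. c i *\<^sub>C f i) \<in> Y" "c j *\<^sub>C f j \<in> Y"
    using insert assms(2)
    by (auto intro!: complex_vector.subspace_sum complex_vector.subspace_scale)
  then show ?case
    using insert assms(1) by (simp add: clinear_on_def)
qed (simp_all add: clinear_on_0[OF assms(1,2)])

text \<open>More vectors than the size of a spanning set are dependent. The family is indexed
  because it will consist of iterates of an operator, which may repeat; a repetition is itself a
  relation.\<close>

lemma finite_span_relation:
  fixes w :: "nat \<Rightarrow> 'x::complex_vector"
  assumes "finite S" "\<And>k. w k \<in> cspan S"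
  obtains n c where "\<exists>k\<le>n. c k \<noteq> 0" "(\<Sum>k\<le>n. c k *\<^sub>C w k) = 0"
proof (cases "inj_on w {..card S}")
  case True
  have "complex_vector.dependent (w ` {..card S})"
  proof (rule ccontr)
    assume "complex_vector.independent (w ` {..card S})"
    from complex_vector.independent_span_bound[OF assms(1) this] assms(2)
    have "card (w ` {..card S}) \<le> card S"
      by blast
    then show False
      by (simp add: card_image[OF True])
  qed
  then obtain u v where "v \<in> w ` {..card S}" "u v \<noteq> 0"
      "(\<Sum>v\<in>w ` {..card S}. u v *\<^sub>C v) = 0"
    by (auto simp: complex_vector.dependent_finite)
  then show thesis
    using that[of "card S" "\<lambda>k. u (w k)"] by (auto simp: sum.reindex[OF True])
next
  case False
  then obtain i j where ij: "i \<le> card S" "j \<le> card S" "i \<noteq> j" "w i = w j"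
    by (auto simp: inj_on_def)
  let ?c = "\<lambda>k. (if k = i then 1 else 0) - (if k = j then 1 else 0 :: complex)"
  have "(\<Sum>k\<le>card S. ?c k *\<^sub>C w k)
      = (\<Sum>k\<le>card S. if k = i then w k else 0) - (\<Sum>k\<le>card S. if k = j then w k else 0)"
    unfolding sum_subtractf[symmetric]
    by (intro sum.cong) (auto simp: complex_vector.scale_left_diff_distrib scaleC_one)
  also have "\<dots> = 0"
    using ij by simp
  finally show thesis
    by (rule that[rotated]) (use ij in \<open>auto intro!: exI[of _ i]\<close>)
qed

text \<open>The eigenvector is \<open>q(T) v\<close>, where \<open>(x - z) q\<close> is a polynomial of least degree that
  annihilates \<open>v\<close>.\<close>

lemma exists_eigenvector:
  assumes Y: "complex_vector.subspace Y" "Y \<subseteq> cspan S" "finite S"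
    and T: "clinear_on Y T" "T ` Y \<subseteq> Y" and v: "v \<in> Y" "v \<noteq> 0"
  obtains x z where "x \<in> Y" "x \<noteq> 0" "T x = z *\<^sub>C x"
proof -
  \<comment> \<open>\<open>E p\<close> is the vector \<open>p(T) v\<close> in Horner form, which
    fits induction over \<open>pCons\<close>.\<close>
  define E where "E p = fold_coeffs (\<lambda>a x. a *\<^sub>C v + T x) p 0" for p
  have E0 [simp]: "E 0 = 0"
    by (simp add: E_def)
  have EpCons: "E (pCons a p) = a *\<^sub>C v + T (E p)" for a p
    by (cases "p = 0 \<and> a = 0") (auto simp: E_def clinear_on_0[OF T(1) Y(1)])
  have TY: "T x \<in> Y" and Tscale: "T (c *\<^sub>C x) = c *\<^sub>C T x"
    and Tadd: "y \<in> Y \<Longrightarrow> T (x + y) = T x + T y" if "x \<in> Y" for x y c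
    using T that unfolding clinear_on_def by blast+
  have EY: "E p \<in> Y" for p
  proof (induction p)
    case 0
    show ?case
      using Y(1) by (simp add: complex_vector.subspace_0)
  next
    case (pCons a p)
    show ?case
      unfolding EpCons
      by (intro complex_vector.subspace_add[OF Y(1)] complex_vector.subspace_scale[OF Y(1)]
          TY pCons.IH v)
  qed
  have Eadd: "E (p + q) = E p + E q" for p q
    by (induction p q rule: poly_induct2) (simp_all add: EpCons Tadd EY scaleC_add_left)
  have Esmult: "E (Polynomial.smult c p) = c *\<^sub>C E p" for c p
    by (induction p) (simp_all add: EpCons Tscale EY scaleC_add_right scaleC_scaleC)
  have Esum: "E (\<Sum>k\<in>I. f k) = (\<Sum>k\<in>I. E (f k))" for f :: "nat \<Rightarrow> complex poly" and I
    by (induction I rule: infinite_finite_induct) (simp_all add: Eadd)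
  have Emonom: "E (monom c k) = c *\<^sub>C E (monom 1 k)" for c k
    using Esmult[of c "monom 1 k"] by (simp add: smult_monom)
  \<comment> \<open>A linear relation among \<open>v\<close>, \<open>T v\<close>,
    \<open>T (T v)\<close>, ... is a nonzero polynomial annihilating \<open>v\<close>.\<close>
  obtain n c where c: "\<exists>k\<le>n. c k \<noteq> 0" "(\<Sum>k\<le>n. c k *\<^sub>C E (monom 1 k)) = 0"
    using finite_span_relation[of S "\<lambda>k. E (monom 1 k)"] Y EY by blast
  let ?r = "\<Sum>k\<le>n. monom (c k) k"
  have "E ?r = 0"
    unfolding Esum using c(2) by (subst Emonom) simp
  moreover have "?r \<noteq> 0"
  proof
    assume r: "?r = 0"
    have "c k = 0" if "k \<le> n" for k
      using arg_cong[OF r, of "\<lambda>p. coeff p k"] that by (simp add: coeff_sum)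
    with c(1) show False
      by blast
  qed
  ultimately have "\<exists>p. (p \<noteq> 0 \<and> E p = 0) \<and> (\<forall>q. q \<noteq> 0 \<and> E q = 0 \<longrightarrow> degree p \<le> degree q)"
    by (intro ex_has_least_nat) blast
  then obtain p where p: "p \<noteq> 0" "E p = 0" and least: "\<And>q. q \<noteq> 0 \<Longrightarrow> E q = 0 \<Longrightarrow> degree p \<le> degree q"
    by blast
  have "degree p \<noteq> 0"
  proof
    assume "degree p = 0"
    then obtain a where a: "p = [:a:]"
      by (metis degree_eq_zeroE)
    with p have "a \<noteq> 0" "a *\<^sub>C v = 0"
      using clinear_on_0[OF T(1) Y(1)] by (auto simp: EpCons)
    with v(2) show False
      by simp
  qed
  then obtain z where "poly p z = 0"
    using fundamental_theorem_of_algebra[of p] by (auto simp: constant_degree)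
  then obtain q where q: "p = [:- z, 1:] * q"
    by (auto simp: poly_eq_0_iff_dvd)
  have "q \<noteq> 0"
    using q p by auto
  moreover have "degree p = Suc (degree q)"
    unfolding q using \<open>q \<noteq> 0\<close> by (subst degree_mult_eq) auto
  ultimately have Eq: "E q \<noteq> 0"
    using least[of q] by auto
  have "p = Polynomial.smult (- z) q + pCons 0 q"
    by (simp add: q)
  then have "0 = - z *\<^sub>C E q + T (E q)"
    using p(2) by (simp add: Eadd Esmult EpCons del: smult_minus_left)
  then have "T (E q) = z *\<^sub>C E q"
    by (simp add: eq_neg_iff_add_eq_0[symmetric] algebra_simps)
  then show thesis
    using that EY Eq by blast
qed

context hermitian_form
begin

text \<open>A maximal orthonormal system of eigenvectors is a basis: the hypothesis on \<open>T\<close> says that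
  the orthogonal complement of an eigenvector is invariant, so otherwise this complement would
  contain a further eigenvector.\<close>

lemma exists_eigenbasis:
  assumes Y: "complex_vector.subspace Y" "Y \<subseteq> cspan S" "finite S"
    and pos: "\<And>x. x \<in> Y \<Longrightarrow> x \<noteq> 0 \<Longrightarrow> 0 < Re (h x x)"
    and T: "clinear_on Y T" "T ` Y \<subseteq> Y"
    and complement: "\<And>x y z. x \<in> Y \<Longrightarrow> x \<noteq> 0 \<Longrightarrow> T x = z *\<^sub>C x \<Longrightarrow> y \<in> Y \<Longrightarrow> h y x = 0 \<Longrightarrow> h (T y) x = 0"
  obtains N b z where "onb Y N b" "\<And>i. i < N \<Longrightarrow> T (b i) = z i *\<^sub>C b i"
proof -
  define P where "P N \<longleftrightarrow> (\<exists>b z. orthonormal N b \<and> (\<forall>i<N. b i \<in> Y \<and> T (b i) = z i *\<^sub>C b i))" for N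
  have "P 0"
    by (simp add: P_def orthonormal_def)
  moreover have bound: "N \<le> card S" if PN: "P N" for N
  proof -
    obtain b where b: "orthonormal N b" "\<forall>i<N. b i \<in> Y"
      using PN unfolding P_def by blast
    have "b ` {..<N} \<subseteq> cspan S"
      using b(2) Y(2) by auto
    then have "card (b ` {..<N}) \<le> card S"
      using complex_vector.independent_span_bound[OF Y(3)] orthonormal_independent(1)[OF b(1)]
      by blast
    then show ?thesis
      using orthonormal_independent(2)[OF b(1), of "{..<N}"] by simp
  qed
  ultimately obtain N where N: "P N" and max: "\<And>k. P k \<Longrightarrow> k \<le> N"
    using Nat.ex_has_greatest_nat[of P 0 "card S"] by blast
  obtain b z where b: "orthonormal N b" "\<And>i. i < N \<Longrightarrow> b i \<in> Y" "\<And>i. i < N \<Longrightarrow> T (b i) = z i *\<^sub>C b i"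
    using N unfolding P_def by blast
  have bnz: "b i \<noteq> 0" if "i < N" for i
    using b(1) that unfolding orthonormal_def by (metis zero_left zero_neq_one)
  define Y' where "Y' = {y\<in>Y. \<forall>i<N. h y (b i) = 0}"
  have Y': "complex_vector.subspace Y'"
    using Y(1) unfolding Y'_def complex_vector.subspace_def
    by (auto simp: add_left scale_left)
  have "y = 0" if y: "y \<in> Y'" for y
  proof (rule ccontr)
    assume "y \<noteq> 0"
    have "T ` Y' \<subseteq> Y'"
    proof
      fix w assume "w \<in> T ` Y'"
      then obtain u where u: "w = T u" "u \<in> Y" "\<And>i. i < N \<Longrightarrow> h u (b i) = 0"
        by (auto simp: Y'_def)
      then show "w \<in> Y'"
        using T(2) complement[OF b(2) bnz b(3) u(2,3)] unfolding Y'_def by blast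
    qed
    moreover have "clinear_on Y' T"
      using T(1) unfolding clinear_on_def Y'_def by blast
    moreover have "Y' \<subseteq> cspan S"
      using Y(2) by (auto simp: Y'_def)
    ultimately obtain x r where x: "x \<in> Y'" "x \<noteq> 0" "T x = r *\<^sub>C x"
      using exists_eigenvector[of Y' S T y] Y' Y(3) y \<open>y \<noteq> 0\<close> by blast
    define e where "e = complex_of_real (1 / sqrt (Re (h x x))) *\<^sub>C x"
    have xY: "x \<in> Y" "\<And>i. i < N \<Longrightarrow> h x (b i) = 0"
      using x(1) by (auto simp: Y'_def)
    have px: "0 < Re (h x x)"
      using pos xY x(2) by blast
    have "h e e = complex_of_real (1 / sqrt (Re (h x x)) * (1 / sqrt (Re (h x x)))) * h x x"
      unfolding e_def scale_left scale_right complex_cnj_complex_of_real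
      by (simp only: of_real_mult mult.assoc)
    also have "\<dots> = complex_of_real (1 / sqrt (Re (h x x)) * (1 / sqrt (Re (h x x))) * Re (h x x))"
      by (metis Re_self_eq of_real_mult)
    also have "1 / sqrt (Re (h x x)) * (1 / sqrt (Re (h x x))) * Re (h x x) = 1"
      using px by (simp add: field_simps)
    finally have hee: "h e e = 1"
      by simp
    have eb: "h e (b i) = 0" "h (b i) e = 0" if "i < N" for i
      using xY(2)[OF that] hermitian[of "b i" x]
      by (auto simp: e_def scale_left scale_right)
    have "orthonormal (Suc N) (b(N := e))"
      using b(1) eb hee unfolding orthonormal_def by (auto simp: less_Suc_eq)
    moreover have "e \<in> Y"
      unfolding e_def using Y(1) xY(1) by (rule complex_vector.subspace_scale)
    moreover have "T e = r *\<^sub>C e"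
      using T(1) xY(1) x(3) by (simp add: e_def clinear_on_def scaleC_scaleC mult.commute)
    ultimately have "P (Suc N)"
      unfolding P_def using b
      by (intro exI[of _ "b(N := e)"] exI[of _ "z(N := r)"]) (auto simp: less_Suc_eq)
    then show False
      using max by fastforce
  qed
  note zero = this
  have "x = (\<Sum>i<N. h x (b i) *\<^sub>C b i)" if "x \<in> Y" for x
  proof -
    let ?s = "\<Sum>i<N. h x (b i) *\<^sub>C b i"
    have "?s \<in> Y"
      using Y(1) b(2) by (intro complex_vector.subspace_sum complex_vector.subspace_scale) auto
    then have "x - ?s \<in> Y"
      using Y(1) that by (intro complex_vector.subspace_diff)
    moreover have "h (x - ?s) (b i) = 0" if "i < N" for i
      using orthonormal_sum[OF b(1), of "{..<N}" i "\<lambda>i. h x (b i)"] that by (simp add: diff_left)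
    ultimately show ?thesis
      using zero[of "x - ?s"] by (simp add: Y'_def)
  qed
  then have "onb Y N b"
    using b by (simp add: onb_def)
  with b(3) that show thesis
    by blast
qed

text \<open>Every vector is an eigenvector of the identity, and the condition on complements is then
  trivial.\<close>

corollary exists_onb:
  assumes "complex_vector.subspace Y" "Y \<subseteq> cspan S" "finite S"
    and "\<And>x. x \<in> Y \<Longrightarrow> x \<noteq> 0 \<Longrightarrow> 0 < Re (h x x)"
  obtains N b where "onb Y N b"
proof (rule exists_eigenbasis[OF assms, of "\<lambda>x. x"])
  show thesis if "onb Y N b" for N b
    using \<open>\<And>N b. onb Y N b \<Longrightarrow> thesis\<close> that .
qed (auto simp: clinear_on_def)

text \<open>Comparing coordinates in \<open>T x = z *\<^sub>C x\<close> shows that \<open>x\<close>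
  has no component along any \<open>e j\<close> with \<open>l j \<noteq> z\<close>, so the remaining
  \<open>e j\<close> form a basis of the eigenspace.\<close>

lemma eigenspace_dim:
  assumes e: "onb Y N e" and Y: "complex_vector.subspace Y" and T: "clinear_on Y T"
    and eig: "\<And>i. i < N \<Longrightarrow> T (e i) = l i *\<^sub>C e i"
  shows "cdim {x\<in>Y. T x = z *\<^sub>C x} = card {i. i < N \<and> l i = z}"
proof (rule complex_vector.dim_unique)
  let ?J = "{i. i < N \<and> l i = z}"
  have J: "?J \<subseteq> {..<N}"
    by auto
  have on: "orthonormal N e" and eY: "\<And>i. i < N \<Longrightarrow> e i \<in> Y"
    and ex: "\<And>x. x \<in> Y \<Longrightarrow> x = (\<Sum>i<N. h x (e i) *\<^sub>C e i)"
    using e by (auto simp: onb_def)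
  show "e ` ?J \<subseteq> {x\<in>Y. T x = z *\<^sub>C x}"
    using eY eig by auto
  show "complex_vector.independent (e ` ?J)" "card (e ` ?J) = card ?J"
    using orthonormal_independent[OF on J] by auto
  show "{x\<in>Y. T x = z *\<^sub>C x} \<subseteq> cspan (e ` ?J)"
  proof safe
    fix x assume x: "x \<in> Y" "T x = z *\<^sub>C x"
    have "T x = (\<Sum>i<N. h x (e i) *\<^sub>C T (e i))"
      by (subst ex[OF x(1)], rule clinear_on_sum[OF T Y]) (use eY in auto)
    also have "\<dots> = (\<Sum>i<N. (h x (e i) * l i) *\<^sub>C e i)"
      by (intro sum.cong) (auto simp: eig scaleC_scaleC)
    finally have Tx: "T x = (\<Sum>i<N. (h x (e i) * l i) *\<^sub>C e i)" .
    have "h x (e j) = 0" if "j < N" "l j \<noteq> z" for j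
    proof -
      have "h (T x) (e j) = h x (e j) * l j"
        unfolding Tx using orthonormal_sum[OF on, of "{..<N}" j] that by simp
      moreover have "h (T x) (e j) = z * h x (e j)"
        by (simp add: x(2) scale_left)
      ultimately show ?thesis
        using that(2) by simp
    qed
    then have "x = (\<Sum>i\<in>?J. h x (e i) *\<^sub>C e i)"
      by (subst ex[OF x(1)], intro sum.mono_neutral_right) auto
    moreover have "(\<Sum>i\<in>?J. h x (e i) *\<^sub>C e i) \<in> cspan (e ` ?J)"
      by (intro complex_vector.span_sum complex_vector.span_scale complex_vector.span_base) auto
    ultimately show "x \<in> cspan (e ` ?J)"
      by simp
  qed
qed

end

section \<open>Unitary matrices and sorted eigenvalue angles\<close>

definition cdet :: "nat \<Rightarrow> (nat \<Rightarrow> nat \<Rightarrow> complex) \<Rightarrow> complex"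
  where "cdet N a = Determinant.det (Matrix.mat N N (\<lambda>(i, j). a i j))"

lemma cdet_mult:
  assumes "\<And>i j. i < N \<Longrightarrow> j < N \<Longrightarrow> c i j = (\<Sum>k<N. a i k * b k j)"
  shows "cdet N c = cdet N a * cdet N b"
proof -
  have "Matrix.mat N N (\<lambda>(i, j). c i j)
      = Matrix.mat N N (\<lambda>(i, j). a i j) * Matrix.mat N N (\<lambda>(i, j). b i j)"
    by (rule eq_matI) (auto simp: assms scalar_prod_def atLeast0LessThan)
  then show ?thesis
    unfolding cdet_def by (simp add: Determinant.det_mult[of _ N])
qed

lemma cdet_expand:
  "cdet N a = (\<Sum>p | p permutes {0..<N}. signof p * (\<Prod>i = 0..<N. a i (p i)))"
  unfolding cdet_def by (subst det_def'[of _ N]) (auto intro!: sum.cong prod.cong simp: permutes_in_image[where S = "{0..<N}", simplified])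

lemma cdet_diagonal:
  assumes "\<And>i j. i < N \<Longrightarrow> j < N \<Longrightarrow> a i j = (if i = j then d i else 0)"
  shows "cdet N a = (\<Prod>i<N. d i)"
proof -
  let ?A = "Matrix.mat N N (\<lambda>(i, j). a i j)"
  have "cdet N a = prod_list (diag_mat ?A)"
    unfolding cdet_def by (rule det_upper_triangular[of _ N]) (auto simp: assms)
  also have "\<dots> = (\<Prod>i<N. d i)"
    by (auto simp: prod_list_diag_prod assms atLeast0LessThan)
  finally show ?thesis .
qed

lemma tendsto_cdet:
  assumes "\<And>i j. i < N \<Longrightarrow> j < N \<Longrightarrow> ((\<lambda>p. a p i j) \<longlongrightarrow> a0 i j) F"
  shows "((\<lambda>p. cdet N (a p)) \<longlongrightarrow> cdet N a0) F"
  unfolding cdet_expand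
  by (intro tendsto_sum tendsto_mult tendsto_const tendsto_prod assms)
    (auto simp: permutes_in_image[where S = "{0..<N}", simplified])

text \<open>A unitary diagonalisation: the columns of \<open>E\<close> are orthonormal eigenvectors
  of \<open>a\<close>, and \<open>\<theta> j\<close> is an argument of the eigenvalue of column
  \<open>j\<close>.\<close>

definition eigframe ::
    "nat \<Rightarrow> (nat \<Rightarrow> nat \<Rightarrow> complex) \<Rightarrow> (nat \<Rightarrow> nat \<Rightarrow> complex) \<Rightarrow> (nat \<Rightarrow> real) \<Rightarrow> bool"
  where "eigframe N a E \<theta> \<longleftrightarrow>
    (\<forall>i<N. \<forall>j<N. (\<Sum>k<N. a i k * E k j) = E i j * exp (\<i> * complex_of_real (\<theta> j))) \<and>
    (\<forall>i<N. \<forall>j<N. (\<Sum>k<N. cnj (E k i) * E k j) = (if i = j then 1 else 0))"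

text \<open>Take determinants in \<open>a E = E D\<close> with \<open>D\<close> diagonal, and cancel
  \<open>cdet N E\<close>, which is nonzero because \<open>E\<close> has a left inverse.\<close>

lemma cdet_eigframe:
  assumes "eigframe N a E \<theta>"
  shows "cdet N a = exp (\<i> * complex_of_real (\<Sum>j<N. \<theta> j))"
proof -
  define D where "D i j = (if i = j then exp (\<i> * complex_of_real (\<theta> i)) else 0)" for i j
  define A where "A i j = (\<Sum>k<N. a i k * E k j)" for i j
  have "A i j = (\<Sum>k<N. E i k * D k j)" if "i < N" "j < N" for i j
  proof -
    have "(\<Sum>k<N. E i k * D k j) = (\<Sum>k<N. if k = j then E i k * exp (\<i> * complex_of_real (\<theta> k)) else 0)"
      by (intro sum.cong) (auto simp: D_def)
    also have "\<dots> = E i j * exp (\<i> * complex_of_real (\<theta> j))"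
      using that by simp
    finally show ?thesis
      using assms that by (simp add: eigframe_def A_def)
  qed
  then have "cdet N A = cdet N E * cdet N D"
    by (rule cdet_mult)
  moreover have "cdet N A = cdet N a * cdet N E"
    by (rule cdet_mult) (simp add: A_def)
  moreover have "cdet N D = (\<Prod>j<N. exp (\<i> * complex_of_real (\<theta> j)))"
    by (rule cdet_diagonal) (simp add: D_def)
  moreover have "cdet N E \<noteq> 0"
  proof -
    have "cdet N (\<lambda>i j. if i = j then 1 else 0) = cdet N (\<lambda>i j. cnj (E j i)) * cdet N E"
      by (rule cdet_mult) (use assms in \<open>simp add: eigframe_def\<close>)
    moreover have "cdet N (\<lambda>i j. if i = j then 1 else 0) = (\<Prod>j<N. 1)"
      by (rule cdet_diagonal) simp
    ultimately show ?thesis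
      by auto
  qed
  ultimately show ?thesis
    by (simp add: exp_sum sum_distrib_left)
qed

text \<open>The columns are unit vectors. The bound provides the compactness from which limits of
  frames are extracted.\<close>

lemma eigframe_entry_le:
  assumes "eigframe N a E \<theta>" "k < N" "j < N"
  shows "cmod (E k j) \<le> 1"
proof -
  have "1 = Re (\<Sum>k<N. cnj (E k j) * E k j)"
    using assms by (simp add: eigframe_def)
  also have "\<dots> = (\<Sum>k<N. (cmod (E k j))\<^sup>2)"
    unfolding Re_sum
    by (simp only: mult.commute[of "cnj _"] complex_norm_square[symmetric] Re_complex_of_real)
  finally have "(cmod (E k j))\<^sup>2 \<le> 1\<^sup>2"
    using member_le_sum[of k "{..<N}" "\<lambda>k. (cmod (E k j))\<^sup>2"] assms by simp
  then show ?thesis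
    by (rule power2_le_imp_le) simp
qed

lemma eigframe_reindex:
  assumes E: "eigframe N a E \<theta>" and p: "\<And>j. j < N \<Longrightarrow> p j < N" "inj_on p {..<N}"
    and "\<And>j. j < N \<Longrightarrow> exp (\<i> * complex_of_real (\<theta>' j)) = exp (\<i> * complex_of_real (\<theta> (p j)))"
  shows "eigframe N a (\<lambda>i j. E i (p j)) \<theta>'"
proof -
  have "p i = p j \<longleftrightarrow> i = j" if "i < N" "j < N" for i j
    using p(2) that by (auto simp: inj_on_def)
  then show ?thesis
    using assms unfolding eigframe_def by simp
qed

text \<open>All inequalities are weak, the one bounding the window included, so that the condition
  survives limits.\<close>

definition sorted_angles :: "nat \<Rightarrow> (nat \<Rightarrow> real) \<Rightarrow> bool"
  where "sorted_angles N \<theta> \<longleftrightarrow>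
    (\<forall>i<N. \<forall>j<N. (i \<le> j \<longrightarrow> \<theta> i \<le> \<theta> j) \<and> \<theta> j \<le> \<theta> i + 2 * pi)"

section \<open>Spectra on the unit circle and their counting function\<close>

definition same_spectrum :: "nat \<Rightarrow> (nat \<Rightarrow> real) \<Rightarrow> (nat \<Rightarrow> real) \<Rightarrow> bool"
  where "same_spectrum N \<theta> \<theta>' \<longleftrightarrow>
    (\<forall>z. card {j. j < N \<and> exp (\<i> * complex_of_real (\<theta> j)) = z}
       = card {j. j < N \<and> exp (\<i> * complex_of_real (\<theta>' j)) = z})"

text \<open>A counting function of the lifted spectrum: as \<open>x\<close> increases it jumps by
  one at every point \<open>\<theta> j + 2 \<pi> k\<close>. At \<open>x = 0\<close> it is minus the
  sum of the ceilings of \<open>\<theta> j / 2 \<pi>\<close>, which is how the Maslov index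
  enters.\<close>

definition floor_sum :: "nat \<Rightarrow> (nat \<Rightarrow> real) \<Rightarrow> real \<Rightarrow> int"
  where "floor_sum N \<theta> x = (\<Sum>j<N. \<lfloor>(x - \<theta> j) / (2 * pi)\<rfloor>)"

lemma same_spectrum_sum:
  fixes g :: "complex \<Rightarrow> real"
  assumes "same_spectrum N \<theta> \<theta>'"
  shows "(\<Sum>j<N. g (exp (\<i> * complex_of_real (\<theta> j)))) = (\<Sum>j<N. g (exp (\<i> * complex_of_real (\<theta>' j))))"
proof -
  let ?e = "\<lambda>\<theta> j. exp (\<i> * complex_of_real (\<theta> j))"
  define T where "T = ?e \<theta> ` {..<N} \<union> ?e \<theta>' ` {..<N}"
  have "(\<Sum>j<N. g (?e \<eta> j)) = (\<Sum>z\<in>T. real (card {j. j < N \<and> ?e \<eta> j = z}) * g z)"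
    if "?e \<eta> ` {..<N} \<subseteq> T" for \<eta> :: "nat \<Rightarrow> real"
  proof -
    have "(\<Sum>j<N. g (?e \<eta> j)) = (\<Sum>z\<in>T. \<Sum>j\<in>{j\<in>{..<N}. ?e \<eta> j = z}. g (?e \<eta> j))"
      using that by (intro sum.group[symmetric]) (auto simp: T_def)
    also have "\<dots> = (\<Sum>z\<in>T. real (card {j. j < N \<and> ?e \<eta> j = z}) * g z)"
      by (intro sum.cong refl) simp
    finally show ?thesis .
  qed
  then show ?thesis
    using assms unfolding same_spectrum_def T_def by auto
qed

lemma exp_ii_eq_iff:
  "exp (\<i> * complex_of_real s) = exp (\<i> * complex_of_real t) \<longleftrightarrow> (\<exists>k::int. s = t + 2 * pi * of_int k)"
proof -
  have "\<i> * complex_of_real s = \<i> * complex_of_real t + complex_of_int (2 * k) * complex_of_real pi * \<i>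
      \<longleftrightarrow> s = t + 2 * pi * of_int k" for k
    by (auto simp: complex_eq_iff mult_ac)
  then show ?thesis
    unfolding exp_eq by simp
qed

text \<open>A floor is a number minus its fractional part, and the fractional part of
  \<open>(x - \<theta> j) / 2 \<pi>\<close> depends only on the eigenvalue
  \<open>exp (\<i> \<theta> j)\<close>. Summed over equal spectra the fractional parts cancel, and
  only the sums of the angles remain.\<close>

lemma floor_sum_diff:
  assumes "same_spectrum N \<theta> \<theta>'"
  shows "real_of_int (floor_sum N \<theta> x) - real_of_int (floor_sum N \<theta>' x)
    = ((\<Sum>j<N. \<theta>' j) - (\<Sum>j<N. \<theta> j)) / (2 * pi)"
proof -
  \<comment> \<open>\<open>g\<close> reads the fractional part off the eigenvalue, through an
    arbitrarily chosen argument.\<close>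
  define g where "g z = frac ((x - (SOME t. exp (\<i> * complex_of_real t) = z)) / (2 * pi))" for z
  have g: "frac ((x - t) / (2 * pi)) = g (exp (\<i> * complex_of_real t))" for t
  proof -
    define s where "s = (SOME s. exp (\<i> * complex_of_real s) = exp (\<i> * complex_of_real t))"
    have "exp (\<i> * complex_of_real s) = exp (\<i> * complex_of_real t)"
      unfolding s_def by (rule someI) (rule refl)
    then obtain k where "s = t + 2 * pi * of_int k"
      unfolding exp_ii_eq_iff by blast
    then have "(x - t) / (2 * pi) = (x - s) / (2 * pi) + of_int k"
      by (simp add: field_simps)
    then show ?thesis
      unfolding g_def s_def by simp
  qed
  have *: "real_of_int (floor_sum N \<eta> x)
      = (real N * x - (\<Sum>j<N. \<eta> j)) / (2 * pi) - (\<Sum>j<N. g (exp (\<i> * complex_of_real (\<eta> j))))" for \<eta>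
    unfolding floor_sum_def g[symmetric] frac_def
    by (simp add: sum_subtractf sum_divide_distrib[symmetric])
  show ?thesis
    unfolding *[of \<theta>] *[of \<theta>'] using same_spectrum_sum[OF assms, of g]
    by (simp add: diff_divide_distrib)
qed

text \<open>If \<open>\<theta> j \<le> x\<close>, the terms up to \<open>j\<close> are nonnegative
  and, by the window condition, the other \<open>N - 1 - j\<close> terms are at least -1. If
  \<open>x < \<theta> j\<close>, the \<open>N - j\<close> terms from \<open>j\<close> on are at most
  -1 and the earlier ones at most 0. The two ranges of the sum are adjacent and disjoint.\<close>

lemma sorted_angles_le_iff:
  assumes "sorted_angles N \<theta>" "j < N"
  shows "\<theta> j \<le> x \<longleftrightarrow> int j + 1 - int N \<le> floor_sum N \<theta> x"
proof -
  let ?f = "\<lambda>i. \<lfloor>(x - \<theta> i) / (2 * pi)\<rfloor>"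
  have split: "floor_sum N \<theta> x = (\<Sum>i<j. ?f i) + (\<Sum>i=j..<N. ?f i)"
    and split': "floor_sum N \<theta> x = (\<Sum>i<Suc j. ?f i) + (\<Sum>i=Suc j..<N. ?f i)"
    unfolding floor_sum_def lessThan_atLeast0 using assms(2)
    by (intro sum.atLeastLessThan_concat[symmetric]; simp)+
  show ?thesis
  proof
    assume x: "\<theta> j \<le> x"
    have "0 \<le> ?f i" if "i < Suc j" for i
    proof -
      have "\<theta> i \<le> \<theta> j"
        using assms that by (simp add: sorted_angles_def)
      with x have "0 \<le> (x - \<theta> i) / (2 * pi)"
        by simp
      then show ?thesis
        by (simp only: zero_le_floor)
    qed
    then have 1: "0 \<le> (\<Sum>i<Suc j. ?f i)"
      by (intro sum_nonneg) auto
    have "- 1 \<le> ?f i" if "i < N" for i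
    proof -
      have "\<theta> i \<le> \<theta> j + 2 * pi"
        using assms that by (simp add: sorted_angles_def)
      with x have "\<theta> i \<le> x + 2 * pi"
        by simp
      then have "- 1 \<le> (x - \<theta> i) / (2 * pi)"
        by (simp add: field_simps)
      then show ?thesis
        by (simp add: le_floor_iff)
    qed
    then have "(\<Sum>i=Suc j..<N. - 1) \<le> (\<Sum>i=Suc j..<N. ?f i)"
      by (intro sum_mono) auto
    then show "int j + 1 - int N \<le> floor_sum N \<theta> x"
      using 1 assms(2) unfolding split' by (simp add: of_nat_diff)
  next
    assume *: "int j + 1 - int N \<le> floor_sum N \<theta> x"
    show "\<theta> j \<le> x"
    proof (rule ccontr)
      assume "\<not> \<theta> j \<le> x"
      then have x: "x < \<theta> j"
        by simp
      have "?f i \<le> - 1" if "i \<in> {j..<N}" for i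
      proof -
        have "\<theta> j \<le> \<theta> i"
          using assms that by (simp add: sorted_angles_def)
        with x have "x < \<theta> i"
          by simp
        then have "(x - \<theta> i) / (2 * pi) < 0"
          by (simp add: divide_less_0_iff)
        then have "?f i < 0"
          by (simp add: floor_less_iff)
        then show ?thesis
          by linarith
      qed
      then have 1: "(\<Sum>i=j..<N. ?f i) \<le> (\<Sum>i=j..<N. - 1)"
        by (intro sum_mono)
      have "?f i \<le> 0" if "i < j" for i
      proof -
        have "\<theta> j \<le> \<theta> i + 2 * pi"
          using assms that by (simp add: sorted_angles_def)
        with x have "(x - \<theta> i) / (2 * pi) < 1"
          by (simp add: field_simps)
        then have "?f i < 1"
          by (simp add: floor_less_iff)
        then show ?thesis
          by linarith
      qed
      then have "(\<Sum>i<j. ?f i) \<le> 0"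
        by (intro sum_nonpos) auto
      with 1 * assms(2) show False
        unfolding split by (simp add: of_nat_diff)
    qed
  qed
qed

text \<open>Equal spectra and equal sums give equal counting functions, and these determine which
  \<open>x\<close> lie above \<open>\<theta> j\<close>.\<close>

lemma sorted_angles_unique:
  assumes "sorted_angles N \<theta>" "sorted_angles N \<theta>'" "same_spectrum N \<theta> \<theta>'"
    and "(\<Sum>j<N. \<theta> j) = (\<Sum>j<N. \<theta>' j)" "j < N"
  shows "\<theta> j = \<theta>' j"
proof -
  have "floor_sum N \<theta> x = floor_sum N \<theta>' x" for x
    using floor_sum_diff[OF assms(3), of x] assms(4) by simp
  then have "\<theta> j \<le> x \<longleftrightarrow> \<theta>' j \<le> x" for x
    using sorted_angles_le_iff[OF assms(1,5)] sorted_angles_le_iff[OF assms(2,5)] by simp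
  then show ?thesis
    by (meson order_antisym order_refl)
qed

definition sorted_frame ::
    "nat \<Rightarrow> (nat \<Rightarrow> nat \<Rightarrow> complex) \<Rightarrow> real \<Rightarrow> (nat \<Rightarrow> nat \<Rightarrow> complex) \<Rightarrow> (nat \<Rightarrow> real) \<Rightarrow> bool"
  where "sorted_frame N a \<Theta> E \<theta> \<longleftrightarrow>
    eigframe N a E \<theta> \<and> sorted_angles N \<theta> \<and> (\<Sum>j<N. \<theta> j) = \<Theta>"

text \<open>The least angle is raised by 2 \<pi> and becomes the last one; order, window and
  eigenvectors are kept.\<close>

lemma sorted_frame_up:
  assumes "sorted_frame N a \<Theta> E \<theta>" "0 < N"
  shows "\<exists>E \<theta>. sorted_frame N a (\<Theta> + 2 * pi) E \<theta>"
proof -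
  define p where "p j = (if Suc j < N then Suc j else 0)" for j
  define \<eta> where "\<eta> j = (if Suc j < N then \<theta> (Suc j) else \<theta> 0 + 2 * pi)" for j
  have "eigframe N a (\<lambda>i j. E i (p j)) \<eta>"
  proof (rule eigframe_reindex)
    show "eigframe N a E \<theta>"
      using assms by (simp add: sorted_frame_def)
    show "inj_on p {..<N}"
      by (auto simp: inj_on_def p_def split: if_splits)
    show "p j < N" if "j < N" for j
      using assms(2) by (simp add: p_def)
    show "exp (\<i> * complex_of_real (\<eta> j)) = exp (\<i> * complex_of_real (\<theta> (p j)))" for j
      unfolding exp_ii_eq_iff \<eta>_def p_def by (auto intro: exI[of _ 0] exI[of _ 1])
  qed
  moreover have "sorted_angles N \<eta>"
    unfolding sorted_angles_def
  proof (intro allI impI conjI)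
    fix i j assume ij: "i < N" "j < N"
    have \<theta>: "\<And>i j. i < N \<Longrightarrow> j < N \<Longrightarrow> i \<le> j \<Longrightarrow> \<theta> i \<le> \<theta> j"
        "\<And>i j. i < N \<Longrightarrow> j < N \<Longrightarrow> \<theta> j \<le> \<theta> i + 2 * pi"
      using assms unfolding sorted_frame_def sorted_angles_def by auto
    show "\<eta> i \<le> \<eta> j" if "i \<le> j"
      using that ij assms(2) \<theta>(1)[of "Suc i" "Suc j"] \<theta>(2)[of 0 "Suc i"] by (auto simp: \<eta>_def)
    show "\<eta> j \<le> \<eta> i + 2 * pi"
      using ij assms(2) \<theta>(2)[of "Suc i" "Suc j"] \<theta>(2)[of 0 "Suc j"] \<theta>(1)[of 0 "Suc i"]
      by (auto simp: \<eta>_def; use pi_ge_zero in linarith)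
  qed
  moreover have "(\<Sum>j<N. \<eta> j) = \<Theta> + 2 * pi"
  proof -
    obtain n where n: "N = Suc n"
      using assms(2) gr0_implies_Suc by blast
    have "(\<Sum>j<N. \<eta> j) = (\<Sum>j<n. \<theta> (Suc j)) + (\<theta> 0 + 2 * pi)"
      by (simp add: n \<eta>_def)
    moreover have "\<Theta> = \<theta> 0 + (\<Sum>j<n. \<theta> (Suc j))"
      using assms(1) unfolding sorted_frame_def n sum.lessThan_Suc_shift by simp
    ultimately show ?thesis
      by simp
  qed
  ultimately show ?thesis
    unfolding sorted_frame_def by blast
qed

text \<open>The inverse rotation: the greatest angle is lowered by 2 \<pi> and becomes the first
  one.\<close>

lemma sorted_frame_down:
  assumes "sorted_frame N a \<Theta> E \<theta>" "0 < N"
  shows "\<exists>E \<theta>. sorted_frame N a (\<Theta> - 2 * pi) E \<theta>"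
proof -
  define p where "p j = (if j = 0 then N - 1 else j - 1)" for j
  define \<eta> where "\<eta> j = (if j = 0 then \<theta> (N - 1) - 2 * pi else \<theta> (j - 1))" for j
  have "eigframe N a (\<lambda>i j. E i (p j)) \<eta>"
  proof (rule eigframe_reindex)
    show "eigframe N a E \<theta>"
      using assms by (simp add: sorted_frame_def)
    show "inj_on p {..<N}"
      by (auto simp: inj_on_def p_def split: if_splits)
    show "p j < N" if "j < N" for j
      using that by (auto simp: p_def)
    show "exp (\<i> * complex_of_real (\<eta> j)) = exp (\<i> * complex_of_real (\<theta> (p j)))" for j
      unfolding exp_ii_eq_iff \<eta>_def p_def by (auto intro: exI[of _ 0] exI[of _ "-1"])
  qed
  moreover have "sorted_angles N \<eta>"
    unfolding sorted_angles_def
  proof (intro allI impI conjI)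
    fix i j assume "i < N" "j < N"
    then have ij: "i < N" "j < N" "i - 1 < N" "j - 1 < N" "N - 1 < N"
      by auto
    have \<theta>: "\<And>i j. i < N \<Longrightarrow> j < N \<Longrightarrow> i \<le> j \<Longrightarrow> \<theta> i \<le> \<theta> j"
        "\<And>i j. i < N \<Longrightarrow> j < N \<Longrightarrow> \<theta> j \<le> \<theta> i + 2 * pi"
      using assms unfolding sorted_frame_def sorted_angles_def by auto
    show "\<eta> i \<le> \<eta> j" if "i \<le> j"
      using that ij \<theta>(1)[of "i - 1" "j - 1"] \<theta>(2)[of "j - 1" "N - 1"] by (auto simp: \<eta>_def)
    show "\<eta> j \<le> \<eta> i + 2 * pi"
      using ij \<theta>(1)[of "j - 1" "N - 1"] \<theta>(2)[of "i - 1" "j - 1"] \<theta>(2)[of "i - 1" "N - 1"]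
      by (auto simp: \<eta>_def; use pi_ge_zero in linarith)
  qed
  moreover have "(\<Sum>j<N. \<eta> j) = \<Theta> - 2 * pi"
  proof -
    obtain n where n: "N = Suc n"
      using assms(2) gr0_implies_Suc by blast
    have "(\<Sum>j<N. \<eta> j) = \<theta> n - 2 * pi + (\<Sum>j<n. \<theta> j)"
      unfolding n sum.lessThan_Suc_shift by (simp add: \<eta>_def n)
    moreover have "\<Theta> = (\<Sum>j<n. \<theta> j) + \<theta> n"
      using assms(1) unfolding sorted_frame_def n by simp
    ultimately show ?thesis
      by simp
  qed
  ultimately show ?thesis
    unfolding sorted_frame_def by blast
qed

text \<open>Sorted arguments in \<open>[0, 2 \<pi>)\<close> satisfy the window condition. Their sum
  and \<open>\<Theta>\<close> are arguments of the same determinant, so they differ by a multiple of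
  2 \<pi>, which is made up by single rotations. An empty sum could not be rotated, hence
  \<open>0 < N\<close>.\<close>

lemma sorted_frame_exists:
  assumes E: "eigframe N a E \<theta>" and "0 < N" and \<Theta>: "cdet N a = exp (\<i> * complex_of_real \<Theta>)"
  shows "\<exists>E \<theta>. sorted_frame N a \<Theta> E \<theta>"
proof -
  define \<alpha> where "\<alpha> j = Arg2pi (exp (\<i> * complex_of_real (\<theta> j)))" for j
  define xs where "xs = sort_key \<alpha> [0..<N]"
  have xs: "length xs = N" "distinct xs" "set xs = {..<N}" "sorted (map \<alpha> xs)"
    by (auto simp: xs_def)
  have "eigframe N a (\<lambda>i j. E i (xs ! j)) (\<lambda>j. \<alpha> (xs ! j))"
  proof (rule eigframe_reindex[OF E])
    show "xs ! j < N" if "j < N" for j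
      using nth_mem[of j xs] that xs by auto
    show "inj_on (\<lambda>j. xs ! j) {..<N}"
      using inj_on_nth[OF xs(2)] xs(1) by simp
    show "exp (\<i> * complex_of_real (\<alpha> (xs ! j))) = exp (\<i> * complex_of_real (\<theta> (xs ! j)))" for j
      using Arg2pi_eq[of "exp (\<i> * complex_of_real (\<theta> (xs ! j)))"] by (simp add: \<alpha>_def)
  qed
  moreover have "sorted_angles N (\<lambda>j. \<alpha> (xs ! j))"
    unfolding sorted_angles_def
  proof (intro allI impI conjI)
    fix i j assume ij: "i < N" "j < N"
    show "\<alpha> (xs ! i) \<le> \<alpha> (xs ! j)" if "i \<le> j"
      using sorted_nth_mono[OF xs(4), of i j] that ij xs(1) by simp
    have "0 \<le> \<alpha> (xs ! i)" "\<alpha> (xs ! j) < 2 * pi"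
      by (simp_all add: \<alpha>_def Arg2pi_ge_0 Arg2pi_lt_2pi)
    then show "\<alpha> (xs ! j) \<le> \<alpha> (xs ! i) + 2 * pi"
      by linarith
  qed
  ultimately have *: "sorted_frame N a (\<Sum>j<N. \<alpha> (xs ! j)) (\<lambda>i j. E i (xs ! j)) (\<lambda>j. \<alpha> (xs ! j))"
    by (simp add: sorted_frame_def)
  then have "exp (\<i> * complex_of_real \<Theta>) = exp (\<i> * complex_of_real (\<Sum>j<N. \<alpha> (xs ! j)))"
    using cdet_eigframe \<Theta> unfolding sorted_frame_def by metis
  then obtain k :: int where k: "\<Theta> = (\<Sum>j<N. \<alpha> (xs ! j)) + 2 * pi * of_int k"
    unfolding exp_ii_eq_iff by blast
  have "\<exists>E \<theta>. sorted_frame N a ((\<Sum>j<N. \<alpha> (xs ! j)) + 2 * pi * of_int k) E \<theta>"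
  proof (induction k rule: int_induct[where k = 0])
    case base
    then show ?case
      using * by auto
  next
    case (step1 i)
    then show ?case
      using sorted_frame_up[OF _ \<open>0 < N\<close>] by (fastforce simp: algebra_simps)
  next
    case (step2 i)
    then show ?case
      using sorted_frame_down[OF _ \<open>0 < N\<close>] by (fastforce simp: algebra_simps)
  qed
  then show ?thesis
    by (simp add: k)
qed

subsection \<open>Continuity of the sorted angles\<close>

lemma bounded_family_subseq:
  fixes f :: "'i \<Rightarrow> nat \<Rightarrow> 'b::heine_borel"
  assumes "finite I" "\<And>i. i \<in> I \<Longrightarrow> bounded (range (f i))"
  shows "\<exists>l r. strict_mono r \<and> (\<forall>i\<in>I. (\<lambda>n. f i (r n)) \<longlonglongrightarrow> l i)"
  using assms
proof (induction I rule: finite_induct)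
  case empty
  show ?case
    using strict_mono_id by auto
next
  case (insert i I)
  then obtain l r where r: "strict_mono r" "\<forall>j\<in>I. (\<lambda>n. f j (r n)) \<longlonglongrightarrow> l j"
    by auto
  have "bounded (range (\<lambda>n. f i (r n)))"
    using insert.prems[of i] by (auto intro: bounded_subset)
  then obtain l' s where s: "strict_mono s" "((\<lambda>n. f i (r n)) \<circ> s) \<longlonglongrightarrow> l'"
    using bounded_imp_convergent_subsequence by blast
  have "(\<lambda>n. f j (r (s n))) \<longlonglongrightarrow> (l(i := l')) j" if "j \<in> insert i I" for j
    using that s r insert.hyps LIMSEQ_subseq_LIMSEQ[OF _ s(1), of "\<lambda>n. f j (r n)"]
    by (auto simp: o_def)
  moreover have "strict_mono (\<lambda>n. r (s n))"
    using r(1) s(1) by (simp add: strict_mono_def)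
  ultimately show ?case
    by (intro exI[of _ "l(i := l')"] exI[of _ "\<lambda>n. r (s n)"]) simp
qed

text \<open>All angles lie within 2 \<pi> of \<open>\<theta> j\<close>, and so does their
  mean.\<close>

lemma sorted_frame_bound:
  assumes "sorted_frame N a \<Theta> E \<theta>" "j < N"
  shows "\<bar>\<theta> j - \<Theta> / real N\<bar> \<le> 2 * pi"
proof -
  have s: "\<And>i. i < N \<Longrightarrow> \<theta> i \<le> \<theta> j + 2 * pi" "\<And>i. i < N \<Longrightarrow> \<theta> j - 2 * pi \<le> \<theta> i"
    using assms by (force simp: sorted_frame_def sorted_angles_def)+
  have "\<Theta> = (\<Sum>i<N. \<theta> i)"
    using assms by (simp add: sorted_frame_def)
  moreover have "(\<Sum>i<N. \<theta> i) \<le> (\<Sum>i<N. \<theta> j + 2 * pi)" "(\<Sum>i<N. \<theta> j - 2 * pi) \<le> (\<Sum>i<N. \<theta> i)"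
    using s by (auto intro!: sum_mono simp del: sum_constant)
  ultimately have "\<Theta> \<le> real N * (\<theta> j + 2 * pi)" "real N * (\<theta> j - 2 * pi) \<le> \<Theta>"
    by simp_all
  then have "\<Theta> / real N \<le> \<theta> j + 2 * pi" "\<theta> j - 2 * pi \<le> \<Theta> / real N"
    using assms(2) by (simp_all add: field_simps)
  then show ?thesis
    by linarith
qed

text \<open>The frames are bounded and the defining conditions closed, so along a subsequence that
  stays away from \<open>l\<close> a further subsequence converges to a sorted frame of the limit
  data, and uniqueness forces its angle to be \<open>l\<close>. Uniqueness is a hypothesis because
  it is obtained from eigenspace dimensions of the operator behind the matrix.\<close>

lemma sorted_frame_limit_seq:
  assumes frame: "\<And>n. sorted_frame N (a n) (\<Theta> n) (E n) (\<theta> n)"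
    and a: "\<And>i j. i < N \<Longrightarrow> j < N \<Longrightarrow> (\<lambda>n. a n i j) \<longlonglongrightarrow> a0 i j" and \<Theta>: "\<Theta> \<longlonglongrightarrow> \<Theta>0"
    and unique: "\<And>E \<theta>. sorted_frame N a0 \<Theta>0 E \<theta> \<Longrightarrow> \<theta> j = l" and j: "j < N"
  shows "(\<lambda>n. \<theta> n j) \<longlonglongrightarrow> l"
proof (rule ccontr)
  assume "\<not> (\<lambda>n. \<theta> n j) \<longlonglongrightarrow> l"
  then obtain e where e: "0 < e" "\<And>m. \<exists>n\<ge>m. e \<le> \<bar>\<theta> n j - l\<bar>"
    unfolding lim_sequentially dist_real_def by (meson not_less)
  have "\<exists>r::nat \<Rightarrow> nat. strict_mono r \<and> (\<forall>n. e \<le> \<bar>\<theta> (r n) j - l\<bar>)"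
  proof -
    have "infinite {n. e \<le> \<bar>\<theta> n j - l\<bar>}"
      unfolding infinite_nat_iff_unbounded_le using e(2) by auto
    from infinite_enumerate[OF this] show ?thesis
      by auto
  qed
  then obtain r :: "nat \<Rightarrow> nat" where r: "strict_mono r" "\<And>n. e \<le> \<bar>\<theta> (r n) j - l\<bar>"
    by blast
  \<comment> \<open>Angles, stored as an extra row of index \<open>N\<close>, and matrix entries
    form one finite family, so that one subsequence serves them all.\<close>
  define f where "f p n = (if fst p = N then complex_of_real (\<theta> (r n) (snd p)) else E (r n) (fst p) (snd p))"
    for p n
  have "bounded (range (f p))" if p: "p \<in> {..N} \<times> {..<N}" for p
  proof (cases "fst p = N")
    case True
    have "bounded (range \<Theta>)"
      using \<Theta> by (intro convergent_imp_bounded) auto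
    then obtain K where K: "\<And>n. \<bar>\<Theta> n\<bar> \<le> K"
      by (auto simp: bounded_iff)
    have "\<bar>\<theta> n (snd p)\<bar> \<le> 2 * pi + K / real N" for n
    proof -
      have "\<bar>\<Theta> n / real N\<bar> \<le> K / real N"
        using K[of n] by (simp add: divide_right_mono)
      moreover have "\<bar>\<theta> n (snd p) - \<Theta> n / real N\<bar> \<le> 2 * pi"
        by (rule sorted_frame_bound[OF frame[of n]]) (use p in auto)
      ultimately show ?thesis
        by linarith
    qed
    then show ?thesis
      by (auto simp: bounded_iff f_def True)
  next
    case False
    then have "cmod (f p n) \<le> 1" for n
      using eigframe_entry_le[of N "a (r n)" "E (r n)" "\<theta> (r n)" "fst p" "snd p"] frame[of "r n"] p
      by (auto simp: f_def sorted_frame_def)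
    then show ?thesis
      by (auto simp: bounded_iff)
  qed
  then have "\<exists>L s. strict_mono s \<and> (\<forall>p\<in>{..N} \<times> {..<N}. (\<lambda>n. f p (s n)) \<longlonglongrightarrow> L p)"
    by (intro bounded_family_subseq) auto
  then obtain L s where s: "strict_mono s"
    and L: "\<And>p. p \<in> {..N} \<times> {..<N} \<Longrightarrow> (\<lambda>n. f p (s n)) \<longlonglongrightarrow> L p"
    by blast
  define q where "q n = r (s n)" for n
  have q: "strict_mono q"
    using r(1) s by (simp add: strict_mono_def q_def)
  define \<theta>' where "\<theta>' i = Re (L (N, i))" for i
  define E' where "E' k i = L (k, i)" for k i
  have E': "(\<lambda>n. E (q n) k i) \<longlonglongrightarrow> E' k i" if "k < N" "i < N" for k i
    using L[of "(k, i)"] that by (simp add: f_def q_def E'_def)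
  have \<theta>': "(\<lambda>n. \<theta> (q n) i) \<longlonglongrightarrow> \<theta>' i" if "i < N" for i
    using tendsto_Re[OF L[of "(N, i)"]] that by (simp add: f_def q_def \<theta>'_def)
  have a': "(\<lambda>n. a (q n) i k) \<longlonglongrightarrow> a0 i k" if "i < N" "k < N" for i k
    using LIMSEQ_subseq_LIMSEQ[OF a[OF that] q] by (simp add: o_def)
  have fr: "sorted_frame N (a (q n)) (\<Theta> (q n)) (E (q n)) (\<theta> (q n))" for n
    by (rule frame)
  have "sorted_frame N a0 \<Theta>0 E' \<theta>'"
    unfolding sorted_frame_def eigframe_def sorted_angles_def
  proof (intro conjI allI impI)
    fix i k assume ik: "i < N" "k < N"
    have "(\<lambda>n. \<Sum>m<N. a (q n) i m * E (q n) m k) \<longlonglongrightarrow> (\<Sum>m<N. a0 i m * E' m k)"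
      using ik by (intro tendsto_sum tendsto_mult a' E') auto
    moreover have "(\<lambda>n. E (q n) i k * exp (\<i> * complex_of_real (\<theta> (q n) k)))
        \<longlonglongrightarrow> E' i k * exp (\<i> * complex_of_real (\<theta>' k))"
      using ik by (intro tendsto_intros E' \<theta>')
    moreover have "(\<Sum>m<N. a (q n) i m * E (q n) m k) = E (q n) i k * exp (\<i> * complex_of_real (\<theta> (q n) k))" for n
      using fr[of n] ik by (simp add: sorted_frame_def eigframe_def)
    ultimately show "(\<Sum>m<N. a0 i m * E' m k) = E' i k * exp (\<i> * complex_of_real (\<theta>' k))"
      using LIMSEQ_unique by auto
    have "(\<lambda>n. \<Sum>m<N. cnj (E (q n) m i) * E (q n) m k) \<longlonglongrightarrow> (\<Sum>m<N. cnj (E' m i) * E' m k)"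
      using ik by (intro tendsto_sum tendsto_mult tendsto_cnj E') auto
    moreover have "(\<Sum>m<N. cnj (E (q n) m i) * E (q n) m k) = (if i = k then 1 else 0)" for n
      using fr[of n] ik by (simp add: sorted_frame_def eigframe_def)
    ultimately have "(if i = k then 1 else 0) = (\<Sum>m<N. cnj (E' m i) * E' m k)"
      by (simp only: LIMSEQ_const_iff)
    then show "(\<Sum>m<N. cnj (E' m i) * E' m k) = (if i = k then 1 else 0)"
      by (rule sym)
    show "\<theta>' i \<le> \<theta>' k" if "i \<le> k"
    proof (rule LIMSEQ_le[OF \<theta>'[OF ik(1)] \<theta>'[OF ik(2)]])
      show "\<exists>m. \<forall>n\<ge>m. \<theta> (q n) i \<le> \<theta> (q n) k"
        using fr ik that by (auto simp: sorted_frame_def sorted_angles_def)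
    qed
    show "\<theta>' k \<le> \<theta>' i + 2 * pi"
    proof (rule LIMSEQ_le[OF \<theta>'[OF ik(2)]])
      show "(\<lambda>n. \<theta> (q n) i + 2 * pi) \<longlonglongrightarrow> \<theta>' i + 2 * pi"
        using ik by (intro tendsto_intros \<theta>')
      show "\<exists>m. \<forall>n\<ge>m. \<theta> (q n) k \<le> \<theta> (q n) i + 2 * pi"
        using fr ik by (auto simp: sorted_frame_def sorted_angles_def)
    qed
  next
    have "(\<lambda>n. \<Sum>i<N. \<theta> (q n) i) \<longlonglongrightarrow> (\<Sum>i<N. \<theta>' i)"
      by (intro tendsto_sum \<theta>') auto
    moreover have "(\<lambda>n. \<Sum>i<N. \<theta> (q n) i) = (\<lambda>n. \<Theta> (q n))"
      using fr by (simp add: sorted_frame_def)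
    ultimately show "(\<Sum>i<N. \<theta>' i) = \<Theta>0"
      using LIMSEQ_unique LIMSEQ_subseq_LIMSEQ[OF \<Theta> q] by (force simp: o_def)
  qed
  then have "\<theta>' j = l"
    by (rule unique)
  then have "(\<lambda>n. \<bar>\<theta> (q n) j - l\<bar>) \<longlonglongrightarrow> 0"
    using \<theta>'[OF j] by (simp add: LIM_zero tendsto_rabs_zero)
  then have "e \<le> 0"
    by (rule LIMSEQ_le_const) (simp add: q_def r(2))
  with e(1) show False
    by simp
qed

text \<open>The base space has no assumed countability, so filters cannot simply be replaced by
  sequences. Here closeness is measured by the single real function \<open>\<delta>\<close>, and a
  failure of convergence produces a sequence along which \<open>\<delta>\<close> vanishes in the
  limit.\<close>

lemma tendsto_via_sequences:
  fixes f \<delta> :: "'p \<Rightarrow> real"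
  assumes \<delta>: "(\<delta> \<longlongrightarrow> 0) F" and P: "eventually P F"
    and seq: "\<And>X. (\<And>n. P (X n)) \<Longrightarrow> (\<lambda>n. \<delta> (X n)) \<longlonglongrightarrow> 0 \<Longrightarrow> (\<lambda>n. f (X n)) \<longlonglongrightarrow> l"
  shows "(f \<longlongrightarrow> l) F"
proof (rule ccontr)
  assume "\<not> (f \<longlongrightarrow> l) F"
  then obtain e where e: "0 < e" "\<not> eventually (\<lambda>p. dist (f p) l < e) F"
    by (auto simp: tendsto_iff)
  have "\<exists>p. P p \<and> \<bar>\<delta> p\<bar> < inverse (real (Suc n)) \<and> \<not> dist (f p) l < e" for n
  proof (rule ccontr)
    assume *: "\<not> ?thesis"
    have "eventually (\<lambda>p. dist (\<delta> p) 0 < inverse (real (Suc n))) F"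
      using \<delta> by (rule tendstoD) simp
    with P have "eventually (\<lambda>p. dist (f p) l < e) F"
      by eventually_elim (use * in \<open>auto simp: dist_real_def\<close>)
    with e(2) show False ..
  qed
  then obtain X where X: "\<And>n. P (X n)" "\<And>n. \<bar>\<delta> (X n)\<bar> < inverse (real (Suc n))"
      "\<And>n. \<not> dist (f (X n)) l < e"
    by metis
  have "(\<lambda>n. \<delta> (X n)) \<longlonglongrightarrow> 0"
    by (rule Lim_null_comparison[OF _ LIMSEQ_inverse_real_of_nat])
      (use X(2) in \<open>auto intro!: always_eventually less_imp_le\<close>)
  then have "(\<lambda>n. f (X n)) \<longlonglongrightarrow> l"
    using seq X(1) by blast
  then have "eventually (\<lambda>n. dist (f (X n)) l < e) sequentially"
    using e(1) by (rule tendstoD)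
  with X(3) show False
    by simp
qed

lemma sorted_frame_tendsto:
  assumes "eventually (\<lambda>p. sorted_frame N (a p) (\<Theta> p) (E p) (\<theta> p)) F"
    and a: "\<And>i j. i < N \<Longrightarrow> j < N \<Longrightarrow> ((\<lambda>p. a p i j) \<longlongrightarrow> a0 i j) F" and \<Theta>: "(\<Theta> \<longlongrightarrow> \<Theta>0) F"
    and unique: "\<And>E \<theta>. sorted_frame N a0 \<Theta>0 E \<theta> \<Longrightarrow> \<theta> j = l" and j: "j < N"
  shows "((\<lambda>p. \<theta> p j) \<longlongrightarrow> l) F"
proof (rule tendsto_via_sequences)
  \<comment> \<open>The distance of the matrix and of the prescribed sum from their limits.\<close>
  define \<delta> where "\<delta> p = (\<Sum>i<N. \<Sum>j<N. cmod (a p i j - a0 i j)) + \<bar>\<Theta> p - \<Theta>0\<bar>" for p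
  have "(\<delta> \<longlongrightarrow> (\<Sum>i<N. \<Sum>j<N. cmod (a0 i j - a0 i j)) + \<bar>\<Theta>0 - \<Theta>0\<bar>) F"
    unfolding \<delta>_def by (intro tendsto_intros a \<Theta>) auto
  then show "(\<delta> \<longlongrightarrow> 0) F"
    by simp
  fix X assume X: "\<And>n. sorted_frame N (a (X n)) (\<Theta> (X n)) (E (X n)) (\<theta> (X n))"
    and \<delta>: "(\<lambda>n. \<delta> (X n)) \<longlonglongrightarrow> 0"
  show "(\<lambda>n. \<theta> (X n) j) \<longlonglongrightarrow> l"
  proof (rule sorted_frame_limit_seq[where a = "\<lambda>n. a (X n)" and \<Theta> = "\<lambda>n. \<Theta> (X n)"
        and E = "\<lambda>n. E (X n)" and \<theta> = "\<lambda>n. \<theta> (X n)"])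
    show "sorted_frame N (a (X n)) (\<Theta> (X n)) (E (X n)) (\<theta> (X n))" for n
      by (rule X)
    show "sorted_frame N a0 \<Theta>0 E \<theta> \<Longrightarrow> \<theta> j = l" for E \<theta>
      by (rule unique)
    show "j < N"
      by (rule j)
    fix i k assume ik: "i < N" "k < N"
    have "cmod (a p i k - a0 i k) \<le> \<delta> p" for p
    proof -
      have "cmod (a p i k - a0 i k) \<le> (\<Sum>j<N. cmod (a p i j - a0 i j))"
        using ik by (intro member_le_sum) auto
      also have "\<dots> \<le> (\<Sum>i<N. \<Sum>j<N. cmod (a p i j - a0 i j))"
        using ik by (intro member_le_sum[of i _ "\<lambda>i. \<Sum>j<N. cmod (a p i j - a0 i j)"])
          (auto intro: sum_nonneg)
      finally show ?thesis
        by (simp add: \<delta>_def)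
    qed
    then have "(\<lambda>n. a (X n) i k - a0 i k) \<longlonglongrightarrow> 0"
      by (intro Lim_null_comparison[OF _ \<delta>]) simp
    then show "(\<lambda>n. a (X n) i k) \<longlonglongrightarrow> a0 i k"
      by (simp add: LIM_zero_iff)
  next
    have "\<bar>\<Theta> p - \<Theta>0\<bar> \<le> \<delta> p" for p
      by (simp add: \<delta>_def sum_nonneg)
    then have "(\<lambda>n. \<Theta> (X n) - \<Theta>0) \<longlonglongrightarrow> 0"
      by (intro Lim_null_comparison[OF _ \<delta>]) simp
    then show "(\<lambda>n. \<Theta> (X n)) \<longlonglongrightarrow> \<Theta>0"
      by (simp add: LIM_zero_iff)
  qed
qed (fact assms(1))

section \<open>Isometries of a definite form\<close>

context hermitian_form
begin

definition opmat :: "(nat \<Rightarrow> 'x) \<Rightarrow> ('x \<Rightarrow> 'x) \<Rightarrow> nat \<Rightarrow> nat \<Rightarrow> complex"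
  where "opmat b W i j = h (W (b j)) (b i)"

lemma opmat_apply:
  assumes b: "onb Y N b" and Y: "complex_vector.subspace Y" and W: "clinear_on Y W" and x: "x \<in> Y"
  shows "h (W x) y = (\<Sum>k<N. h x (b k) * h (W (b k)) y)"
proof -
  have "x = (\<Sum>k<N. h x (b k) *\<^sub>C b k)" and bY: "\<And>k. k < N \<Longrightarrow> b k \<in> Y"
    using b x unfolding onb_def by blast+
  then have "W x = W (\<Sum>k<N. h x (b k) *\<^sub>C b k)"
    by (metis (no_types))
  also have "\<dots> = (\<Sum>k<N. h x (b k) *\<^sub>C W (b k))"
    by (rule clinear_on_sum[OF W Y]) (use bY in auto)
  finally show ?thesis
    by (simp add: sum_left scale_left)
qed

lemma opmat_comp:
  assumes "onb Y N b" "complex_vector.subspace Y" "clinear_on Y W" "V (b j) \<in> Y"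
  shows "opmat b (\<lambda>x. W (V x)) i j = (\<Sum>k<N. opmat b W i k * opmat b V k j)"
  unfolding opmat_def opmat_apply[OF assms(1-3,4)] by (simp add: mult.commute)

text \<open>A vector of \<open>Y\<close> outside the span of \<open>e\<close> would give
  \<open>N + 1\<close> independent vectors in the span of the \<open>N\<close> vectors
  \<open>b i\<close>.\<close>

lemma orthonormal_onb:
  assumes b: "onb Y N b" and e: "orthonormal N e" "\<And>i. i < N \<Longrightarrow> e i \<in> Y"
  shows "onb Y N e"
proof -
  have "x = (\<Sum>i<N. h x (e i) *\<^sub>C e i)" if x: "x \<in> Y" for x
  proof -
    have ind: "complex_vector.independent (e ` {..<N})" "card (e ` {..<N}) = N"
      using orthonormal_independent[OF e(1), of "{..<N}"] by auto
    have span: "Y \<subseteq> cspan (b ` {..<N})"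
    proof
      fix y assume "y \<in> Y"
      then have "y = (\<Sum>i<N. h y (b i) *\<^sub>C b i)"
        using b by (auto simp: onb_def)
      also have "\<dots> \<in> cspan (b ` {..<N})"
        by (intro complex_vector.span_sum complex_vector.span_scale complex_vector.span_base) auto
      finally show "y \<in> cspan (b ` {..<N})" .
    qed
    have "x \<in> cspan (e ` {..<N})"
    proof (rule ccontr)
      assume x': "x \<notin> cspan (e ` {..<N})"
      then have "complex_vector.independent (insert x (e ` {..<N}))"
        using complex_vector.independent_insertI ind(1) by blast
      moreover have "insert x (e ` {..<N}) \<subseteq> cspan (b ` {..<N})"
        using span x e(2) by auto
      ultimately have "card (insert x (e ` {..<N})) \<le> card (b ` {..<N})"
        using complex_vector.independent_span_bound[of "b ` {..<N}"] by auto
      moreover have "x \<notin> e ` {..<N}"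
        using x' complex_vector.span_base[of x "e ` {..<N}"] by blast
      ultimately have "Suc N \<le> card (b ` {..<N})"
        using ind(2) by simp
      then show False
        using card_image_le[of "{..<N}" b] by simp
    qed
    then obtain u where u: "x = (\<Sum>v\<in>e ` {..<N}. u v *\<^sub>C v)"
      unfolding complex_vector.span_finite[OF finite_imageI[OF finite_lessThan]] by auto
    have x_eq: "x = (\<Sum>i<N. u (e i) *\<^sub>C e i)"
      unfolding u by (simp add: sum.reindex[OF orthonormal_inj_on[OF e(1)]])
    have "h x (e j) = u (e j)" if "j < N" for j
      unfolding x_eq using orthonormal_sum[OF e(1), of "{..<N}" j "\<lambda>i. u (e i)"] that by simp
    then have "(\<Sum>i<N. u (e i) *\<^sub>C e i) = (\<Sum>i<N. h x (e i) *\<^sub>C e i)"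
      by (intro sum.cong) auto
    with x_eq show ?thesis
      by (rule trans)
  qed
  then show ?thesis
    using e by (simp add: onb_def)
qed

text \<open>An isometry has unimodular eigenvalues and preserves the orthogonal complement of an
  eigenvector, so an orthonormal eigenbasis exists; \<open>E\<close> lists its coordinates with
  respect to \<open>b\<close>.\<close>

lemma eigframe_exists:
  assumes b: "onb Y N b" and Y: "complex_vector.subspace Y" "Y \<subseteq> cspan S" "finite S"
    and pos: "\<And>x. x \<in> Y \<Longrightarrow> x \<noteq> 0 \<Longrightarrow> 0 < Re (h x x)"
    and W: "clinear_on Y W" "W ` Y \<subseteq> Y" and iso: "\<And>x y. x \<in> Y \<Longrightarrow> y \<in> Y \<Longrightarrow> h (W x) (W y) = h x y"
  shows "\<exists>E \<theta>. eigframe N (opmat b W) E \<theta>"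
proof -
  have unimodular: "z * cnj z = 1" if "x \<in> Y" "x \<noteq> 0" "W x = z *\<^sub>C x" for x z
  proof -
    have "h x x = z * cnj z * h x x"
      using iso[OF that(1,1)] by (simp add: that(3) scale_left scale_right mult.commute)
    moreover have "h x x \<noteq> 0"
      using pos[OF that(1,2)] by auto
    ultimately show ?thesis
      by simp
  qed
  have complement: "h (W y) x = 0" if "x \<in> Y" "x \<noteq> 0" "W x = z *\<^sub>C x" "y \<in> Y" "h y x = 0" for x y z
  proof -
    have "cnj z * h (W y) x = 0"
      using iso[OF that(4,1)] that(3,5) by (simp add: scale_right)
    moreover have "z \<noteq> 0"
      using unimodular[OF that(1-3)] by auto
    ultimately show ?thesis
      by simp
  qed
  have "\<exists>M e z. onb Y M e \<and> (\<forall>i<M. W (e i) = z i *\<^sub>C e i)"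
  proof (rule exists_eigenbasis[OF Y _ W])
    show "0 < Re (h x x)" if "x \<in> Y" "x \<noteq> 0" for x
      using that by (rule pos)
    show "h (W y) x = 0" if "x \<in> Y" "x \<noteq> 0" "W x = z *\<^sub>C x" "y \<in> Y" "h y x = 0" for x y z
      using that by (rule complement)
  qed blast
  then obtain M e z where e: "onb Y M e" and eig: "\<And>i. i < M \<Longrightarrow> W (e i) = z i *\<^sub>C e i"
    by blast
  have M: "M = N"
    using onb_dim[OF e Y(1)] onb_dim[OF b Y(1)] by simp
  have eY: "e i \<in> Y" and ee: "j < N \<Longrightarrow> h (e i) (e j) = (if i = j then 1 else 0)" if "i < N" for i j
    using e that unfolding M onb_def orthonormal_def by auto
  define E where "E i j = h (e j) (b i)" for i j
  have cm: "cmod w = 1" if "w * cnj w = 1" for w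
  proof -
    have "complex_of_real ((cmod w)\<^sup>2) = 1"
      using that by (simp only: complex_norm_square)
    then have "(cmod w)\<^sup>2 = 1\<^sup>2"
      by (simp only: of_real_eq_1_iff one_power2)
    then show ?thesis
      by (rule power2_eq_imp_eq) simp_all
  qed
  have z: "z j = exp (\<i> * complex_of_real (Arg (z j)))" if "j < N" for j
  proof -
    have "e j \<noteq> 0"
      using ee[OF that that] by auto
    then have "z j * cnj (z j) = 1"
      using unimodular eY eig that M by blast
    then have "cmod (z j) = 1"
      using cm[of "z j"] by simp
    moreover from this have "z j \<noteq> 0"
      by auto
    ultimately show ?thesis
      using Arg_eq[of "z j"] by simp
  qed
  have "eigframe N (opmat b W) E (\<lambda>j. Arg (z j))"
    unfolding eigframe_def
  proof (intro conjI allI impI)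
    fix i j assume ij: "i < N" "j < N"
    have "(\<Sum>k<N. opmat b W i k * E k j) = h (W (e j)) (b i)"
      unfolding opmat_apply[OF b Y(1) W(1) eY[OF ij(2)]] by (simp add: opmat_def E_def mult.commute)
    also have "\<dots> = z j * E i j"
      using eig ij by (simp add: M scale_left E_def)
    finally show "(\<Sum>k<N. opmat b W i k * E k j) = E i j * exp (\<i> * complex_of_real (Arg (z j)))"
      using z[OF ij(2)] by (metis mult.commute)
    have "(\<Sum>k<N. cnj (E k i) * E k j) = h (e j) (e i)"
      by (subst onb_inner[OF b eY[OF ij(2)]]) (simp add: E_def mult.commute)
    then show "(\<Sum>k<N. cnj (E k i) * E k j) = (if i = j then 1 else 0)"
      using ee ij by simp
  qed
  then show ?thesis
    by blast
qed

text \<open>The columns of any frame, read as coordinates, form an orthonormal eigenbasis. The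
  right-hand side is thus the same for every frame, so two frames of one operator have the same
  spectrum.\<close>

lemma eigframe_multiplicity:
  assumes b: "onb Y N b" and Y: "complex_vector.subspace Y"
    and W: "clinear_on Y W" "W ` Y \<subseteq> Y" and E: "eigframe N (opmat b W) E \<theta>"
  shows "cdim {x\<in>Y. W x = z *\<^sub>C x} = card {j. j < N \<and> exp (\<i> * complex_of_real (\<theta> j)) = z}"
proof -
  define e where "e j = (\<Sum>i<N. E i j *\<^sub>C b i)" for j
  have on: "orthonormal N b" and bY: "\<And>i. i < N \<Longrightarrow> b i \<in> Y"
    using b by (auto simp: onb_def)
  have eY: "e j \<in> Y" for j
    unfolding e_def
    by (intro complex_vector.subspace_sum complex_vector.subspace_scale Y) (simp add: bY)
  have eb: "h (e j) (b k) = E k j" if "k < N" for j k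
    unfolding e_def using orthonormal_sum[OF on, of "{..<N}" k] that by simp
  have "h (e j) (e i) = (if j = i then 1 else 0)" if "i < N" "j < N" for i j
    using E that by (subst onb_inner[OF b eY]) (simp add: eb eigframe_def mult.commute)
  then have "orthonormal N e"
    by (simp add: orthonormal_def)
  then have e: "onb Y N e"
    using eY by (rule orthonormal_onb[OF b])
  have "W (e j) = exp (\<i> * complex_of_real (\<theta> j)) *\<^sub>C e j" if j: "j < N" for j
  proof -
    have WY: "W (e j) \<in> Y"
      using W(2) eY by blast
    have "h (W (e j)) (b i) = E i j * exp (\<i> * complex_of_real (\<theta> j))" if "i < N" for i
      unfolding opmat_apply[OF b Y W(1) eY] using E that j
      by (simp add: eb opmat_def eigframe_def mult.commute)
    then have "(\<Sum>i<N. h (W (e j)) (b i) *\<^sub>C b i)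
        = (\<Sum>i<N. (E i j * exp (\<i> * complex_of_real (\<theta> j))) *\<^sub>C b i)"
      by (intro sum.cong) auto
    moreover have "W (e j) = (\<Sum>i<N. h (W (e j)) (b i) *\<^sub>C b i)"
      using b WY unfolding onb_def by blast
    ultimately have "W (e j) = (\<Sum>i<N. (E i j * exp (\<i> * complex_of_real (\<theta> j))) *\<^sub>C b i)"
      by (rule trans[rotated])
    then show ?thesis
      by (simp add: e_def complex_vector.scale_sum_right scaleC_scaleC mult.commute)
  qed
  then show ?thesis
    by (rule eigenspace_dim[OF e Y W(1)])
qed

lemma orthogonal_projection:
  assumes "complex_vector.subspace P" "P \<subseteq> cspan S" "finite S"
    and "\<And>x. x \<in> P \<Longrightarrow> x \<noteq> 0 \<Longrightarrow> 0 < Re (h x x)"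
  obtains p where "p \<in> P" "\<And>q. q \<in> P \<Longrightarrow> h (x - p) q = 0"
proof -
  obtain N b where b: "onb P N b"
    using exists_onb[OF assms] by blast
  then have on: "orthonormal N b" and bP: "\<And>i. i < N \<Longrightarrow> b i \<in> P"
    by (auto simp: onb_def)
  let ?p = "\<Sum>i<N. h x (b i) *\<^sub>C b i"
  have p: "?p \<in> P"
    by (intro complex_vector.subspace_sum complex_vector.subspace_scale assms(1)) (simp add: bP)
  have "h (x - ?p) q = 0" if "q \<in> P" for q
  proof -
    have "h (x - ?p) (b i) = 0" if "i < N" for i
      using orthonormal_sum[OF on, of "{..<N}" i "\<lambda>i. h x (b i)"] that by (simp add: diff_left)
    then have "h (x - ?p) (\<Sum>i<N. h q (b i) *\<^sub>C b i) = 0"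
      unfolding sum_right scale_right by (intro sum.neutral) simp
    moreover have q: "q = (\<Sum>i<N. h q (b i) *\<^sub>C b i)"
      using b that unfolding onb_def by blast
    ultimately show ?thesis
      by (subst q)
  qed
  with p that show thesis
    by blast
qed

end

section \<open>Lagrangian subspaces as graphs of isometries\<close>

lemma finite_dimensional_basis:
  fixes S :: "'x::complex_vector set"
  assumes "finite S" "cspan S = UNIV"
  obtains B where "finite_dimensional_vector_space (scaleC :: complex \<Rightarrow> 'x \<Rightarrow> 'x) B"
proof -
  obtain B where B: "B \<subseteq> S" "complex_vector.independent B" "S \<subseteq> cspan B"
    using complex_vector.maximal_independent_subset[of S] by blast
  then have "cspan B = UNIV"
    using assms(2) complex_vector.span_mono[of S "cspan B"] by (simp add: complex_vector.span_span top.extremum_unique)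
  then have "finite_dimensional_vector_space (scaleC :: complex \<Rightarrow> 'x \<Rightarrow> 'x) B"
    using B assms(1) by unfold_locales (auto intro: finite_subset)
  then show thesis
    by (rule that)
qed

text \<open>Abstracts \<open>- \<i> * \<Omega>\<close> with \<open>Y = Xplus\<close> and
  \<open>Z = Xminus\<close>: an orthogonal splitting into a positive and a negative part. Sums are
  written \<open>z + y\<close> because Lagrangian subspaces appear as graphs over
  \<open>Z\<close>.\<close>

locale split_form = hermitian_form h
  for h :: "'x::complex_vector \<Rightarrow> 'x \<Rightarrow> complex" +
  fixes Y Z S :: "'x set"
  assumes subspaces: "complex_vector.subspace Y" "complex_vector.subspace Z"
    and finite_span: "finite S" "cspan S = UNIV"
    and pos: "y \<in> Y \<Longrightarrow> y \<noteq> 0 \<Longrightarrow> 0 < Re (h y y)"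
    and neg: "z \<in> Z \<Longrightarrow> z \<noteq> 0 \<Longrightarrow> Re (h z z) < 0"
    and cross: "y \<in> Y \<Longrightarrow> z \<in> Z \<Longrightarrow> h y z = 0"
    and decompose: "\<exists>y\<in>Y. \<exists>z\<in>Z. x = z + y"
begin

lemma cross': "y \<in> Y \<Longrightarrow> z \<in> Z \<Longrightarrow> h z y = 0"
  using cross[of y z] hermitian[of z y] by simp

text \<open>A change of sign exchanges the two parts, so results proved for the positive part
  transfer to the negative one.\<close>

lemma split_form_flip: "split_form (\<lambda>x y. - h x y) Z Y S"
proof unfold_locales
  show "sesquilinear (\<lambda>x y. - h x y)"
    by (auto simp: sesquilinear_def add_left add_right scale_left scale_right)
  show "- h y x = cnj (- h x y)" for x y
    using hermitian[of x y] by simp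
  show "\<exists>y\<in>Z. \<exists>z\<in>Y. x = z + y" for x
    using decompose[of x] by (metis add.commute)
qed (use subspaces finite_span pos neg cross' in auto)

text \<open>Annihilators with respect to \<open>- \<i> * \<Omega>\<close> and to
  \<open>\<Omega>\<close> coincide, so this is the usual notion.\<close>

definition lagrangian :: "'x set \<Rightarrow> bool"
  where "lagrangian L \<longleftrightarrow> complex_vector.subspace L \<and> (\<forall>x. x \<in> L \<longleftrightarrow> (\<forall>y\<in>L. h x y = 0))"

text \<open>This and \<open>pair_op\<close> copy \<open>lag_map\<close> and
  \<open>lag_pair_op\<close> with \<open>Y\<close>, \<open>Z\<close> in place of the eigenspace
  sums, which makes the later identification immediate.\<close>

definition graph_map :: "'x set \<Rightarrow> 'x \<Rightarrow> 'x"
  where "graph_map L x = (THE y. y \<in> Y \<and> x + y \<in> L)"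

definition pair_op :: "'x set \<Rightarrow> 'x set \<Rightarrow> 'x \<Rightarrow> 'x"
  where "pair_op L L' z = graph_map L (inv_into Z (graph_map L') z)"

section \<open>Lagrangian subspaces and the unitary operator of a pair\<close>

lemmas lin_closed =
  complex_vector.subspace_add[OF subspaces(1)] complex_vector.subspace_add[OF subspaces(2)]
  complex_vector.subspace_diff[OF subspaces(1)] complex_vector.subspace_diff[OF subspaces(2)]
  complex_vector.subspace_scale[OF subspaces(1)] complex_vector.subspace_scale[OF subspaces(2)]
  complex_vector.subspace_0[OF subspaces(1)] complex_vector.subspace_0[OF subspaces(2)]

lemma lagrangian_subspace: "lagrangian L \<Longrightarrow> complex_vector.subspace L"
  unfolding lagrangian_def by (rule conjunct1)

lemma lagrangian_iff: "lagrangian L \<Longrightarrow> x \<in> L \<longleftrightarrow> (\<forall>y\<in>L. h x y = 0)"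
  unfolding lagrangian_def by (elim conjE allE)

lemma lagrangian_closed:
  assumes "lagrangian L" "x \<in> L" "y \<in> L"
  shows "x + y \<in> L" "x - y \<in> L" "c *\<^sub>C x \<in> L" "h x y = 0"
proof -
  have s: "complex_vector.subspace L"
    using assms(1) by (rule lagrangian_subspace)
  show "h x y = 0"
    using lagrangian_iff[OF assms(1), of x] assms(2,3) by blast
  show "x + y \<in> L" "x - y \<in> L" "c *\<^sub>C x \<in> L"
    using assms(2,3) by (simp_all add: complex_vector.subspace_add[OF s]
        complex_vector.subspace_diff[OF s] complex_vector.subspace_scale[OF s])
qed

text \<open>The form vanishes on \<open>L\<close> and is definite on \<open>Y\<close>; the same
  reason excludes nonzero vectors of \<open>Z\<close> in \<open>L\<close>.\<close>

lemma lagrangian_Y: "lagrangian L \<Longrightarrow> y \<in> L \<Longrightarrow> y \<in> Y \<Longrightarrow> y = 0"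
  using lagrangian_closed(4)[of L y y] pos[of y] by force

lemma lagrangian_Z: "lagrangian L \<Longrightarrow> z \<in> L \<Longrightarrow> z \<in> Z \<Longrightarrow> z = 0"
  using lagrangian_closed(4)[of L z z] neg[of z] by force

text \<open>The part of \<open>z\<close> orthogonal to the projection of \<open>L\<close> annihilates \<open>L\<close>, so it lies in
  \<open>L \<inter> Z\<close> and vanishes.\<close>

lemma lagrangian_over_Z:
  assumes L: "lagrangian L" and z: "z \<in> Z"
  shows "\<exists>y\<in>Y. z + y \<in> L"
proof -
  interpret flip: split_form "\<lambda>x y. - h x y" Z Y S
    by (rule split_form_flip)
  define P where "P = {z\<in>Z. \<exists>y\<in>Y. z + y \<in> L}"
  have P: "complex_vector.subspace P"
    unfolding complex_vector.subspace_def
  proof (intro conjI ballI allI)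
    show "0 \<in> P"
      using lin_closed(7,8) complex_vector.subspace_0[OF lagrangian_subspace[OF L]]
      by (auto simp: P_def intro!: bexI[of _ 0])
    fix x assume "x \<in> P"
    then obtain v where x: "x \<in> Z" "v \<in> Y" "x + v \<in> L"
      by (auto simp: P_def)
    show "c *\<^sub>C x \<in> P" for c
      using lin_closed(5)[OF x(2), of c] lin_closed(6)[OF x(1), of c] lagrangian_closed(3)[OF L x(3,3), of c]
      by (auto simp: P_def scaleC_add_right)
    fix y assume "y \<in> P"
    then obtain w where y: "y \<in> Z" "w \<in> Y" "y + w \<in> L"
      by (auto simp: P_def)
    have "x + y + (v + w) \<in> L"
      using lagrangian_closed(1)[OF L x(3) y(3)] by (simp add: algebra_simps)
    then show "x + y \<in> P"
      using lin_closed(1)[OF x(2) y(2)] lin_closed(2)[OF x(1) y(1)] by (auto simp: P_def)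
  qed
  have PZ: "P \<subseteq> Z"
    by (auto simp: P_def)
  have "P \<subseteq> cspan S" "0 < Re (- h x x)" if "x \<in> P" "x \<noteq> 0" for x
    using finite_span(2) PZ neg that by auto
  then obtain p where p: "p \<in> P" "\<And>q. q \<in> P \<Longrightarrow> - h (z - p) q = 0"
    using flip.orthogonal_projection[of P S z] P finite_span by (metis UNIV_I subsetI)
  have zp: "z - p \<in> Z"
    using z p(1) PZ lin_closed(4) by blast
  have "h (z - p) l = 0" if l: "l \<in> L" for l
  proof -
    obtain y w where yw: "y \<in> Y" "w \<in> Z" "l = w + y"
      using decompose[of l] by blast
    with l have "w \<in> P"
      by (auto simp: P_def)
    then show ?thesis
      using p(2)[of w] cross'[OF yw(1) zp] by (simp add: yw(3) add_right)
  qed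
  then have "z - p \<in> L"
    using lagrangian_iff[OF L] by blast
  then have "z = p"
    using lagrangian_Z[OF L _ zp] by simp
  with p(1) show ?thesis
    by (auto simp: P_def)
qed

lemma lagrangian_over_Y:
  assumes L: "lagrangian L" and y: "y \<in> Y"
  shows "\<exists>z\<in>Z. z + y \<in> L"
proof -
  interpret flip: split_form "\<lambda>x y. - h x y" Z Y S
    by (rule split_form_flip)
  have "flip.lagrangian L"
    using L unfolding flip.lagrangian_def lagrangian_def neg_equal_0_iff_equal .
  from flip.lagrangian_over_Z[OF this y] show ?thesis
    by (metis add.commute)
qed

lemma graph_map_eq:
  assumes L: "lagrangian L" and "y \<in> Y" "x + y \<in> L"
  shows "graph_map L x = y"
  unfolding graph_map_def
proof (rule the_equality)
  show "y' = y" if "y' \<in> Y \<and> x + y' \<in> L" for y'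
  proof -
    have "(x + y') - (x + y) \<in> L" "y' - y \<in> Y"
      using that assms lagrangian_closed(2)[OF L] lin_closed(3) by blast+
    then show ?thesis
      using lagrangian_Y[OF L, of "y' - y"] by simp
  qed
qed (use assms in simp)

text \<open>A single \<open>x\<close> in \<open>Z\<close> below both \<open>y\<close> and
  \<open>w\<close> witnesses the value: \<open>x\<close> is the preimage of \<open>y\<close> under
  the graph map of \<open>L'\<close>, which is injective because \<open>L'\<close> meets
  \<open>Z\<close> only in 0. Through this rule the properties of \<open>pair_op\<close> are proved
  without unfolding its choice operators.\<close>

lemma pair_op_eq:
  assumes L: "lagrangian L" "lagrangian L'" and "x \<in> Z" "y \<in> Y" "w \<in> Y" "x + y \<in> L'" "x + w \<in> L"
  shows "pair_op L L' y = w"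
proof -
  have "inj_on (graph_map L') Z"
  proof (rule inj_onI)
    fix u v assume uv: "u \<in> Z" "v \<in> Z" "graph_map L' u = graph_map L' v"
    obtain u' v' where u': "u' \<in> Y" "u + u' \<in> L'" and v': "v' \<in> Y" "v + v' \<in> L'"
      using lagrangian_over_Z[OF L(2)] uv by meson
    then have "u' = v'"
      using uv(3) graph_map_eq[OF L(2)] by metis
    then have "u - v \<in> L'"
      using lagrangian_closed(2)[OF L(2) u'(2) v'(2)] by simp
    then show "u = v"
      using lagrangian_Z[OF L(2), of "u - v"] lin_closed(4) uv by auto
  qed
  then have "inv_into Z (graph_map L') y = x"
    using assms graph_map_eq[OF L(2)] by (intro inv_into_f_eq) auto
  then show ?thesis
    using graph_map_eq[OF L(1)] assms by (simp add: pair_op_def)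
qed

lemma pair_opE:
  assumes L: "lagrangian L" "lagrangian L'" and y: "y \<in> Y"
  obtains x where "x \<in> Z" "x + y \<in> L'" "x + pair_op L L' y \<in> L" "pair_op L L' y \<in> Y"
proof -
  obtain x where x: "x \<in> Z" "x + y \<in> L'"
    using lagrangian_over_Y[OF L(2) y] by blast
  moreover obtain w where "w \<in> Y" "x + w \<in> L"
    using lagrangian_over_Z[OF L(1) x(1)] by blast
  ultimately show thesis
    using that pair_op_eq[OF L _ y] by metis
qed

lemma pair_op_clinear:
  assumes L: "lagrangian L" "lagrangian L'"
  shows "clinear_on Y (pair_op L L')"
  unfolding clinear_on_def
proof (intro conjI ballI allI)
  fix y assume y: "y \<in> Y"
  obtain x where x: "x \<in> Z" "x + y \<in> L'" "x + pair_op L L' y \<in> L" "pair_op L L' y \<in> Y"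
    using pair_opE[OF L y] .
  show "pair_op L L' (c *\<^sub>C y) = c *\<^sub>C pair_op L L' y" for c
  proof (rule pair_op_eq[OF L])
    show "c *\<^sub>C x + c *\<^sub>C y \<in> L'" "c *\<^sub>C x + c *\<^sub>C pair_op L L' y \<in> L"
      using lagrangian_closed(3)[OF L(2) x(2,2), of c] lagrangian_closed(3)[OF L(1) x(3,3), of c]
      by (simp_all add: scaleC_add_right)
  qed (use x y lin_closed in auto)
  fix y' assume y': "y' \<in> Y"
  obtain x' where x': "x' \<in> Z" "x' + y' \<in> L'" "x' + pair_op L L' y' \<in> L" "pair_op L L' y' \<in> Y"
    using pair_opE[OF L y'] .
  show "pair_op L L' (y + y') = pair_op L L' y + pair_op L L' y'"
  proof (rule pair_op_eq[OF L])
    show "x + x' + (y + y') \<in> L'" "x + x' + (pair_op L L' y + pair_op L L' y') \<in> L"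
      using lagrangian_closed(1)[OF L(2) x(2) x'(2)] lagrangian_closed(1)[OF L(1) x(3) x'(3)]
      by (simp_all add: algebra_simps)
  qed (use x y x' y' lin_closed in auto)
qed

lemma pair_op_closed:
  assumes "lagrangian L" "lagrangian L'"
  shows "pair_op L L' ` Y \<subseteq> Y"
  using pair_opE[OF assms] by blast

text \<open>The mixed terms vanish by orthogonality. Hence the graph map is an isometry from
  \<open>Z\<close> with the form \<open>- h\<close> to \<open>Y\<close> with the form
  \<open>h\<close>.\<close>

lemma lagrangian_split:
  assumes "lagrangian L" "x \<in> Z" "y \<in> Y" "x + y \<in> L" "x' \<in> Z" "y' \<in> Y" "x' + y' \<in> L"
  shows "h y y' = - h x x'"
  using lagrangian_closed(4)[OF assms(1,4,7)] assms
  by (simp add: add_left add_right cross cross' add_eq_0_iff)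

lemma pair_op_isometry:
  assumes L: "lagrangian L" "lagrangian L'" and y: "y \<in> Y" "y' \<in> Y"
  shows "h (pair_op L L' y) (pair_op L L' y') = h y y'"
proof -
  obtain x where x: "x \<in> Z" "x + y \<in> L'" "x + pair_op L L' y \<in> L" "pair_op L L' y \<in> Y"
    using pair_opE[OF L y(1)] .
  obtain x' where x': "x' \<in> Z" "x' + y' \<in> L'" "x' + pair_op L L' y' \<in> L" "pair_op L L' y' \<in> Y"
    using pair_opE[OF L y(2)] .
  show ?thesis
    using lagrangian_split[OF L(1) x(1,4,3) x'(1,4,3)]
      lagrangian_split[OF L(2) x(1) y(1) x(2) x'(1) y(2) x'(2)] by simp
qed

text \<open>One and the same \<open>x\<close> in \<open>Z\<close> lies below the three values
  involved.\<close>

lemma pair_op_comp: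
  assumes L: "lagrangian L" "lagrangian L'" "lagrangian L''" and y: "y \<in> Y"
  shows "pair_op L L'' y = pair_op L L' (pair_op L' L'' y)"
proof -
  obtain x where x: "x \<in> Z" "x + y \<in> L''" "x + pair_op L' L'' y \<in> L'" "pair_op L' L'' y \<in> Y"
    using pair_opE[OF L(2,3) y] .
  obtain w where w: "w \<in> Y" "x + w \<in> L"
    using lagrangian_over_Z[OF L(1) x(1)] by blast
  show ?thesis
    using pair_op_eq[OF L(1,3) x(1) y w(1) x(2) w(2)]
      pair_op_eq[OF L(1,2) x(1) x(4) w(1) x(3) w(2)] by simp
qed

lemma pair_op_self:
  assumes "lagrangian L" "y \<in> Y"
  shows "pair_op L L y = y"
  using lagrangian_over_Y[OF assms] pair_op_eq[OF assms(1,1) _ assms(2,2)] by blast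

text \<open>Fixed vectors are the \<open>Y\<close>-components of \<open>L \<inter> L'\<close>; this
  is the link between the eigenvalue 1 and intersections.\<close>

lemma pair_op_fixed_iff:
  assumes L: "lagrangian L" "lagrangian L'" and y: "y \<in> Y"
  shows "pair_op L L' y = y \<longleftrightarrow> (\<exists>x\<in>Z. x + y \<in> L \<and> x + y \<in> L')"
  using pair_opE[OF L y] pair_op_eq[OF L _ y y] by metis

text \<open>Exchanging the two subspaces inverts the operator, and the inverse of a unitary operator
  is its adjoint.\<close>

lemma pair_op_inverse_matrix:
  assumes L: "lagrangian L" "lagrangian L'" and b: "onb Y N b" and "i < N" "j < N"
  shows "opmat b (pair_op L' L) i j = cnj (opmat b (pair_op L L') j i)"
proof -
  have bY: "b i \<in> Y" "b j \<in> Y"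
    using b assms(4,5) by (auto simp: onb_def)
  obtain x where "pair_op L' L (b j) \<in> Y"
    using pair_opE[OF L(2,1) bY(2)] .
  then have "h (pair_op L L' (pair_op L' L (b j))) (pair_op L L' (b i)) = h (pair_op L' L (b j)) (b i)"
    by (rule pair_op_isometry[OF L _ bY(1)])
  moreover have "pair_op L L' (pair_op L' L (b j)) = b j"
    using pair_op_comp[OF L(1,2,1) bY(2)] pair_op_self[OF L(1) bY(2)] by simp
  ultimately show ?thesis
    unfolding opmat_def using hermitian[of "b j" "pair_op L L' (b i)"] by simp
qed

text \<open>Lifting \<open>b\<close> through \<open>L\<close> gives a basis \<open>c\<close> of
  \<open>Z\<close> that is orthonormal for \<open>- h\<close>. Equality of the two dimensions is
  what identifies \<open>N\<close> with half the dimension of the whole space, as the definition of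
  the index requires.\<close>

lemma cdim_Z:
  assumes L: "lagrangian L" and b: "onb Y N b"
  shows "cdim Z = N"
proof -
  interpret flip: split_form "\<lambda>x y. - h x y" Z Y S
    by (rule split_form_flip)
  have bY: "b i \<in> Y" if "i < N" for i
    using b that by (auto simp: onb_def)
  have "\<forall>i. \<exists>z. i < N \<longrightarrow> z \<in> Z \<and> z + b i \<in> L"
    using lagrangian_over_Y[OF L bY] by blast
  then obtain c where c: "\<And>i. i < N \<Longrightarrow> c i \<in> Z" "\<And>i. i < N \<Longrightarrow> c i + b i \<in> L"
    by metis
  have cc: "h (c i) (c j) = - h (b i) (b j)" if "i < N" "j < N" for i j
    using lagrangian_split[OF L c(1) bY c(2) c(1) bY c(2)] that by simp
  have "flip.orthonormal N c"
    using b cc by (simp add: flip.orthonormal_def onb_def orthonormal_def)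
  moreover have "z = (\<Sum>i<N. (- h z (c i)) *\<^sub>C c i)" if z: "z \<in> Z" for z
  proof -
    obtain y where y: "y \<in> Y" "z + y \<in> L"
      using lagrangian_over_Z[OF L z] by blast
    have hy: "h y (b i) = - h z (c i)" if "i < N" for i
      using lagrangian_split[OF L z y c(1) bY c(2)] that by simp
    have "y = (\<Sum>i<N. h y (b i) *\<^sub>C b i)"
      using b y(1) unfolding onb_def by blast
    also have "\<dots> = (\<Sum>i<N. (- h z (c i)) *\<^sub>C b i)"
      by (intro sum.cong) (auto simp: hy)
    finally have y_eq: "y = (\<Sum>i<N. (- h z (c i)) *\<^sub>C b i)" .
    have Ls: "complex_vector.subspace L"
      using L by (rule lagrangian_subspace)
    let ?w = "\<Sum>i<N. (- h z (c i)) *\<^sub>C c i"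
    have "(\<Sum>i<N. (- h z (c i)) *\<^sub>C (c i + b i)) \<in> L"
      by (intro complex_vector.subspace_sum[OF Ls] complex_vector.subspace_scale[OF Ls]) (simp add: c)
    then have "?w + y \<in> L"
      by (subst y_eq) (simp only: scaleC_add_right sum.distrib)
    from lagrangian_closed(2)[OF L y(2) this] have "z - ?w \<in> L"
      by simp
    moreover have "z - ?w \<in> Z"
      by (intro lin_closed z complex_vector.subspace_sum[OF subspaces(2)]) (simp add: c)
    ultimately show ?thesis
      using lagrangian_Z[OF L] by force
  qed
  ultimately have "flip.onb Z N c"
    using c(1) by (simp add: flip.onb_def)
  then show ?thesis
    using flip.onb_dim subspaces(2) by blast
qed

lemma cdim_UNIV:
  assumes L: "lagrangian L" and b: "onb Y N b"
  shows "cdim (UNIV :: 'x set) = 2 * N"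
proof -
  obtain B where "finite_dimensional_vector_space (scaleC :: complex \<Rightarrow> 'x \<Rightarrow> 'x) B"
    using finite_dimensional_basis[OF finite_span] .
  then interpret fd: finite_dimensional_vector_space "scaleC :: complex \<Rightarrow> 'x \<Rightarrow> 'x" B .
  have "{x + y |x y. x \<in> Y \<and> y \<in> Z} = UNIV"
    using decompose by (auto simp: set_eq_iff) (metis add.commute)
  moreover have "Y \<inter> Z = {0}"
    using pos neg lin_closed(7,8) by (fastforce)
  ultimately show ?thesis
    using fd.dim_sums_Int[OF subspaces] cdim_Z[OF L b] onb_dim[OF b subspaces(1)] by simp
qed

text \<open>No operator has to be inverted: if \<open>x + w\<close> lies in \<open>L0\<close> and \<open>x + w'\<close> in a nearby
  \<open>\<Lambda> p\<close>, then a point of \<open>\<Lambda> p\<close> near \<open>x + w\<close> shows that \<open>w' - w\<close> is small, since \<open>\<Lambda> p\<close> is the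
  graph of an isometry.\<close>

lemma opmat_pair_op_tendsto:
  assumes L: "eventually (\<lambda>p. lagrangian (\<Lambda> p)) F" "lagrangian L0" "lagrangian L'"
    and b: "onb Y N b" and ij: "i < N" "j < N"
    and approx: "\<And>l. l \<in> L0 \<Longrightarrow> \<exists>f. (\<forall>p. f p \<in> \<Lambda> p) \<and> (\<forall>x. ((\<lambda>p. h (f p) x) \<longlongrightarrow> h l x) F)"
  shows "((\<lambda>p. opmat b (pair_op (\<Lambda> p) L') i j) \<longlongrightarrow> opmat b (pair_op L0 L') i j) F"
proof -
  interpret flip: split_form "\<lambda>x y. - h x y" Z Y S
    by (rule split_form_flip)
  obtain M c where c: "flip.onb Z M c"
    using flip.exists_onb[of Z S] subspaces finite_span neg by auto
  have bY: "b i \<in> Y" "b j \<in> Y" and cZ: "\<And>k. k < M \<Longrightarrow> c k \<in> Z"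
    using b c ij by (auto simp: onb_def flip.onb_def)
  obtain x where x: "x \<in> Z" "x + b j \<in> L'" "x + pair_op L0 L' (b j) \<in> L0" "pair_op L0 L' (b j) \<in> Y"
    using pair_opE[OF L(2,3) bY(2)] .
  define w where "w = pair_op L0 L' (b j)"
  obtain f where f: "\<And>p. f p \<in> \<Lambda> p" "\<And>v. ((\<lambda>p. h (f p) v) \<longlongrightarrow> h (x + w) v) F"
    using approx[OF x(3)] unfolding w_def by blast
  \<comment> \<open>\<open>d\<close> is the error in one \<open>Y\<close>-coordinate of
    \<open>f p\<close>, and \<open>e\<close> the length of the error in its
    \<open>Z\<close>-component.\<close>
  define d where "d p = h (f p) (b i) - h (x + w) (b i)" for p
  define e where "e p = sqrt (\<Sum>k<M. (cmod (h (f p) (c k) - h (x + w) (c k)))\<^sup>2)" for p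
  have d0: "(d \<longlongrightarrow> 0) F"
    unfolding d_def using tendsto_diff[OF f(2)[of "b i"] tendsto_const[of "h (x + w) (b i)"]] by simp
  have "(e \<longlongrightarrow> sqrt (\<Sum>k<M. (cmod (h (x + w) (c k) - h (x + w) (c k)))\<^sup>2)) F"
    unfolding e_def by (intro tendsto_intros f(2))
  then have e0: "(e \<longlongrightarrow> 0) F"
    by simp
  have "cmod (opmat b (pair_op (\<Lambda> p) L') i j - opmat b (pair_op L0 L') i j) \<le> cmod (d p) + e p"
    if \<Lambda>: "lagrangian (\<Lambda> p)" for p
  proof -
    obtain u v where uv: "u \<in> Y" "v \<in> Z" "f p = v + u"
      using decompose[of "f p"] by blast
    obtain w' where w': "w' \<in> Y" "x + w' \<in> \<Lambda> p"
      using lagrangian_over_Z[OF \<Lambda> x(1)] by blast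
    have pw': "pair_op (\<Lambda> p) L' (b j) = w'"
      by (rule pair_op_eq[OF \<Lambda> L(3) x(1) bY(2) w'(1) x(2) w'(2)])
    have vx: "v - x \<in> Z" and uw: "u - w' \<in> Y"
      using uv w' x lin_closed by auto
    \<comment> \<open>A difference of two points of \<open>\<Lambda> p\<close>: its
      \<open>Y\<close>- and \<open>Z\<close>-components have equal length, so \<open>u - w'\<close>
      is controlled by \<open>e p\<close>.\<close>
    have "(v - x) + (u - w') \<in> \<Lambda> p"
      using lagrangian_closed(2)[OF \<Lambda> f(1) w'(2)] by (simp add: uv(3) algebra_simps)
    from lagrangian_split[OF \<Lambda> vx uw this vx uw this]
    have "h (u - w') (u - w') = - h (v - x) (v - x)" .
    moreover have "(cmod (h (u - w') (b i)))\<^sup>2 \<le> Re (h (u - w') (u - w'))"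
      by (rule onb_coeff_le[OF b uw ij(1)])
    moreover have "Re (- h (v - x) (v - x)) = (\<Sum>k<M. (cmod (- h (v - x) (c k)))\<^sup>2)"
      by (rule flip.onb_norm[OF c vx])
    moreover have "h (v - x) (c k) = h (f p) (c k) - h (x + w) (c k)" if "k < M" for k
      using cZ[OF that] x(4) by (simp add: uv w_def diff_left add_left cross)
    ultimately have "(cmod (h (u - w') (b i)))\<^sup>2 \<le> (e p)\<^sup>2"
      by (simp add: e_def sum_nonneg norm_minus_commute)
    then have 1: "cmod (h (u - w') (b i)) \<le> e p"
      by (rule power2_le_imp_le) (simp add: e_def sum_nonneg)
    have "h w' (b i) - h w (b i) = d p - h (u - w') (b i)"
      using bY(1) uv x(1) by (simp add: d_def diff_left add_left cross')
    then have "cmod (h w' (b i) - h w (b i)) \<le> cmod (d p) + e p"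
      using 1 norm_triangle_ineq4[of "d p" "h (u - w') (b i)"] by simp
    then show ?thesis
      by (simp add: opmat_def pw' w_def)
  qed
  then have "eventually (\<lambda>p. cmod (opmat b (pair_op (\<Lambda> p) L') i j - opmat b (pair_op L0 L') i j)
      \<le> cmod (d p) + e p) F"
    by (rule eventually_mono[OF L(1)])
  moreover have "((\<lambda>p. cmod (d p) + e p) \<longlongrightarrow> 0) F"
    using tendsto_add[OF tendsto_norm_zero[OF d0] e0] by simp
  ultimately have "((\<lambda>p. opmat b (pair_op (\<Lambda> p) L') i j - opmat b (pair_op L0 L') i j) \<longlongrightarrow> 0) F"
    by (rule Lim_null_comparison)
  then show ?thesis
    by (simp add: LIM_zero_iff)
qed

end

lemma sesquilinearD:
  assumes "sesquilinear f"
  shows "f (x + x') y = f x y + f x' y" "f (c *\<^sub>C x) y = c * f x y"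
    "f x (y + y') = f x y + f x y'" "f x (c *\<^sub>C y) = cnj c * f x y"
  using assms unfolding sesquilinear_def by blast+

lemma symplectic_formD:
  assumes "symplectic_form \<omega>"
  shows "sesquilinear \<omega>" "\<omega> y x = - cnj (\<omega> x y)" "(\<And>y. \<omega> x y = 0) \<Longrightarrow> x = 0"
  using assms unfolding symplectic_form_def by blast+

lemma inner_productD:
  assumes "inner_product G"
  shows "sesquilinear G" "G y x = cnj (G x y)" "x \<noteq> 0 \<Longrightarrow> 0 < Re (G x x)"
  using assms unfolding inner_product_def by blast+

section \<open>The splitting defined by a symplectic form and an inner product\<close>

lemma clinear_iff:
  "clinear f \<longleftrightarrow> (\<forall>x y. f (x + y) = f x + f y) \<and> (\<forall>c x. f (c *\<^sub>C x) = c *\<^sub>C f x)"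
  unfolding Vector_Spaces.linear_iff by (simp add: complex_vector.vector_space_axioms)

lemma clinear_inj_imp_surj:
  fixes f :: "'x::complex_vector \<Rightarrow> 'x"
  assumes "finite S" "cspan S = (UNIV :: 'x set)" "clinear f" "inj f"
  shows "surj f"
proof -
  obtain B where "finite_dimensional_vector_space (scaleC :: complex \<Rightarrow> 'x \<Rightarrow> 'x) B"
    using finite_dimensional_basis[OF assms(1,2)] .
  then interpret finite_dimensional_vector_space "scaleC :: complex \<Rightarrow> 'x \<Rightarrow> 'x" B .
  show ?thesis
    using assms(3,4) by (rule linear_inj_imp_surj)
qed

context hermitian_form
begin

text \<open>Eigenvectors of a self-adjoint operator for different real eigenvalues are orthogonal,
  so the span is the complement of the remaining basis vectors. The sign \<open>\<sigma>\<close>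
  treats \<open>Xplus\<close> (1) and \<open>Xminus\<close> (-1) together.\<close>

lemma span_of_eigenvectors:
  assumes g: "onb UNIV n g" and K: "\<And>x y. h (K x) y = h x (K y)"
    and eig: "\<And>i. i < n \<Longrightarrow> K (g i) = complex_of_real (r i) *\<^sub>C g i" and r: "\<And>i. i < n \<Longrightarrow> r i \<noteq> 0"
    and \<sigma>: "\<sigma> \<noteq> (0 :: real)"
  shows "cspan {v. v \<noteq> 0 \<and> (\<exists>s::real. \<sigma> * s < 0 \<and> K v = complex_of_real s *\<^sub>C v)}
    = {x. \<forall>i<n. 0 < \<sigma> * r i \<longrightarrow> h x (g i) = 0}" (is "cspan ?V = ?P")
proof
  show "cspan ?V \<subseteq> ?P"
  proof (rule complex_vector.span_minimal)
    show "complex_vector.subspace ?P"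
      by (auto simp: complex_vector.subspace_def add_left scale_left)
    show "?V \<subseteq> ?P"
    proof safe
      fix v :: 'x and s :: real and i
      assume v: "\<sigma> * s < 0" "K v = complex_of_real s *\<^sub>C v" and i: "i < n" "0 < \<sigma> * r i"
      have "complex_of_real s * h v (g i) = complex_of_real (r i) * h v (g i)"
        using K[of v "g i"] by (simp add: v(2) eig[OF i(1)] scale_left scale_right)
      moreover have "s \<noteq> r i"
        using v(1) i(2) by auto
      ultimately show "h v (g i) = 0"
        by simp
    qed
  qed
  show "?P \<subseteq> cspan ?V"
  proof
    fix x assume x: "x \<in> ?P"
    have "h x (g i) *\<^sub>C g i \<in> cspan ?V" if i: "i < n" for i
    proof (cases "0 < \<sigma> * r i")
      case True
      then show ?thesis
        using x i by (simp add: complex_vector.span_zero)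
    next
      case False
      then have "\<sigma> * r i < 0"
        using r[OF i] \<sigma> by (metis linorder_neqE_linordered_idom mult_eq_0_iff)
      moreover have "g i \<noteq> 0"
        using g i unfolding onb_def orthonormal_def by (metis zero_left zero_neq_one)
      ultimately have "g i \<in> ?V"
        using eig[OF i] by blast
      then show ?thesis
        by (intro complex_vector.span_scale complex_vector.span_base)
    qed
    then have "(\<Sum>i<n. h x (g i) *\<^sub>C g i) \<in> cspan ?V"
      by (intro complex_vector.span_sum) auto
    moreover have "x = (\<Sum>i<n. h x (g i) *\<^sub>C g i)"
      using g unfolding onb_def by blast
    ultimately show "x \<in> cspan ?V"
      by (rule ssubst[rotated])
  qed
qed

end

lemma split_form_symplectic:
  fixes G \<Omega> :: "'x::complex_vector \<Rightarrow> 'x \<Rightarrow> complex"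
  assumes G: "inner_product G" and \<Omega>: "symplectic_form \<Omega>" and S: "finite S" "cspan S = (UNIV :: 'x set)"
  shows "split_form (\<lambda>x y. - \<i> * \<Omega> x y) (Xplus G \<Omega>) (Xminus G \<Omega>) S"
proof -
  define h where "h x y = - \<i> * \<Omega> x y" for x y
  have \<Omega>_h: "\<Omega> x y = \<i> * h x y" for x y
    by (simp add: h_def)
  interpret G: hermitian_form G
    by unfold_locales (fact inner_productD[OF G])+
  interpret h: hermitian_form h
  proof
    show "sesquilinear h"
      by (simp add: sesquilinear_def h_def sesquilinearD[OF symplectic_formD(1)[OF \<Omega>]] algebra_simps)
    show "h y x = cnj (h x y)" for x y
      unfolding h_def by (subst symplectic_formD(2)[OF \<Omega>]) simp
  qed
  have G_pos: "0 < Re (G x x)" if "x \<noteq> 0" for x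
    using inner_productD(3)[OF G] that .
  have G_eq: "x = y" if "\<And>z. G x z = G y z" for x y
  proof (rule ccontr)
    assume "x \<noteq> y"
    then have "0 < Re (G (x - y) (x - y))"
      by (intro G_pos) simp
    then show False
      using that[of "x - y"] by (simp add: G.diff_left)
  qed
  obtain n0 g0 where g0: "G.onb UNIV n0 g0"
    using G.exists_onb[of UNIV S] S G_pos by auto
  \<comment> \<open>Riesz representation: \<open>K\<close> represents \<open>- h\<close> with
    respect to \<open>G\<close>. It is the operator \<open>\<i> *\<^sub>C form_op G \<Omega>\<close>
    of the definition.\<close>
  define K where "K x = (\<Sum>i<n0. (- h x (g0 i)) *\<^sub>C g0 i)" for x
  have GK: "G (K x) y = - h x y" for x y
  proof -
    have "G (K x) y = - (\<Sum>i<n0. h x (g0 i) * cnj (G y (g0 i)))"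
      unfolding K_def G.sum_left G.scale_left sum_negf[symmetric]
      by (intro sum.cong refl) (simp add: G.hermitian[of _ y])
    also have "(\<Sum>i<n0. h x (g0 i) * cnj (G y (g0 i))) = h x (\<Sum>i<n0. G y (g0 i) *\<^sub>C g0 i)"
      by (simp add: h.sum_right h.scale_right mult.commute)
    also have "(\<Sum>i<n0. G y (g0 i) *\<^sub>C g0 i) = y"
      using g0 unfolding G.onb_def by (metis UNIV_I)
    finally show ?thesis .
  qed
  have K_lin: "K (x + y) = K x + K y" "K (c *\<^sub>C x) = c *\<^sub>C K x" for x y c
    by (rule G_eq; simp add: GK G.add_left G.scale_left h.add_left h.scale_left)+
  have K_self: "G (K x) y = G x (K y)" for x y
  proof -
    have "G x (K y) = - cnj (h y x)"
      using G.hermitian[of x "K y"] by (simp add: GK)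
    then show ?thesis
      using h.hermitian[of x y] by (simp add: GK)
  qed
  have K_inj: "x = 0" if "K x = 0" for x
  proof -
    have "\<Omega> x y = 0" for y
      using GK[of x y] that by (simp add: \<Omega>_h)
    then show ?thesis
      by (rule symplectic_formD(3)[OF \<Omega>])
  qed
  \<comment> \<open>\<open>form_op\<close> is a definite description, so existence and uniqueness
    are both at stake; bijectivity follows from injectivity in finite dimension.\<close>
  have "form_op G \<Omega> = (\<lambda>x. (- \<i>) *\<^sub>C K x)"
    unfolding form_op_def
  proof (rule the_equality)
    have lin: "clinear (\<lambda>x. (- \<i>) *\<^sub>C K x)"
      by (simp add: clinear_iff K_lin scaleC_add_right scaleC_scaleC mult.commute
          del: complex_vector.scale_minus_left)
    have "inj (\<lambda>x. (- \<i>) *\<^sub>C K x)"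
    proof (rule injI)
      fix x y assume "(- \<i>) *\<^sub>C K x = (- \<i>) *\<^sub>C K y"
      then have "K (x + (-1) *\<^sub>C y) = 0"
        unfolding K_lin by simp
      then show "x = y"
        using K_inj[of "x + (-1) *\<^sub>C y"] by simp
    qed
    then have "bij (\<lambda>x. (- \<i>) *\<^sub>C K x)"
      using clinear_inj_imp_surj[OF S lin] by (simp add: bij_def)
    moreover have "\<Omega> x y = G ((- \<i>) *\<^sub>C K x) y" for x y
      unfolding G.scale_left GK by (simp add: \<Omega>_h)
    ultimately show "clinear (\<lambda>x. (- \<i>) *\<^sub>C K x) \<and> bij (\<lambda>x. (- \<i>) *\<^sub>C K x) \<and>
        (\<forall>x y. \<Omega> x y = G ((- \<i>) *\<^sub>C K x) y)"
      using lin by blast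
    fix J assume J: "clinear J \<and> bij J \<and> (\<forall>x y. \<Omega> x y = G (J x) y)"
    show "J = (\<lambda>x. (- \<i>) *\<^sub>C K x)"
    proof
      fix x
      show "J x = (- \<i>) *\<^sub>C K x"
      proof (rule G_eq)
        fix z
        have "G (J x) z = \<Omega> x z"
          using J by simp
        then show "G (J x) z = G ((- \<i>) *\<^sub>C K x) z"
          unfolding G.scale_left GK by (simp add: \<Omega>_h)
      qed
    qed
  qed
  then have iJ: "\<i> *\<^sub>C form_op G \<Omega> v = K v" for v
    by (simp add: scaleC_scaleC scaleC_one del: complex_vector.scale_minus_left)
  have "\<exists>n g z. G.onb UNIV n g \<and> (\<forall>i<n. K (g i) = z i *\<^sub>C g i)"
  proof (rule G.exists_eigenbasis[of UNIV S K])
    show "clinear_on UNIV K"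
      by (simp add: clinear_on_def K_lin)
    show "G (K y) x = 0" if "K x = z *\<^sub>C x" "G y x = 0" for x y z
      using that by (simp add: K_self G.scale_right)
  qed (use S G_pos in auto)
  then obtain n g z where g: "G.onb UNIV n g" and eig: "\<And>i. i < n \<Longrightarrow> K (g i) = z i *\<^sub>C g i"
    by blast
  have gg: "G (g i) (g i) = 1" if "i < n" for i
    using g that by (simp add: G.onb_def G.orthonormal_def)
  define r where "r i = Re (z i)" for i
  have zr: "z i = complex_of_real (r i)" if "i < n" for i
    using K_self[of "g i" "g i"] gg[OF that]
    by (simp add: eig[OF that] G.scale_left G.scale_right r_def complex_eq_iff)
  have eig': "K (g i) = complex_of_real (r i) *\<^sub>C g i" if "i < n" for i
    using eig zr that by simp
  have r0: "r i \<noteq> 0" if "i < n" for i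
  proof
    assume "r i = 0"
    then have "g i = 0"
      using eig'[OF that] K_inj[of "g i"] by simp
    then show False
      using gg[OF that] by simp
  qed
  have plus: "Xplus G \<Omega> = {x. \<forall>i<n. 0 < r i \<longrightarrow> G x (g i) = 0}"
    using G.span_of_eigenvectors[OF g K_self eig' r0, of 1] by (simp add: Xplus_def iJ)
  have minus: "Xminus G \<Omega> = {x. \<forall>i<n. r i < 0 \<longrightarrow> G x (g i) = 0}"
    using G.span_of_eigenvectors[OF g K_self eig' r0, of "-1"] by (simp add: Xminus_def iJ)
  have hxy: "h x y = (\<Sum>i<n. - complex_of_real (r i) * (G x (g i) * cnj (G y (g i))))" for x y
  proof -
    have "h x y = - G (K x) y"
      by (simp add: GK)
    also have "G (K x) y = (\<Sum>i<n. G (K x) (g i) * cnj (G y (g i)))"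
      by (rule G.onb_inner[OF g]) simp
    also have "\<dots> = (\<Sum>i<n. complex_of_real (r i) * (G x (g i) * cnj (G y (g i))))"
      by (intro sum.cong) (auto simp: K_self[of x] eig' G.scale_right)
    finally show ?thesis
      by (simp add: sum_negf)
  qed
  \<comment> \<open>In the eigenbasis \<open>h\<close> is diagonal with entries
    \<open>- r i\<close>: the negative eigenvalues of \<open>K\<close> span the positive part of
    \<open>h\<close>.\<close>
  have hxx: "Re (h x x) = (\<Sum>i<n. - r i * (cmod (G x (g i)))\<^sup>2)" for x
    unfolding hxy Re_sum
    by (intro sum.cong refl)
      (simp only: complex_norm_square[symmetric] of_real_minus[symmetric] of_real_mult[symmetric] Re_complex_of_real)
  have nz: "\<exists>i<n. G x (g i) \<noteq> 0" if "x \<noteq> 0" for x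
  proof (rule ccontr)
    assume "\<not> ?thesis"
    then have "(\<Sum>i<n. G x (g i) *\<^sub>C g i) = 0"
      by (intro sum.neutral) auto
    moreover have "x = (\<Sum>i<n. G x (g i) *\<^sub>C g i)"
      using g unfolding G.onb_def by blast
    ultimately show False
      using that by simp
  qed
  have "split_form h (Xplus G \<Omega>) (Xminus G \<Omega>) S"
  proof
    show "finite S" "cspan S = UNIV"
      by (rule S)+
    show "complex_vector.subspace (Xplus G \<Omega>)" "complex_vector.subspace (Xminus G \<Omega>)"
      by (simp_all add: Xplus_def Xminus_def)
    show "0 < Re (h y y)" if y: "y \<in> Xplus G \<Omega>" "y \<noteq> 0" for y
    proof -
      obtain i where i: "i < n" "G y (g i) \<noteq> 0"
        using nz y(2) by blast
      have le: "0 \<le> - r j * (cmod (G y (g j)))\<^sup>2" if "j < n" for j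
        using y(1) that by (cases "0 < r j") (auto simp: plus mult_nonpos_nonneg)
      have "r i < 0"
        using i y(1) r0[OF i(1)] by (force simp: plus not_less[symmetric])
      then have "0 < - r i * (cmod (G y (g i)))\<^sup>2"
        using i(2) by (intro mult_pos_pos) auto
      with i(1) le show ?thesis
        unfolding hxx by (intro sum_pos2[of _ i]) auto
    qed
    show "Re (h y y) < 0" if y: "y \<in> Xminus G \<Omega>" "y \<noteq> 0" for y
    proof -
      obtain i where i: "i < n" "G y (g i) \<noteq> 0"
        using nz y(2) by blast
      have le: "0 \<le> r j * (cmod (G y (g j)))\<^sup>2" if "j < n" for j
        using y(1) that by (cases "r j < 0") (auto simp: minus)
      have "0 < r i"
        using i y(1) r0[OF i(1)] by (force simp: minus not_less[symmetric])
      then have "0 < r i * (cmod (G y (g i)))\<^sup>2"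
        using i(2) by (intro mult_pos_pos) auto
      with i(1) le have "0 < (\<Sum>j<n. r j * (cmod (G y (g j)))\<^sup>2)"
        by (intro sum_pos2[of _ i]) auto
      then show ?thesis
        unfolding hxx by (simp add: sum_negf)
    qed
    show "h y z = 0" if "y \<in> Xplus G \<Omega>" "z \<in> Xminus G \<Omega>" for y z
      unfolding hxy
    proof (intro sum.neutral ballI)
      fix i assume "i \<in> {..<n}"
      then show "- complex_of_real (r i) * (G y (g i) * cnj (G z (g i))) = 0"
        using that r0[of i] by (cases "0 < r i") (auto simp: plus minus)
    qed
    show "\<exists>y\<in>Xplus G \<Omega>. \<exists>z\<in>Xminus G \<Omega>. x = z + y" for x
    proof (intro bexI)
      let ?I = "{i. i < n \<and> r i < 0}" and ?J = "{i. i < n \<and> 0 < r i}"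
      have on: "G.orthonormal n g"
        using g by (simp add: G.onb_def)
      show "(\<Sum>i\<in>?I. G x (g i) *\<^sub>C g i) \<in> Xplus G \<Omega>"
        unfolding plus using G.orthonormal_sum[OF on, of ?I] by fastforce
      show "(\<Sum>i\<in>?J. G x (g i) *\<^sub>C g i) \<in> Xminus G \<Omega>"
        unfolding minus using G.orthonormal_sum[OF on, of ?J] by fastforce
      have "x = (\<Sum>i<n. G x (g i) *\<^sub>C g i)"
        using g unfolding G.onb_def by blast
      also have "{..<n} = ?J \<union> ?I"
        using r0 by (auto simp: linorder_neq_iff)
      also have "(\<Sum>i\<in>?J \<union> ?I. G x (g i) *\<^sub>C g i)
          = (\<Sum>i\<in>?J. G x (g i) *\<^sub>C g i) + (\<Sum>i\<in>?I. G x (g i) *\<^sub>C g i)"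
        by (intro sum.union_disjoint) auto
      finally show "x = (\<Sum>i\<in>?J. G x (g i) *\<^sub>C g i) + (\<Sum>i\<in>?I. G x (g i) *\<^sub>C g i)" .
    qed
  qed
  then show ?thesis
    by (simp add: h_def[abs_def])
qed

lemma lag_pair_op_eq:
  assumes "split_form (\<lambda>x y. - \<i> * \<Omega> x y) (Xplus G \<Omega>) (Xminus G \<Omega>) S"
  shows "lag_pair_op G \<Omega> = split_form.pair_op (Xplus G \<Omega>) (Xminus G \<Omega>)"
proof (intro ext)
  fix L L' z
  interpret split_form "\<lambda>x y. - \<i> * \<Omega> x y" "Xplus G \<Omega>" "Xminus G \<Omega>" S
    by (rule assms)
  have "lag_map G \<Omega> = graph_map"
    by (intro ext) (simp add: lag_map_def graph_map_def)
  then show "lag_pair_op G \<Omega> L L' z = pair_op L L' z"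
    by (simp add: lag_pair_op_def pair_op_def)
qed

subsection \<open>Graphs of symplectic maps\<close>

lemma symplectic_direct_sum:
  assumes "symplectic_form \<omega>"
  shows "symplectic_form (direct_sum_form \<omega>)"
proof -
  note s = sesquilinearD[OF symplectic_formD(1)[OF assms]]
  have z: "\<omega> x 0 = 0" for x
    using s(4)[of x 0 0] by simp
  show ?thesis
    unfolding symplectic_form_def
  proof (intro conjI allI impI)
    show "sesquilinear (direct_sum_form \<omega>)"
      by (simp add: sesquilinear_def direct_sum_form_def scaleC_prod_def s algebra_simps)
    show "direct_sum_form \<omega> y x = - cnj (direct_sum_form \<omega> x y)" for x y
      using symplectic_formD(2)[OF assms, of "fst y" "fst x"]
        symplectic_formD(2)[OF assms, of "snd y" "snd x"] by (simp add: direct_sum_form_def)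
    fix x :: "'a \<times> 'a" assume x: "\<forall>y. direct_sum_form \<omega> x y = 0"
    have "\<omega> (fst x) v = 0" "\<omega> (snd x) v = 0" for v
      using x[rule_format, of "(v, 0)"] x[rule_format, of "(0, v)"]
      by (simp_all add: direct_sum_form_def z)
    then show "x = 0"
      using symplectic_formD(3)[OF assms] by (metis prod_eq_iff fst_zero snd_zero)
  qed
qed

lemma span_linear_image:
  assumes "clinear f" "f ` S \<subseteq> cspan T" "x \<in> cspan S"
  shows "f x \<in> cspan T"
proof -
  have f: "f (x + y) = f x + f y" "f (c *\<^sub>C x) = c *\<^sub>C f x" for x y c
    using assms(1) unfolding clinear_iff by blast+
  have "f 0 = 0"
    using f(2)[of 0 0] by simp
  then have "complex_vector.subspace {x. f x \<in> cspan T}"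
    by (simp add: complex_vector.subspace_def f complex_vector.span_zero complex_vector.span_add
        complex_vector.span_scale)
  then have "cspan S \<subseteq> {x. f x \<in> cspan T}"
    using assms(2) by (intro complex_vector.span_minimal) auto
  with assms(3) show ?thesis
    by auto
qed

lemma finite_span_prod:
  fixes S :: "'v::complex_vector set"
  assumes "finite S" "cspan S = UNIV"
  obtains T where "finite T" "cspan T = (UNIV :: ('v \<times> 'v) set)"
proof
  define T :: "('v \<times> 'v) set" where "T = (\<lambda>x. (x, 0)) ` S \<union> (\<lambda>x. (0, x)) ` S"
  show "finite T"
    using assms(1) by (simp add: T_def)
  have "(x, 0) \<in> cspan T" for x
    using assms(2)
    by (intro span_linear_image[of "\<lambda>x. (x, 0)" S T])
      (auto simp: clinear_iff scaleC_prod_def T_def intro: complex_vector.span_base)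
  moreover have "(0, x) \<in> cspan T" for x
    using assms(2)
    by (intro span_linear_image[of "\<lambda>x. (0, x)" S T])
      (auto simp: clinear_iff scaleC_prod_def T_def intro: complex_vector.span_base)
  ultimately have "(x, y) \<in> cspan T" for x y
    using complex_vector.span_add[of "(x, 0)" T "(0, y)"] by simp
  then show "cspan T = UNIV"
    by auto
qed

text \<open>Non-degeneracy makes \<open>A\<close> injective, and finite dimension then makes it
  surjective. A pair annihilating the graph satisfies
  \<open>\<omega> (snd p) (A x) = \<omega> (A (fst p)) (A x)\<close> for all \<open>x\<close>, and
  \<open>A x\<close> is arbitrary.\<close>

lemma lagrangian_Gr:
  fixes \<omega> :: "'v::complex_vector \<Rightarrow> 'v \<Rightarrow> complex"
  assumes sf: "split_form (\<lambda>x y. - \<i> * direct_sum_form \<omega> x y) Y Z T"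
    and \<omega>: "symplectic_form \<omega>" and S: "finite S" "cspan S = (UNIV :: 'v set)"
    and A: "clinear A" "\<And>x y. \<omega> (A x) (A y) = \<omega> x y"
  shows "split_form.lagrangian (\<lambda>x y. - \<i> * direct_sum_form \<omega> x y) (Gr A)"
proof -
  interpret split_form "\<lambda>x y. - \<i> * direct_sum_form \<omega> x y" Y Z T
    by (rule sf)
  have Alin: "A (x + y) = A x + A y" "A (c *\<^sub>C x) = c *\<^sub>C A x" for x y c
    using A(1) unfolding clinear_iff by blast+
  have diff: "\<omega> (x - x') y = \<omega> x y - \<omega> x' y" for x x' y
    using sesquilinearD(1)[OF symplectic_formD(1)[OF \<omega>], of "x - x'" x' y] by simp
  have nondeg: "x = y" if "\<And>v. \<omega> x v = \<omega> y v" for x y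
    using symplectic_formD(3)[OF \<omega>, of "x - y"] that by (simp add: diff)
  have "inj A"
  proof (rule injI)
    fix x y assume "A x = A y"
    then have "\<omega> x v = \<omega> y v" for v
      using A(2)[of x v] A(2)[of y v] by simp
    then show "x = y"
      by (rule nondeg)
  qed
  then have surj: "surj A"
    by (rule clinear_inj_imp_surj[OF S A(1)])
  have sub: "complex_vector.subspace (Gr A)"
    unfolding complex_vector.subspace_def Gr_def
    using Alin Alin(2)[of 0 0] by (auto simp: scaleC_prod_def zero_prod_def)
  have "p \<in> Gr A \<longleftrightarrow> (\<forall>q\<in>Gr A. - \<i> * direct_sum_form \<omega> p q = 0)" for p
  proof
    assume "p \<in> Gr A"
    then show "\<forall>q\<in>Gr A. - \<i> * direct_sum_form \<omega> p q = 0"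
      by (auto simp: Gr_def direct_sum_form_def A(2))
  next
    assume p: "\<forall>q\<in>Gr A. - \<i> * direct_sum_form \<omega> p q = 0"
    have eq: "\<omega> (snd p) (A x) = \<omega> (A (fst p)) (A x)" for x
    proof -
      have "(x, A x) \<in> Gr A"
        by (auto simp: Gr_def)
      then have "direct_sum_form \<omega> p (x, A x) = 0"
        using p by force
      then show ?thesis
        by (simp add: direct_sum_form_def A(2))
    qed
    have "snd p = A (fst p)"
    proof (rule nondeg)
      fix v
      obtain x where "v = A x"
        using surj by (rule surjE)
      then show "\<omega> (snd p) v = \<omega> (A (fst p)) v"
        using eq by simp
    qed
    then show "p \<in> Gr A"
      by (cases p) (auto simp: Gr_def)
  qed
  with sub show ?thesis
    unfolding lagrangian_def by blast
qed

section \<open>The Maslov index in terms of sorted angles\<close>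

lemma continuous_Ints_constant:
  fixes f :: "real \<Rightarrow> real"
  assumes "continuous_on {a..b} f" "\<And>s. s \<in> {a..b} \<Longrightarrow> f s \<in> \<int>" "a \<le> b"
  shows "f b = f a"
proof -
  have "f constant_on {a..b}"
  proof (rule continuous_discrete_range_constant)
    fix x assume x: "x \<in> {a..b}"
    have "1 \<le> norm (f y - f x)" if "y \<in> {a..b} \<and> f y \<noteq> f x" for y
      using Ints_nonzero_abs_ge1[of "f y - f x"] assms(2) x that by simp
    then show "\<exists>e>0. \<forall>y. y \<in> {a..b} \<and> f y \<noteq> f x \<longrightarrow> e \<le> norm (f y - f x)"
      by (intro exI[of _ 1]) auto
  qed (use assms in auto)
  then show ?thesis
    using assms(3) unfolding constant_on_def by (metis atLeastAtMost_iff order_refl)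
qed

text \<open>Divided by 2 \<pi>, the difference of two lifts is continuous and integer-valued, hence
  constant.\<close>

lemma continuous_exp_ii_eq:
  fixes f g :: "real \<Rightarrow> real"
  assumes "continuous_on {a..b} f" "continuous_on {a..b} g" "a \<le> b"
    and "\<And>s. s \<in> {a..b} \<Longrightarrow> exp (\<i> * complex_of_real (f s)) = exp (\<i> * complex_of_real (g s))"
  shows "f b - g b = f a - g a"
proof -
  have "(f b - g b) / (2 * pi) = (f a - g a) / (2 * pi)"
  proof (rule continuous_Ints_constant[where f = "\<lambda>s. (f s - g s) / (2 * pi)"])
    show "continuous_on {a..b} (\<lambda>s. (f s - g s) / (2 * pi))"
      using assms(1,2) by (intro continuous_intros) auto
    show "(f s - g s) / (2 * pi) \<in> \<int>" if s: "s \<in> {a..b}" for s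
    proof -
      obtain k :: int where "f s = g s + 2 * pi * of_int k"
        using assms(4)[OF s] unfolding exp_ii_eq_iff by blast
      then have "(f s - g s) / (2 * pi) = of_int k"
        by simp
      then show ?thesis
        by simp
    qed
  qed (rule assms)
  then show ?thesis
    by simp
qed

lemma same_spectrum_exp_sum:
  assumes "same_spectrum N \<theta> \<theta>'"
  shows "exp (\<i> * complex_of_real (\<Sum>j<N. \<theta> j)) = exp (\<i> * complex_of_real (\<Sum>j<N. \<theta>' j))"
proof -
  have "(\<Sum>j<N. \<theta> j) = (\<Sum>j<N. \<theta>' j) + 2 * pi * of_int (floor_sum N \<theta>' 0 - floor_sum N \<theta> 0)"
    using floor_sum_diff[OF assms, of 0] by (simp add: field_simps)
  then show ?thesis
    unfolding exp_ii_eq_iff by blast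
qed

text \<open>With a constant number of angles in 2 \<pi> \<int>, the set of times at which a given
  angle lies there is both closed and open. By connectedness the angle either stays at one multiple
  of 2 \<pi> or remains strictly between two consecutive ones.\<close>

lemma eigen_angles_no_crossing:
  fixes \<theta> :: "real \<Rightarrow> nat \<Rightarrow> real"
  assumes cont: "\<And>j. j < N \<Longrightarrow> continuous_on {a..b} (\<lambda>s. \<theta> s j)" and "a \<le> b"
    and card: "\<And>s. s \<in> {a..b} \<Longrightarrow> card {j. j < N \<and> exp (\<i> * complex_of_real (\<theta> s j)) = 1} = k"
    and j: "j < N"
  shows "\<bar>\<theta> b j - \<theta> a j\<bar> \<le> 2 * pi"
proof -
  define e where "e s j = exp (\<i> * complex_of_real (\<theta> s j))" for s j
  define A where "A s = {j. j < N \<and> e s j = 1}" for s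
  have finA: "finite (A s)" for s
    by (simp add: A_def)
  have e_cont: "continuous_on {a..b} (\<lambda>s. e s i)" if "i < N" for i
    unfolding e_def using cont[OF that] by (intro continuous_intros) auto
  have closed1: "closed {s\<in>{a..b}. e s i = 1}" if "i < N" for i
    using continuous_closed_preimage_constant[OF e_cont[OF that]] by simp
  define C where "C = {s\<in>{a..b}. e s j = 1}"
  \<comment> \<open>The complement of \<open>C\<close> as a finite union of closed sets: angle
    \<open>j\<close> is off 2 \<pi> \<int> exactly when \<open>k\<close> other angles, indexed by
    some \<open>B\<close>, account for the whole count.\<close>
  define D where "D = (\<Union>B\<in>{B. B \<subseteq> {..<N} \<and> card B = k \<and> j \<notin> B}. {s\<in>{a..b}. \<forall>i\<in>B. e s i = 1})"
  have "closed C"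
    using closed1[OF j] by (simp add: C_def)
  have "closed D"
    unfolding D_def
  proof (intro closed_UN ballI)
    show "finite {B. B \<subseteq> {..<N} \<and> card B = k \<and> j \<notin> B}"
      by (rule finite_subset[of _ "Pow {..<N}"]) auto
    fix B assume B: "B \<in> {B. B \<subseteq> {..<N} \<and> card B = k \<and> j \<notin> B}"
    have "{s\<in>{a..b}. \<forall>i\<in>B. e s i = 1} = {a..b} \<inter> (\<Inter>i\<in>B. {s\<in>{a..b}. e s i = 1})"
      by auto
    also have "closed \<dots>"
      using B closed1 by (intro closed_Int closed_INT) auto
    finally show "closed {s\<in>{a..b}. \<forall>i\<in>B. e s i = 1}" .
  qed
  have D_eq: "s \<in> D \<longleftrightarrow> e s j \<noteq> 1" if s: "s \<in> {a..b}" for s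
  proof
    assume "s \<in> D"
    then obtain B where B: "B \<subseteq> {..<N}" "card B = k" "j \<notin> B" "\<forall>i\<in>B. e s i = 1"
      by (auto simp: D_def)
    have "B \<subseteq> A s"
      using B by (auto simp: A_def)
    moreover have "card (A s) = card B"
      using card[OF s] B by (simp add: A_def e_def)
    ultimately have "A s = B"
      using card_subset_eq[OF finA] by metis
    then show "e s j \<noteq> 1"
      using B(3) j by (auto simp: A_def)
  next
    assume "e s j \<noteq> 1"
    then have "A s \<subseteq> {..<N}" "card (A s) = k" "j \<notin> A s" "\<forall>i\<in>A s. e s i = 1"
      using card[OF s] by (auto simp: A_def e_def)
    then show "s \<in> D"
      using s unfolding D_def by blast
  qed
  have e1: "e s j = 1 \<longleftrightarrow> \<theta> s j / (2 * pi) \<in> \<int>" for s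
  proof -
    have "e s j = 1 \<longleftrightarrow> (\<exists>n::int. \<theta> s j = 2 * pi * of_int n)"
      using exp_ii_eq_iff[of "\<theta> s j" 0] by (simp add: e_def)
    also have "\<dots> \<longleftrightarrow> (\<exists>n::int. \<theta> s j / (2 * pi) = of_int n)"
      by (simp add: field_simps)
    finally show ?thesis
      by (auto simp: Ints_def)
  qed
  have "C = {} \<or> D \<inter> {a..b} = {}"
  proof (rule ccontr)
    assume "\<not> (C = {} \<or> D \<inter> {a..b} = {})"
    moreover have "C \<subseteq> {a..b}" "C \<inter> D \<inter> {a..b} = {}" "{a..b} \<subseteq> C \<union> D"
      using D_eq by (auto simp: C_def)
    ultimately have "\<not> connected {a..b}"
      using \<open>closed C\<close> \<open>closed D\<close> unfolding connected_closed by blast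
    then show False
      by simp
  qed
  then consider "\<forall>s\<in>{a..b}. e s j = 1" | "\<forall>s\<in>{a..b}. e s j \<noteq> 1"
    using D_eq unfolding C_def by blast
  then show ?thesis
  proof cases
    case 1
    have "\<theta> b j / (2 * pi) = \<theta> a j / (2 * pi)"
    proof (rule continuous_Ints_constant[OF _ _ \<open>a \<le> b\<close>])
      show "continuous_on {a..b} (\<lambda>s. \<theta> s j / (2 * pi))"
        using cont[OF j] by (intro continuous_intros) auto
    qed (use 1 e1 in auto)
    then show ?thesis
      by simp
  next
    case 2
    show ?thesis
    proof (rule ccontr)
      assume far: "\<not> ?thesis"
      define x y where "x = min (\<theta> a j) (\<theta> b j)" and "y = max (\<theta> a j) (\<theta> b j)"
      \<comment> \<open>A range longer than 2 \<pi> contains the last multiple of 2 \<pi> below its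
        upper end, which the angle would then attain.\<close>
      have xy: "x + 2 * pi < y"
        using far by (auto simp: x_def y_def min_def max_def)
      let ?z = "2 * pi * of_int \<lfloor>y / (2 * pi)\<rfloor>"
      have z: "?z \<le> y" "y < ?z + 2 * pi"
        using floor_divide_lower[of "2 * pi" y] floor_divide_upper[of "2 * pi" y]
        by (simp_all add: algebra_simps)
      have "is_interval ((\<lambda>s. \<theta> s j) ` {a..b})"
        unfolding is_interval_connected_1 using cont[OF j] by (intro connected_continuous_image) auto
      moreover have "x \<in> (\<lambda>s. \<theta> s j) ` {a..b}" "y \<in> (\<lambda>s. \<theta> s j) ` {a..b}"
        using \<open>a \<le> b\<close> by (auto simp: x_def y_def min_def max_def)
      ultimately have "?z \<in> (\<lambda>s. \<theta> s j) ` {a..b}"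
        using xy z unfolding is_interval_1 by (meson less_imp_le add_less_cancel_right less_trans)
      then obtain s where "s \<in> {a..b}" "\<theta> s j = ?z"
        by auto
      with 2 e1[of s] show False
        by simp
    qed
  qed
qed

context split_form
begin

section \<open>Sorted angles of the operator of a Lagrangian pair\<close>

lemma pair_op_eigframe_exists:
  assumes "lagrangian L" "lagrangian L'" "onb Y N b"
  shows "\<exists>E \<theta>. eigframe N (opmat b (pair_op L L')) E \<theta>"
  using finite_span pos pair_op_isometry[OF assms(1,2)]
  by (intro eigframe_exists[OF assms(3) subspaces(1) _ _ _ pair_op_clinear[OF assms(1,2)] pair_op_closed[OF assms(1,2)]])
    auto

lemma pair_op_matrix_mult:
  assumes L: "lagrangian L" "lagrangian L'" "lagrangian L''" and b: "onb Y N b" and j: "j < N"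
  shows "opmat b (pair_op L L'') i j = (\<Sum>k<N. opmat b (pair_op L L') i k * opmat b (pair_op L' L'') k j)"
proof -
  have bj: "b j \<in> Y"
    using b j by (simp add: onb_def)
  then have "pair_op L' L'' (b j) \<in> Y"
    using pair_op_closed[OF L(2,3)] by blast
  from opmat_comp[where V = "pair_op L' L''" and j = j, OF b subspaces(1) pair_op_clinear[OF L(1,2)] this]
  have "opmat b (\<lambda>x. pair_op L L' (pair_op L' L'' x)) i j
      = (\<Sum>k<N. opmat b (pair_op L L') i k * opmat b (pair_op L' L'') k j)" .
  then show ?thesis
    unfolding opmat_def pair_op_comp[OF L bj] .
qed

lemma pair_op_sorted_frame_exists:
  assumes "lagrangian L" "lagrangian L'" "onb Y N b" "0 < N"
    and "cdet N (opmat b (pair_op L L')) = exp (\<i> * complex_of_real \<Theta>)"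
  shows "\<exists>E \<theta>. sorted_frame N (opmat b (pair_op L L')) \<Theta> E \<theta>"
  using pair_op_eigframe_exists[OF assms(1-3)] sorted_frame_exists[OF _ assms(4,5)] by blast

lemma pair_op_multiplicity:
  assumes "lagrangian L" "lagrangian L'" "onb Y N b" "eigframe N (opmat b (pair_op L L')) E \<theta>"
  shows "card {j. j < N \<and> exp (\<i> * complex_of_real (\<theta> j)) = z} = cdim {x\<in>Y. pair_op L L' x = z *\<^sub>C x}"
  using eigframe_multiplicity[OF assms(3) subspaces(1) pair_op_clinear[OF assms(1,2)]
      pair_op_closed[OF assms(1,2)] assms(4)] by simp

text \<open>Supplies the uniqueness that the limit argument asks for: all frames of the limit
  operator share its eigenspace dimensions, and order and sum fix the angles.\<close>

lemma sorted_angles_tendsto: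
  assumes L: "lagrangian L" "lagrangian L'" and b: "onb Y N b"
    and frames: "eventually (\<lambda>p. sorted_frame N (a p) (\<Theta> p) (E p) (\<theta> p)) F"
    and a: "\<And>i j. i < N \<Longrightarrow> j < N \<Longrightarrow> ((\<lambda>p. a p i j) \<longlongrightarrow> opmat b (pair_op L L') i j) F"
    and \<Theta>: "(\<Theta> \<longlongrightarrow> \<Theta>0) F"
    and frame: "sorted_frame N (opmat b (pair_op L L')) \<Theta>0 E0 \<theta>0" and j: "j < N"
  shows "((\<lambda>p. \<theta> p j) \<longlongrightarrow> \<theta>0 j) F"
proof (rule sorted_frame_tendsto[OF frames a \<Theta> _ j])
  fix E \<eta> assume "sorted_frame N (opmat b (pair_op L L')) \<Theta>0 E \<eta>"
  moreover from this frame have "same_spectrum N \<eta> \<theta>0"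
    using pair_op_multiplicity[OF L b, of E \<eta>] pair_op_multiplicity[OF L b, of E0 \<theta>0]
    by (simp add: same_spectrum_def sorted_frame_def)
  ultimately show "\<eta> j = \<theta>0 j"
    using frame j unfolding sorted_frame_def by (intro sorted_angles_unique) auto
qed

lemma sorted_angles_continuous:
  assumes lag: "\<And>s. s \<in> I \<Longrightarrow> lagrangian (\<Lambda> s) \<and> lagrangian (\<Lambda>' s)" and b: "onb Y N b"
    and a: "\<And>i j. i < N \<Longrightarrow> j < N \<Longrightarrow> continuous_on I (\<lambda>s. opmat b (pair_op (\<Lambda> s) (\<Lambda>' s)) i j)"
    and \<Theta>: "continuous_on I \<Theta>"
    and frames: "\<And>s. s \<in> I \<Longrightarrow> sorted_frame N (opmat b (pair_op (\<Lambda> s) (\<Lambda>' s))) (\<Theta> s) (E s) (\<theta> s)"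
    and j: "j < N"
  shows "continuous_on I (\<lambda>s. \<theta> s j)"
  unfolding continuous_on_def
proof
  fix s assume s: "s \<in> I"
  show "((\<lambda>s. \<theta> s j) \<longlongrightarrow> \<theta> s j) (at s within I)"
  proof (rule sorted_angles_tendsto[of "\<Lambda> s" "\<Lambda>' s"])
    show "eventually (\<lambda>s. sorted_frame N (opmat b (pair_op (\<Lambda> s) (\<Lambda>' s))) (\<Theta> s) (E s) (\<theta> s)) (at s within I)"
      unfolding eventually_at_topological using frames by auto
    show "((\<lambda>s. opmat b (pair_op (\<Lambda> s) (\<Lambda>' s)) i k)
        \<longlongrightarrow> opmat b (pair_op (\<Lambda> s) (\<Lambda>' s)) i k) (at s within I)" if "i < N" "k < N" for i k
      using a[OF that] s by (simp add: continuous_on_def)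
    show "(\<Theta> \<longlongrightarrow> \<Theta> s) (at s within I)"
      using \<Theta> s by (simp add: continuous_on_def)
  qed (use lag s b frames j in auto)
qed

text \<open>Along the two paths the intersection \<open>\<Lambda>1 s \<inter> \<Lambda>2 s\<close> has constant dimension, so no
  eigenvalue of \<open>pair_op (\<Lambda>1 s) (\<Lambda>2 s)\<close> crosses 1 and the total angle of this unitary operator,
  which is the difference of the two total angles, is almost constant.\<close>

lemma total_angle_difference:
  fixes a c :: real
  assumes "a \<le> c" and lag: "\<And>s. s \<in> {a..c} \<Longrightarrow> lagrangian (\<Lambda>1 s) \<and> lagrangian (\<Lambda>2 s)" "lagrangian L'"
    and b: "onb Y N b"
    and M1: "\<And>i j. i < N \<Longrightarrow> j < N \<Longrightarrow> continuous_on {a..c} (\<lambda>s. opmat b (pair_op (\<Lambda>1 s) L') i j)"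
    and M2: "\<And>i j. i < N \<Longrightarrow> j < N \<Longrightarrow> continuous_on {a..c} (\<lambda>s. opmat b (pair_op (\<Lambda>2 s) L') i j)"
    and \<Theta>1: "continuous_on {a..c} \<Theta>1"
      "\<And>s. s \<in> {a..c} \<Longrightarrow> cdet N (opmat b (pair_op (\<Lambda>1 s) L')) = exp (\<i> * complex_of_real (\<Theta>1 s))"
    and \<Theta>2: "continuous_on {a..c} \<Theta>2"
      "\<And>s. s \<in> {a..c} \<Longrightarrow> cdet N (opmat b (pair_op (\<Lambda>2 s) L')) = exp (\<i> * complex_of_real (\<Theta>2 s))"
    and dim: "\<And>s. s \<in> {a..c} \<Longrightarrow> cdim {y\<in>Y. pair_op (\<Lambda>1 s) (\<Lambda>2 s) y = y} = d"
  shows "\<bar>(\<Theta>1 c - \<Theta>2 c) - (\<Theta>1 a - \<Theta>2 a)\<bar> \<le> 2 * pi * real N"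
proof -
  \<comment> \<open>The operator of the pair is the first operator times the adjoint of the second,
    so its entries inherit continuity in \<open>s\<close>.\<close>
  have Q: "opmat b (pair_op (\<Lambda>1 s) (\<Lambda>2 s)) i j
      = (\<Sum>k<N. opmat b (pair_op (\<Lambda>1 s) L') i k * cnj (opmat b (pair_op (\<Lambda>2 s) L') j k))"
    if s: "s \<in> {a..c}" and ij: "i < N" "j < N" for s i j
  proof -
    have lags: "lagrangian (\<Lambda>1 s)" "lagrangian (\<Lambda>2 s)"
      using lag(1)[OF s] by simp_all
    have "opmat b (pair_op (\<Lambda>1 s) (\<Lambda>2 s)) i j
        = (\<Sum>k<N. opmat b (pair_op (\<Lambda>1 s) L') i k * opmat b (pair_op L' (\<Lambda>2 s)) k j)"
      by (rule pair_op_matrix_mult[OF lags(1) lag(2) lags(2) b ij(2)])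
    also have "\<dots> = (\<Sum>k<N. opmat b (pair_op (\<Lambda>1 s) L') i k * cnj (opmat b (pair_op (\<Lambda>2 s) L') j k))"
      by (intro sum.cong refl) (simp add: pair_op_inverse_matrix[OF lags(2) lag(2) b] ij)
    finally show ?thesis .
  qed
  have Q_cont: "continuous_on {a..c} (\<lambda>s. opmat b (pair_op (\<Lambda>1 s) (\<Lambda>2 s)) i j)" if "i < N" "j < N" for i j
  proof -
    have "continuous_on {a..c} (\<lambda>s. \<Sum>k<N. opmat b (pair_op (\<Lambda>1 s) L') i k * cnj (opmat b (pair_op (\<Lambda>2 s) L') j k))"
      using that by (intro continuous_intros M1 M2) auto
    then show ?thesis
      using Q that by (subst continuous_on_cong[OF refl Q]) auto
  qed
  have Q_det: "cdet N (opmat b (pair_op (\<Lambda>1 s) (\<Lambda>2 s))) = exp (\<i> * complex_of_real (\<Theta>1 s - \<Theta>2 s))"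
    if s: "s \<in> {a..c}" for s
  proof -
    have "cdet N (opmat b (pair_op (\<Lambda>1 s) L'))
        = cdet N (opmat b (pair_op (\<Lambda>1 s) (\<Lambda>2 s))) * cdet N (opmat b (pair_op (\<Lambda>2 s) L'))"
      using pair_op_matrix_mult[OF conjunct1[OF lag(1)[OF s]] conjunct2[OF lag(1)[OF s]] lag(2) b]
      by (rule cdet_mult)
    then show ?thesis
      unfolding \<Theta>1(2)[OF s] \<Theta>2(2)[OF s] by (simp add: right_diff_distrib exp_diff)
  qed
  show ?thesis
  \<comment> \<open>Without eigenvalues there are no angles to sort; the determinant is then 1 and
    its continuous argument constant.\<close>
  proof (cases "N = 0")
    case True
    have "exp (\<i> * complex_of_real (\<Theta>1 s - \<Theta>2 s)) = exp (\<i> * complex_of_real 0)" if "s \<in> {a..c}" for s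
      using Q_det[OF that] cdet_diagonal[of N "opmat b (pair_op (\<Lambda>1 s) (\<Lambda>2 s))" "\<lambda>_. 1"] True by simp
    then have "\<Theta>1 c - \<Theta>2 c - 0 = \<Theta>1 a - \<Theta>2 a - 0"
      using \<Theta>1(1) \<Theta>2(1) \<open>a \<le> c\<close>
      by (intro continuous_exp_ii_eq[where f = "\<lambda>s. \<Theta>1 s - \<Theta>2 s" and g = "\<lambda>_. 0"] continuous_intros)
    then show ?thesis
      by simp
  next
    case False
    have "\<forall>s. \<exists>E \<theta>. s \<in> {a..c} \<longrightarrow> sorted_frame N (opmat b (pair_op (\<Lambda>1 s) (\<Lambda>2 s))) (\<Theta>1 s - \<Theta>2 s) E \<theta>"
      using pair_op_sorted_frame_exists[OF _ _ b _ Q_det] lag(1) False by blast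
    then obtain E \<theta> where frame:
        "\<And>s. s \<in> {a..c} \<Longrightarrow> sorted_frame N (opmat b (pair_op (\<Lambda>1 s) (\<Lambda>2 s))) (\<Theta>1 s - \<Theta>2 s) (E s) (\<theta> s)"
      by metis
    have cont: "continuous_on {a..c} (\<lambda>s. \<theta> s j)" if "j < N" for j
      using sorted_angles_continuous[OF lag(1) b Q_cont _ frame that] \<Theta>1(1) \<Theta>2(1)
      by (auto intro!: continuous_intros)
    have card: "card {j. j < N \<and> exp (\<i> * complex_of_real (\<theta> s j)) = 1} = d" if s: "s \<in> {a..c}" for s
      using pair_op_multiplicity[OF _ _ b, of "\<Lambda>1 s" "\<Lambda>2 s" "E s" "\<theta> s" 1] lag(1)[OF s] frame[OF s] dim[OF s]
      by (simp add: sorted_frame_def scaleC_one)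
    have "\<bar>\<theta> c j - \<theta> a j\<bar> \<le> 2 * pi" if "j < N" for j
      by (rule eigen_angles_no_crossing[OF cont \<open>a \<le> c\<close> card that])
    then have "(\<Sum>j<N. \<bar>\<theta> c j - \<theta> a j\<bar>) \<le> (\<Sum>j<N. 2 * pi)"
      by (intro sum_mono) simp
    moreover have "\<bar>\<Sum>j<N. \<theta> c j - \<theta> a j\<bar> \<le> (\<Sum>j<N. \<bar>\<theta> c j - \<theta> a j\<bar>)"
      by (rule sum_abs)
    moreover have "(\<Sum>j<N. \<theta> c j - \<theta> a j) = (\<Theta>1 c - \<Theta>2 c) - (\<Theta>1 a - \<Theta>2 a)"
      using frame[of a] frame[of c] \<open>a \<le> c\<close> by (simp add: sorted_frame_def sum_subtractf)
    ultimately show ?thesis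
      by (simp add: mult_ac)
  qed
qed

end

text \<open>Any admissible choice of angles has a sum that lifts the determinant, so this sum
  differs from \<open>\<Theta>\<close> by a constant. As the path starts at \<open>L'\<close>, the
  initial angles are multiples of 2 \<pi> and contribute exactly that constant. This proves
  independence of the choice and evaluates the definite description; sorted angles show that a
  choice exists.\<close>

lemma maslov_index_eq:
  assumes sf: "split_form (\<lambda>x y. - \<i> * \<Omega> x y) (Xplus G \<Omega>) (Xminus G \<Omega>) S"
    and b: "hermitian_form.onb (\<lambda>x y. - \<i> * \<Omega> x y) (Xplus G \<Omega>) N b"
    and lag: "\<And>s. s \<in> {0..t} \<Longrightarrow> split_form.lagrangian (\<lambda>x y. - \<i> * \<Omega> x y) (\<Lambda> s)"
    and "0 \<le> t" and \<Lambda>0: "\<Lambda> 0 = L'"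
    and M: "\<And>s i j. M s i j = hermitian_form.opmat (\<lambda>x y. - \<i> * \<Omega> x y) b
      (split_form.pair_op (Xplus G \<Omega>) (Xminus G \<Omega>) (\<Lambda> s) L') i j"
    and M_cont: "\<And>i j. i < N \<Longrightarrow> j < N \<Longrightarrow> continuous_on {0..t} (\<lambda>s. M s i j)"
    and \<Theta>: "continuous_on {0..t} \<Theta>" "\<Theta> 0 = 0" "\<And>s. s \<in> {0..t} \<Longrightarrow> cdet N (M s) = exp (\<i> * complex_of_real (\<Theta> s))"
    and frame: "sorted_frame N (M t) (\<Theta> t) E \<theta>"
  shows "maslov_index G \<Omega> 0 t \<Lambda> (\<lambda>_. L') = - floor_sum N \<theta> 0"
proof -
  interpret split_form "\<lambda>x y. - \<i> * \<Omega> x y" "Xplus G \<Omega>" "Xminus G \<Omega>" S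
    by (rule sf)
  have M': "M s = opmat b (pair_op (\<Lambda> s) L')" for s
    by (intro ext) (rule M)
  have L': "lagrangian L'"
    using lag[of 0] \<open>0 \<le> t\<close> \<Lambda>0 by simp
  have dimN: "cdim (UNIV :: 'a set) div 2 = N"
    using cdim_UNIV[OF L' b] by simp
  define spec where "spec s \<eta> \<longleftrightarrow>
      (\<forall>z. card {j. j < N \<and> exp (\<i> * complex_of_real (\<eta> j)) = z} = cdim {x\<in>Xplus G \<Omega>. pair_op (\<Lambda> s) L' x = z *\<^sub>C x})"
    for s and \<eta> :: "nat \<Rightarrow> real"
  have spec_frame: "spec s \<eta>" if "s \<in> {0..t}" "eigframe N (M s) E' \<eta>" for s E' \<eta>
    using pair_op_multiplicity[OF lag[OF that(1)] L' b, of E' \<eta>] that(2) by (simp add: spec_def M')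
  have spec_same: "same_spectrum N \<eta> \<eta>'" if "spec s \<eta>" "spec s \<eta>'" for s \<eta> \<eta>'
    using that by (simp add: spec_def same_spectrum_def)
  \<comment> \<open>The definition numbers the angles from 1 to \<open>N\<close>, the sorted angles
    are numbered from 0.\<close>
  have angles_iff: "eigen_angles G \<Omega> N 0 t \<Lambda> (\<lambda>_. L') \<eta> \<longleftrightarrow>
      (\<forall>j<N. continuous_on {0..t} (\<eta> (Suc j))) \<and> (\<forall>s\<in>{0..t}. spec s (\<lambda>j. \<eta> (Suc j) s))" for \<eta>
  proof -
    have "card {j\<in>{1..N}. exp (\<i> * complex_of_real (\<eta> j s)) = z}
        = card {j. j < N \<and> exp (\<i> * complex_of_real (\<eta> (Suc j) s)) = z}" for s z
    proof -
      have "{j\<in>{1..N}. exp (\<i> * complex_of_real (\<eta> j s)) = z}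
          = Suc ` {j. j < N \<and> exp (\<i> * complex_of_real (\<eta> (Suc j) s)) = z}"
      proof (intro equalityI subsetI)
        fix j assume "j \<in> {j\<in>{1..N}. exp (\<i> * complex_of_real (\<eta> j s)) = z}"
        then show "j \<in> Suc ` {j. j < N \<and> exp (\<i> * complex_of_real (\<eta> (Suc j) s)) = z}"
          by (intro image_eqI[of _ _ "j - 1"]) auto
      qed auto
      then show ?thesis
        by (simp add: card_image)
    qed
    moreover have "(\<forall>j\<in>{1..N}. continuous_on {0..t} (\<eta> j)) \<longleftrightarrow> (\<forall>j<N. continuous_on {0..t} (\<eta> (Suc j)))"
    proof
      assume *: "\<forall>j<N. continuous_on {0..t} (\<eta> (Suc j))"
      show "\<forall>j\<in>{1..N}. continuous_on {0..t} (\<eta> j)"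
      proof
        fix j assume "j \<in> {1..N}"
        then show "continuous_on {0..t} (\<eta> j)"
          using * by (cases j) auto
      qed
    qed auto
    ultimately show ?thesis
      by (simp add: eigen_angles_def spec_def lag_pair_op_eq[OF sf])
  qed
  \<comment> \<open>Turns the ceilings of the index into the floors of \<open>floor_sum\<close> at
    0.\<close>
  have ceil: "\<lceil>x / (2 * pi)\<rceil> = - \<lfloor>(0 - x) / (2 * pi)\<rfloor>" for x :: real
    by (simp add: ceiling_def)
  have index: "(\<Sum>j=1..N. \<lceil>\<eta> j t / (2 * pi)\<rceil> - \<lceil>\<eta> j 0 / (2 * pi)\<rceil>) = - floor_sum N \<theta> 0"
    if \<eta>: "eigen_angles G \<Omega> N 0 t \<Lambda> (\<lambda>_. L') \<eta>" for \<eta>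
  proof -
    let ?\<eta> = "\<lambda>s j. \<eta> (Suc j) s"
    define \<Psi> where "\<Psi> s = (\<Sum>j<N. ?\<eta> s j)" for s
    have spec: "spec s (?\<eta> s)" if "s \<in> {0..t}" for s
      using \<eta> that by (simp add: angles_iff)
    have "exp (\<i> * complex_of_real (\<Psi> s)) = exp (\<i> * complex_of_real (\<Theta> s))" if s: "s \<in> {0..t}" for s
    proof -
      obtain E' \<eta>' where fr: "eigframe N (M s) E' \<eta>'"
        using pair_op_eigframe_exists[OF lag[OF s] L' b] by (auto simp: M')
      have "exp (\<i> * complex_of_real (\<Psi> s)) = exp (\<i> * complex_of_real (\<Sum>j<N. \<eta>' j))"
        unfolding \<Psi>_def using spec_same[OF spec[OF s] spec_frame[OF s fr]] by (rule same_spectrum_exp_sum)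
      also have "\<dots> = cdet N (M s)"
        using cdet_eigframe[OF fr] by simp
      finally show ?thesis
        by (simp add: \<Theta>(3)[OF s])
    qed
    moreover have "continuous_on {0..t} \<Psi>"
      unfolding \<Psi>_def using \<eta> by (intro continuous_on_sum) (simp add: angles_iff)
    ultimately have \<Psi>: "\<Psi> t - \<Theta> t = \<Psi> 0 - \<Theta> 0"
      using \<Theta>(1) \<open>0 \<le> t\<close> by (intro continuous_exp_ii_eq) auto
    have "eigframe N (M 0) (\<lambda>i j. if i = j then 1 else 0) (\<lambda>_. 0)"
      unfolding eigframe_def
    proof (intro conjI allI impI)
      fix i j assume ij: "i < N" "j < N"
      have bj: "b j \<in> Xplus G \<Omega>" and bij: "- \<i> * \<Omega> (b j) (b i) = (if i = j then 1 else 0)"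
        using b ij unfolding onb_def orthonormal_def by auto
      have "(\<Sum>k<N. M 0 i k * (if k = j then 1 else 0)) = (\<Sum>k<N. if k = j then M 0 i k else 0)"
        by (intro sum.cong) auto
      also have "\<dots> = M 0 i j"
        using ij by simp
      also have "\<dots> = (if i = j then 1 else 0)"
        unfolding M' \<Lambda>0 opmat_def pair_op_self[OF L' bj] by (rule bij)
      finally show "(\<Sum>k<N. M 0 i k * (if k = j then 1 else 0))
          = (if i = j then 1 else 0) * exp (\<i> * complex_of_real 0)"
        by simp
      have "(\<Sum>k<N. cnj (if k = i then 1 else 0) * (if k = j then 1 else 0))
          = (\<Sum>k<N. if k = i then (if k = j then 1 else 0) else (0::complex))"
        by (intro sum.cong) auto
      then show "(\<Sum>k<N. cnj (if k = i then 1 else 0) * (if k = j then 1 else 0)) = (if i = j then 1 else (0::complex))"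
        using ij by simp
    qed
    then have "same_spectrum N (?\<eta> 0) (\<lambda>_. 0)"
      using spec_same[OF spec spec_frame] \<open>0 \<le> t\<close> by simp
    from floor_sum_diff[OF this, of 0]
    \<comment> \<open>All eigenvalues at the start are 1, so comparing with the zero angles shows
      that no rounding occurs there.\<close>
    have 0: "real_of_int (floor_sum N (?\<eta> 0) 0) = - \<Psi> 0 / (2 * pi)"
      by (simp add: \<Psi>_def floor_sum_def)
    have "same_spectrum N (?\<eta> t) \<theta>"
      using spec_same[OF spec spec_frame, of t E \<theta>] frame \<open>0 \<le> t\<close> by (simp add: sorted_frame_def)
    from floor_sum_diff[OF this, of 0]
    have "real_of_int (floor_sum N (?\<eta> t) 0) - real_of_int (floor_sum N \<theta> 0) = (\<Theta> t - \<Psi> t) / (2 * pi)"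
      using frame by (simp add: sorted_frame_def \<Psi>_def)
    moreover have "\<Theta> t - \<Psi> t = - \<Psi> 0"
      using \<Psi> \<Theta>(2) by simp
    ultimately have "real_of_int (floor_sum N (?\<eta> t) 0) - real_of_int (floor_sum N (?\<eta> 0) 0) = real_of_int (floor_sum N \<theta> 0)"
      using 0 by simp
    then have "floor_sum N (?\<eta> t) 0 - floor_sum N (?\<eta> 0) 0 = floor_sum N \<theta> 0"
      by linarith
    moreover have "(\<Sum>j=1..N. \<lceil>\<eta> j t / (2 * pi)\<rceil> - \<lceil>\<eta> j 0 / (2 * pi)\<rceil>)
        = (\<Sum>j<N. \<lceil>\<eta> (Suc j) t / (2 * pi)\<rceil> - \<lceil>\<eta> (Suc j) 0 / (2 * pi)\<rceil>)"
      by (rule sum.reindex_bij_witness[of _ Suc "\<lambda>j. j - 1"]) auto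
    moreover have "\<dots> = floor_sum N (?\<eta> 0) 0 - floor_sum N (?\<eta> t) 0"
      unfolding floor_sum_def ceil by (simp add: sum_subtractf sum_negf)
    ultimately show ?thesis
      by linarith
  qed
  have "\<exists>\<eta>. eigen_angles G \<Omega> N 0 t \<Lambda> (\<lambda>_. L') \<eta>"
  proof (cases "N = 0")
    case True
    have "spec s (\<lambda>_. 0)" if s: "s \<in> {0..t}" for s
    proof -
      obtain E' \<eta>' where "eigframe N (M s) E' \<eta>'"
        using pair_op_eigframe_exists[OF lag[OF s] L' b] by (auto simp: M')
      then show ?thesis
        using spec_frame[OF s, of E' \<eta>'] by (simp add: spec_def True)
    qed
    then show ?thesis
      by (intro exI[of _ "\<lambda>_ _. 0"]) (simp add: angles_iff)
  next
    case False
    have "\<forall>s. \<exists>E \<theta>. s \<in> {0..t} \<longrightarrow> sorted_frame N (M s) (\<Theta> s) E \<theta>"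
      using pair_op_sorted_frame_exists[OF lag L' b] False \<Theta>(3) unfolding M' by blast
    then obtain E' \<theta>' where fr: "\<And>s. s \<in> {0..t} \<Longrightarrow> sorted_frame N (M s) (\<Theta> s) (E' s) (\<theta>' s)"
      by metis
    have "continuous_on {0..t} (\<lambda>s. \<theta>' s j)" if "j < N" for j
      using sorted_angles_continuous[of "{0..t}" \<Lambda> "\<lambda>_. L'" N b \<Theta> E' \<theta>' j] lag L' b M_cont \<Theta>(1) fr that
      by (simp add: M')
    moreover have "spec s (\<theta>' s)" if "s \<in> {0..t}" for s
      using spec_frame[OF that, of "E' s" "\<theta>' s"] fr[OF that] by (simp add: sorted_frame_def)
    ultimately show ?thesis
      by (intro exI[of _ "\<lambda>j s. \<theta>' s (j - 1)"]) (simp add: angles_iff)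
  qed
  then show ?thesis
    unfolding maslov_index_def Let_def dimN using index by (intro the_equality) auto
qed

section \<open>Finite-dimensional complex inner product spaces\<close>

interpretation cinner: hermitian_form "cinner :: 'v::complex_inner \<Rightarrow> 'v \<Rightarrow> complex"
proof
  show "sesquilinear (cinner :: 'v \<Rightarrow> 'v \<Rightarrow> complex)"
    unfolding sesquilinear_def
  proof (intro conjI allI)
    fix x y y' :: 'v and c
    show "cinner x (y + y') = cinner x y + cinner x y'"
      unfolding cinner_commute[of x] cinner_add_left by simp
    show "cinner x (c *\<^sub>C y) = cnj c * cinner x y"
      unfolding cinner_commute[of x] cinner_scaleC_left by simp
  qed (rule cinner_add_left cinner_scaleC_left)+
  show "cinner y x = cnj (cinner x y)" for x y :: 'v
    by (rule cinner_commute)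
qed

lemma norm_scaleC: "norm (c *\<^sub>C x) = cmod c * norm x" for x :: "'v::complex_inner"
proof (rule power2_eq_imp_eq)
  have "(norm (c *\<^sub>C x))\<^sup>2 = Re (c * cnj c * cinner x x)"
    by (simp only: Re_cinner_self[symmetric] cinner.scale_left cinner.scale_right mult_ac)
  also have "\<dots> = (cmod c)\<^sup>2 * (norm x)\<^sup>2"
    unfolding complex_norm_square[symmetric] by (simp add: Re_cinner_self)
  finally show "(norm (c *\<^sub>C x))\<^sup>2 = (cmod c * norm x)\<^sup>2"
    by (simp add: power_mult_distrib)
qed simp_all

lemma cinner_real_le: "2 * Re (cinner x y) \<le> (norm x)\<^sup>2 + (norm y)\<^sup>2"
proof -
  have "0 \<le> Re (cinner (x - y) (x - y))"
    by (simp add: Re_cinner_self)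
  also have "\<dots> = (norm x)\<^sup>2 + (norm y)\<^sup>2 - 2 * Re (cinner x y)"
    by (simp add: cinner.diff_left cinner.diff_right Re_cinner_self cinner_commute[of x y])
  finally show ?thesis
    by simp
qed

lemma clinear_sum:
  assumes "clinear f"
  shows "f (\<Sum>i\<in>I. c i *\<^sub>C v i) = (\<Sum>i\<in>I. c i *\<^sub>C f (v i))"
proof -
  have f: "f (x + y) = f x + f y" "f (c *\<^sub>C x) = c *\<^sub>C f x" for x y c
    using assms unfolding clinear_iff by blast+
  have "f 0 = 0"
    using f(2)[of 0 0] by simp
  then show ?thesis
    by (induction I rule: infinite_finite_induct) (simp_all add: f)
qed

lemma finite_dim_onb:
  fixes S :: "'v::complex_inner set"
  assumes "finite S" "cspan S = UNIV"
  obtains n and e :: "nat \<Rightarrow> 'v" where "cinner.onb UNIV n e"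
  using cinner.exists_onb[of UNIV S] assms by (auto simp: Re_cinner_self)

lemma onb_coeff_le_norm:
  fixes x :: "'v::complex_inner"
  assumes "cinner.onb UNIV n e" "i < n"
  shows "cmod (cinner x (e i)) \<le> norm x"
proof (rule power2_le_imp_le)
  show "(cmod (cinner x (e i)))\<^sup>2 \<le> (norm x)\<^sup>2"
    using cinner.onb_coeff_le[OF assms(1) _ assms(2), of x] by (simp add: Re_cinner_self)
qed simp

lemma clinear_bounded:
  fixes f :: "'v::complex_inner \<Rightarrow> 'w::complex_inner"
  assumes S: "finite S" "cspan S = (UNIV :: 'v set)" and f: "clinear f"
  obtains K where "0 \<le> K" "\<And>x. norm (f x) \<le> K * norm x"
proof -
  obtain n and e :: "nat \<Rightarrow> 'v" where e: "cinner.onb UNIV n e"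
    using finite_dim_onb[OF S] .
  have "norm (f x) \<le> (\<Sum>i<n. norm (f (e i))) * norm x" for x
  proof -
    have "x = (\<Sum>i<n. cinner x (e i) *\<^sub>C e i)"
      using e unfolding cinner.onb_def by blast
    then have "f x = (\<Sum>i<n. cinner x (e i) *\<^sub>C f (e i))"
      using clinear_sum[OF f] by metis
    then have "norm (f x) \<le> (\<Sum>i<n. norm (cinner x (e i) *\<^sub>C f (e i)))"
      by (simp add: norm_sum)
    also have "\<dots> \<le> (\<Sum>i<n. norm x * norm (f (e i)))"
      unfolding norm_scaleC by (intro sum_mono mult_right_mono onb_coeff_le_norm[OF e]) auto
    finally show ?thesis
      by (simp add: sum_distrib_left mult.commute)
  qed
  then show thesis
    using that[of "\<Sum>i<n. norm (f (e i))"] by (simp add: sum_nonneg)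
qed

lemma clinear_bounded_linear:
  fixes f :: "'v::complex_inner \<Rightarrow> 'w::complex_inner"
  assumes S: "finite S" "cspan S = (UNIV :: 'v set)" and f: "clinear f"
  shows "bounded_linear f"
proof -
  obtain K where "\<And>x. norm (f x) \<le> K * norm x"
    using clinear_bounded[OF assms] by blast
  moreover have "f (x + y) = f x + f y" "f (c *\<^sub>C x) = c *\<^sub>C f x" for x y c
    using f unfolding clinear_iff by blast+
  ultimately show ?thesis
    by (intro bounded_linear_intro[of f K]) (auto simp: scaleR_scaleC mult.commute)
qed

lemma bounded_bilinear_cinner:
  fixes S :: "'v::complex_inner set"
  assumes S: "finite S" "cspan S = UNIV"
  shows "bounded_bilinear (cinner :: 'v \<Rightarrow> 'v \<Rightarrow> complex)"
proof
  obtain n and e :: "nat \<Rightarrow> 'v" where e: "cinner.onb UNIV n e"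
    using finite_dim_onb[OF S] .
  have "norm (cinner x y) \<le> norm x * norm y * real n" for x y :: 'v
  proof -
    have "cinner x y = (\<Sum>i<n. cinner x (e i) * cnj (cinner y (e i)))"
      by (rule cinner.onb_inner[OF e]) simp
    then have "norm (cinner x y) \<le> (\<Sum>i<n. norm (cinner x (e i) * cnj (cinner y (e i))))"
      by (simp add: norm_sum)
    also have "\<dots> \<le> (\<Sum>i<n. norm x * norm y)"
      by (intro sum_mono) (auto simp: norm_mult intro!: mult_mono onb_coeff_le_norm[OF e])
    finally show ?thesis
      by (simp add: mult.commute)
  qed
  then show "\<exists>K. \<forall>x y :: 'v. norm (cinner x y) \<le> norm x * norm y * K"
    by blast
qed (simp_all add: cinner.add_left cinner.add_right cinner.scale_left cinner.scale_right
    scaleR_scaleC[where 'a = 'v] scaleR_conv_of_real)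

section \<open>Linear Hamiltonian systems over a flow\<close>

text \<open>A Gronwall estimate for the squared norm, with an integrating factor. For
  \<open>\<epsilon> = 0\<close> it gives uniqueness of solutions, for small
  \<open>\<epsilon>\<close> continuous dependence on the parameter.\<close>

lemma linear_growth_bound:
  fixes z :: "real \<Rightarrow> 'v::complex_inner"
  assumes S: "finite S" "cspan S = (UNIV :: 'v set)"
    and z: "\<And>t. t \<in> {0..T} \<Longrightarrow> (z has_vector_derivative z' t) (at t)"
    and bound: "\<And>t. t \<in> {0..T} \<Longrightarrow> norm (z' t) \<le> K * norm (z t) + \<epsilon>"
    and "z 0 = 0" and t: "t \<in> {0..T}"
  shows "(norm (z t))\<^sup>2 \<le> 2 * \<epsilon>\<^sup>2 * t * exp ((2 * K\<^sup>2 + 1) * t)"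
proof -
  interpret bounded_bilinear "cinner :: 'v \<Rightarrow> 'v \<Rightarrow> complex"
    by (rule bounded_bilinear_cinner[OF S])
  \<comment> \<open>The 1 comes from bounding twice the real inner product of \<open>z'\<close> and
    \<open>z\<close> by the sum of squared norms, the \<open>2 * K\<^sup>2\<close> from squaring
    \<open>K * norm (z s) + \<epsilon>\<close>.\<close>
  let ?a = "2 * K\<^sup>2 + 1"
  define q where "q s = (norm (z s))\<^sup>2" for s
  define g where "g s = exp (- ?a * s) * q s - 2 * \<epsilon>\<^sup>2 * s" for s
  have "g t \<le> g 0"
  proof (rule DERIV_nonpos_imp_nonincreasing[where f = g])
    show "0 \<le> t"
      using t by simp
    fix s assume "0 \<le> s" "s \<le> t"
    then have s: "s \<in> {0..T}" "0 \<le> s"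
      using t by auto
    let ?n' = "2 * Re (cinner (z' s) (z s))"
    have "((\<lambda>s. cinner (z s) (z s)) has_vector_derivative cinner (z s) (z' s) + cinner (z' s) (z s)) (at s)"
      using z[OF s(1)] z[OF s(1)] by (rule has_vector_derivative)
    from bounded_linear.has_vector_derivative[OF bounded_linear_Re this]
    have n: "(q has_real_derivative ?n') (at s)"
      by (simp add: q_def[abs_def] has_real_derivative_iff_has_vector_derivative Re_cinner_self cinner_commute[of "z' s" "z s"])
    let ?g' = "exp (- ?a * s) * ?n' - ?a * exp (- ?a * s) * q s - 2 * \<epsilon>\<^sup>2"
    have "(g has_real_derivative ?g') (at s)"
      unfolding g_def by (auto intro!: derivative_eq_intros n simp: algebra_simps)
    moreover have "?g' \<le> 0"
    proof -
      have "?n' \<le> (norm (z' s))\<^sup>2 + q s"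
        unfolding q_def by (rule cinner_real_le)
      also have "(norm (z' s))\<^sup>2 \<le> (K * norm (z s) + \<epsilon>)\<^sup>2"
        by (intro power_mono bound s) simp
      also have "(K * norm (z s) + \<epsilon>)\<^sup>2 \<le> 2 * K\<^sup>2 * q s + 2 * \<epsilon>\<^sup>2"
        unfolding q_def using zero_le_power2[of "K * norm (z s) - \<epsilon>"] by (simp add: power2_eq_square algebra_simps)
      finally have "?n' - ?a * q s \<le> 2 * \<epsilon>\<^sup>2"
        by (simp add: algebra_simps)
      then have "exp (- ?a * s) * (?n' - ?a * q s) \<le> exp (- ?a * s) * (2 * \<epsilon>\<^sup>2)"
        by (intro mult_left_mono) auto
      also have "\<dots> \<le> 1 * (2 * \<epsilon>\<^sup>2)"
      proof (rule mult_right_mono)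
        have "0 \<le> ?a * s"
          using s(2) by simp
        then show "exp (- ?a * s) \<le> 1"
          by (simp only: exp_le_one_iff mult_minus_left neg_le_0_iff_le)
      qed simp
      finally show ?thesis
        by (simp add: algebra_simps)
    qed
    ultimately show "\<exists>y. DERIV g s :> y \<and> y \<le> 0"
      by blast
  qed
  then have "exp (- ?a * t) * (norm (z t))\<^sup>2 \<le> 2 * \<epsilon>\<^sup>2 * t"
    by (simp add: g_def q_def \<open>z 0 = 0\<close>)
  then have "exp (?a * t) * (exp (- ?a * t) * (norm (z t))\<^sup>2) \<le> exp (?a * t) * (2 * \<epsilon>\<^sup>2 * t)"
    by (rule mult_left_mono) simp
  moreover have "exp (?a * t) * exp (- ?a * t) = 1"
    by (simp only: mult_exp_exp mult_minus_left right_minus exp_zero)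
  ultimately have "(norm (z t))\<^sup>2 \<le> exp (?a * t) * (2 * \<epsilon>\<^sup>2 * t)"
    by (simp only: mult.assoc[symmetric] mult_1_left)
  then show ?thesis
    by (simp only: mult.commute)
qed

text \<open>The tube lemma replaces uniform continuity, since the parameter space carries no
  metric.\<close>

lemma eventually_uniform_on_compact:
  fixes f :: "'m::topological_space \<Rightarrow> 'k::topological_space \<Rightarrow> 'b::metric_space"
  assumes f: "continuous_on (UNIV \<times> K) (\<lambda>p. f (fst p) (snd p))" and K: "compact K" and "0 < e"
  shows "eventually (\<lambda>\<xi>. \<forall>t\<in>K. dist (f \<xi> t) (f \<xi>0 t) < e) (nhds \<xi>0)"
proof -
  define g where "g p = dist (f (fst p) (snd p)) (f \<xi>0 (snd p))" for p
  have "continuous_on (UNIV \<times> K) (\<lambda>p. f (fst (\<xi>0, snd p)) (snd (\<xi>0, snd p)))"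
    by (rule continuous_on_compose2[OF f]) (auto intro!: continuous_intros)
  then have "continuous_on (UNIV \<times> K) g"
    unfolding g_def using f by (intro continuous_on_dist) auto
  then obtain W where W: "open W" "W \<inter> UNIV \<times> K = g -` {..<e} \<inter> UNIV \<times> K"
    unfolding continuous_on_open_invariant using open_lessThan by metis
  have "{\<xi>0} \<times> K \<subseteq> W"
  proof
    fix p assume "p \<in> {\<xi>0} \<times> K"
    then have "p \<in> g -` {..<e} \<inter> UNIV \<times> K"
      using \<open>0 < e\<close> by (auto simp: g_def)
    then show "p \<in> W"
      using W(2) by blast
  qed
  then obtain X where X: "\<xi>0 \<in> X" "open X" "X \<times> K \<subseteq> W"
    using Elementary_Topology.tube_lemma[OF K W(1)] by blast
  have "dist (f \<xi> t) (f \<xi>0 t) < e" if "\<xi> \<in> X" "t \<in> K" for \<xi> t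
  proof -
    have "(\<xi>, t) \<in> g -` {..<e}"
      using X(3) that W(2) by blast
    then show ?thesis
      by (simp add: g_def)
  qed
  with X show ?thesis
    unfolding eventually_nhds by blast
qed

lemma joint_continuity:
  fixes f :: "'m::topological_space \<Rightarrow> real \<Rightarrow> 'b::metric_space"
  assumes unif: "\<And>\<xi>0 T e. 0 < e \<Longrightarrow> eventually (\<lambda>\<xi>. \<forall>t\<in>{0..T}. dist (f \<xi> t) (f \<xi>0 t) < e) (nhds \<xi>0)"
    and cont: "\<And>\<xi>. continuous_on {0..} (f \<xi>)"
  shows "continuous_on (UNIV \<times> {0..}) (\<lambda>p. f (fst p) (snd p))"
  unfolding continuous_on_def
proof
  fix p :: "'m \<times> real" assume p: "p \<in> UNIV \<times> {0..}"
  obtain \<xi>0 t0 where p_eq: "p = (\<xi>0, t0)" "0 \<le> t0"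
    using p by auto
  let ?F = "at p within UNIV \<times> {0..}"
  show "((\<lambda>p. f (fst p) (snd p)) \<longlongrightarrow> f (fst p) (snd p)) ?F"
  proof (rule tendstoI)
    fix e :: real assume e: "0 < e"
    have "filterlim fst (nhds \<xi>0) ?F"
      using tendsto_fst[OF tendsto_ident_at[of p "UNIV \<times> {0..}"]] by (simp add: p_eq)
    then have "eventually (\<lambda>q. \<forall>t\<in>{0..t0 + 1}. dist (f (fst q) t) (f \<xi>0 t) < e / 2) ?F"
      using e by (intro eventually_compose_filterlim[OF unif]) auto
    moreover have "eventually (\<lambda>q. dist (f \<xi>0 (snd q)) (f \<xi>0 t0) < e / 2) ?F"
    proof -
      have "continuous_on (UNIV \<times> {0..}) (\<lambda>q::'m \<times> real. f \<xi>0 (snd q))"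
        by (rule continuous_on_compose2[OF cont]) (auto intro!: continuous_intros)
      then have "((\<lambda>q. f \<xi>0 (snd q)) \<longlongrightarrow> f \<xi>0 t0) ?F"
        using p by (auto simp: continuous_on_def p_eq)
      then show ?thesis
        using e by (intro tendstoD) auto
    qed
    moreover have "eventually (\<lambda>q. snd q < t0 + 1) ?F"
      using tendsto_snd[OF tendsto_ident_at, of p "UNIV \<times> {0..}"]
      by (rule order_tendstoD) (simp add: p_eq)
    moreover have "eventually (\<lambda>q. q \<in> UNIV \<times> {0..}) ?F"
      by (simp add: eventually_at_filter)
    ultimately show "eventually (\<lambda>q. dist (f (fst q) (snd q)) (f (fst p) (snd p)) < e) ?F"
    proof eventually_elim
      case (elim q)
      then have "dist (f (fst q) (snd q)) (f \<xi>0 (snd q)) < e / 2"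
        by auto
      with elim(2) show ?case
        using dist_triangle_half_l by (metis dist_commute fst_conv snd_conv p_eq(1))
    qed
  qed
qed

locale hamiltonian_flow =
  fixes S :: "'v::complex_inner set" and \<omega> :: "'v \<Rightarrow> 'v \<Rightarrow> complex" and J :: "'v \<Rightarrow> 'v"
    and \<phi> :: "real \<Rightarrow> 'm::t2_space \<Rightarrow> 'm" and B :: "'m \<Rightarrow> 'v \<Rightarrow>\<^sub>L 'v"
    and \<gamma> :: "'m \<Rightarrow> real \<Rightarrow> 'v \<Rightarrow> 'v"
  assumes S: "finite S" "cspan S = UNIV"
    and \<omega>: "symplectic_form \<omega>"
    and J: "clinear J" "bij J" "\<And>x y. \<omega> x y = cinner (J x) y"
    and compact: "compact (UNIV :: 'm set)"
    and flow: "continuous_flow \<phi>"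
    and B: "continuous_on UNIV B" "\<And>\<xi>. self_adjoint (blinfun_apply (B \<xi>))"
    and \<gamma>: "\<And>\<xi>. fundamental_solution (\<lambda>t x. - inv J (B (\<phi> t \<xi>) x)) (\<gamma> \<xi>)"
begin

section \<open>The fundamental solution: symplecticity, cocycle identity, continuity\<close>

lemma flow_continuous: "continuous_on UNIV (\<lambda>p. \<phi> (fst p) (snd p))"
  and flow_add: "\<phi> (s + t) \<xi> = \<phi> s (\<phi> t \<xi>)"
  using flow unfolding continuous_flow_def by blast+

lemma \<gamma>_zero: "\<gamma> \<xi> 0 = id" and \<gamma>_clinear: "clinear (\<gamma> \<xi> t)"
  and \<gamma>_deriv: "((\<lambda>s. \<gamma> \<xi> s x) has_vector_derivative - inv J (B (\<phi> t \<xi>) (\<gamma> \<xi> t x))) (at t)"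
  using \<gamma>[of \<xi>] unfolding fundamental_solution_def by blast+

lemma J_inv: "J (inv J x) = x"
  using J(2) by (simp add: bij_is_surj surj_f_inv_f)

lemma inv_J_clinear: "clinear (inv J)"
proof -
  have J': "J (x + y) = J x + J y" "J (c *\<^sub>C x) = c *\<^sub>C J x" for x y c
    using J(1) unfolding clinear_iff by blast+
  have "inj J"
    using J(2) by (rule bij_is_inj)
  then show ?thesis
    unfolding clinear_iff by (auto simp: J' J_inv inv_f_f intro!: inv_f_eq)
qed

lemma J_minus: "J (- x) = - J x" and inv_J_minus: "inv J (- x) = - inv J x"
proof -
  have "f (- x) = - f x" if "clinear f" for f :: "'v \<Rightarrow> 'v" and x
  proof -
    have "f ((- 1) *\<^sub>C x) = (- 1) *\<^sub>C f x"
      using that unfolding clinear_iff by blast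
    then show ?thesis
      by simp
  qed
  then show "J (- x) = - J x" "inv J (- x) = - inv J x"
    using J(1) inv_J_clinear by blast+
qed

text \<open>Along two solutions \<open>u\<close>, \<open>v\<close> the derivative of
  \<open>\<omega> u v\<close> is the inner product of \<open>u\<close> with \<open>B v\<close> minus
  that of \<open>B u\<close> with \<open>v\<close>, which vanishes by self-adjointness.\<close>

lemma \<gamma>_symplectic: "\<omega> (\<gamma> \<xi> t x) (\<gamma> \<xi> t y) = \<omega> x y"
proof -
  interpret bounded_bilinear "cinner :: 'v \<Rightarrow> 'v \<Rightarrow> complex"
    by (rule bounded_bilinear_cinner[OF S])
  let ?F = "\<lambda>t. \<omega> (\<gamma> \<xi> t x) (\<gamma> \<xi> t y)"
  have "(?F has_vector_derivative 0) (at t)" for t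
  proof -
    let ?u = "\<gamma> \<xi> t x" and ?v = "\<gamma> \<xi> t y" and ?B = "blinfun_apply (B (\<phi> t \<xi>))"
    have "((\<lambda>s. J (\<gamma> \<xi> s x)) has_vector_derivative J (- inv J (?B ?u))) (at t)"
      by (rule bounded_linear.has_vector_derivative[OF clinear_bounded_linear[OF S J(1)] \<gamma>_deriv])
    from has_vector_derivative[OF this \<gamma>_deriv[of \<xi> y t]]
    have "(?F has_vector_derivative
        cinner (J ?u) (- inv J (?B ?v)) + cinner (J (- inv J (?B ?u))) ?v) (at t)"
      by (simp add: J(3))
    moreover have "cinner (J ?u) (- inv J (?B ?v)) = cinner ?u (?B ?v)"
    proof -
      have "cinner (J ?u) (- inv J (?B ?v)) = - cnj (cinner (J (- inv J (?B ?v))) ?u)"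
        using symplectic_formD(2)[OF \<omega>, of ?u] by (simp add: J(3))
      also have "\<dots> = cnj (cinner (?B ?v) ?u)"
        by (simp add: J_minus J_inv minus_left)
      also have "\<dots> = cinner ?u (?B ?v)"
        by (rule cinner_commute[symmetric])
      finally show ?thesis .
    qed
    moreover have "cinner (J (- inv J (?B ?u))) ?v = - cinner ?u (?B ?v)"
      using B(2)[of "\<phi> t \<xi>"] by (simp add: J_minus J_inv minus_left self_adjoint_def)
    ultimately show ?thesis
      by simp
  qed
  then have "\<exists>c. \<forall>t\<in>UNIV. ?F t = c"
    by (intro has_derivative_zero_constant) (auto simp: has_vector_derivative_def)
  then have "?F t = ?F 0"
    by auto
  then show ?thesis
    by (simp add: \<gamma>_zero)
qed

text \<open>Compactness bounds \<open>B\<close> uniformly in the base point. The bound on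
  \<open>inv J\<close> alone serves for differences of values of \<open>B\<close>.\<close>

lemma generator_bounds:
  obtains KJ K where "0 \<le> KJ" "\<And>x. norm (- inv J x) \<le> KJ * norm x"
    and "0 \<le> K" "\<And>\<xi> x. norm (- inv J (B \<xi> x)) \<le> K * norm x"
proof -
  obtain KJ where KJ: "0 \<le> KJ" "\<And>x. norm (inv J x) \<le> KJ * norm x"
    using clinear_bounded[OF S inv_J_clinear] by blast
  have "bounded (range B)"
    using compact_continuous_image[OF B(1) compact] by (rule compact_imp_bounded)
  then obtain KB where KB: "\<And>\<xi>. norm (B \<xi>) \<le> KB"
    by (auto simp: bounded_iff)
  have KB0: "0 \<le> KB"
    using KB[of undefined] norm_ge_zero order_trans by blast
  have "norm (- inv J (B \<xi> x)) \<le> (KJ * KB) * norm x" for \<xi> x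
  proof -
    have "norm (- inv J (B \<xi> x)) \<le> KJ * norm (B \<xi> x)"
      using KJ(2) by simp
    also have "norm (B \<xi> x) \<le> norm (B \<xi>) * norm x"
      by (rule norm_blinfun)
    also have "norm (B \<xi>) * norm x \<le> KB * norm x"
      by (intro mult_right_mono KB) simp
    finally show ?thesis
      using KJ(1) by (simp add: mult_left_mono mult.assoc)
  qed
  then show thesis
    using that[of KJ "KJ * KB"] KJ KB0 by simp
qed

text \<open>Both sides solve the system over \<open>\<phi> t \<xi>\<close> with the same initial
  value; the growth estimate with zero forcing makes their difference vanish.\<close>

lemma \<gamma>_cocycle:
  assumes "0 \<le> s"
  shows "\<gamma> \<xi> (t + s) x = \<gamma> (\<phi> t \<xi>) s (\<gamma> \<xi> t x)"
proof -
  obtain K where K: "\<And>\<xi> x. norm (- inv J (B \<xi> x)) \<le> K * norm x"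
    using generator_bounds by metis
  define z where "z s = \<gamma> \<xi> (t + s) x - \<gamma> (\<phi> t \<xi>) s (\<gamma> \<xi> t x)" for s
  have inv_J_diff: "inv J (u - v) = inv J u - inv J v" for u v
    using inv_J_clinear inv_J_minus[of v] unfolding clinear_iff by (metis diff_conv_add_uminus)
  have z: "(z has_vector_derivative - inv J (B (\<phi> s (\<phi> t \<xi>)) (z s))) (at s)" for s
  proof -
    have "((\<lambda>s. \<gamma> \<xi> (t + s) x) has_vector_derivative
        1 *\<^sub>R - inv J (B (\<phi> (t + s) \<xi>) (\<gamma> \<xi> (t + s) x))) (at s)"
      by (rule vector_diff_chain_at[of "\<lambda>s. t + s" 1 s, unfolded o_def])
        (auto intro!: derivative_eq_intros \<gamma>_deriv)
    then have "((\<lambda>s. \<gamma> \<xi> (t + s) x) has_vector_derivative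
        - inv J (B (\<phi> s (\<phi> t \<xi>)) (\<gamma> \<xi> (t + s) x))) (at s)"
      by (simp add: flow_add[symmetric] add.commute)
    from has_vector_derivative_diff[OF this \<gamma>_deriv[of "\<phi> t \<xi>" "\<gamma> \<xi> t x" s]]
    show ?thesis
      by (simp add: z_def[abs_def] blinfun.diff_right inv_J_diff)
  qed
  have "(norm (z s))\<^sup>2 \<le> 2 * 0\<^sup>2 * s * exp ((2 * K\<^sup>2 + 1) * s)"
  proof (rule linear_growth_bound[OF S z])
    show "z 0 = 0"
      by (simp add: z_def \<gamma>_zero)
    show "s \<in> {0..s}"
      using assms by simp
  qed (use K in auto)
  then show ?thesis
    by (simp add: z_def)
qed

text \<open>The difference of the two solutions satisfies the system over \<open>\<xi>\<close> with
  the difference of the generators, applied to the solution over \<open>\<xi>0\<close>, as forcing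
  term.\<close>

lemma \<gamma>_uniform:
  assumes "0 < e"
  shows "eventually (\<lambda>\<xi>. \<forall>t\<in>{0..T}. dist (\<gamma> \<xi> t x) (\<gamma> \<xi>0 t x) < e) (nhds \<xi>0)"
proof -
  obtain KJ K where KJ: "0 \<le> KJ" "\<And>x. norm (- inv J x) \<le> KJ * norm x"
    and K: "\<And>\<xi> x. norm (- inv J (B \<xi> x)) \<le> K * norm x"
    using generator_bounds by metis
  have "continuous_on {0..T} (\<lambda>t. \<gamma> \<xi>0 t x)"
    by (intro continuous_at_imp_continuous_on ballI has_vector_derivative_continuous[OF \<gamma>_deriv])
  then have "bounded ((\<lambda>t. \<gamma> \<xi>0 t x) ` {0..T})"
    by (intro compact_imp_bounded compact_continuous_image) auto
  then obtain R where R: "0 < R" "\<And>t. t \<in> {0..T} \<Longrightarrow> norm (\<gamma> \<xi>0 t x) \<le> R"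
    by (auto simp: bounded_pos)
  \<comment> \<open>Bounds the factor of \<open>\<epsilon>\<^sup>2\<close> in the growth estimate on
    the whole time interval; \<open>\<epsilon> = e / (C + 1)\<close> then gives
    \<open>\<epsilon>\<^sup>2 * C < e\<^sup>2\<close>.\<close>
  define C where "C = 2 * \<bar>T\<bar> * exp ((2 * K\<^sup>2 + 1) * \<bar>T\<bar>)"
  have C0: "0 \<le> C"
    by (simp add: C_def)
  define \<epsilon> where "\<epsilon> = e / (C + 1)"
  have \<epsilon>: "0 < \<epsilon>"
    using assms C0 by (simp add: \<epsilon>_def)
  have "e\<^sup>2 * C < e\<^sup>2 * (C + 1)\<^sup>2"
  proof -
    have "C < (C + 1)\<^sup>2"
      using C0 by (simp add: power2_eq_square algebra_simps) (smt (verit) mult_nonneg_nonneg)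
    then show ?thesis
      using assms by simp
  qed
  then have \<epsilon>C: "\<epsilon>\<^sup>2 * C < e\<^sup>2"
    using C0 by (simp add: \<epsilon>_def power_divide field_simps)
  \<comment> \<open>Chosen so that the forcing term stays below \<open>\<epsilon>\<close>; the added
    1 keeps the denominator positive.\<close>
  define \<delta> where "\<delta> = \<epsilon> / (KJ * R + 1)"
  have \<delta>: "0 < \<delta>" "KJ * (\<delta> * R) \<le> \<epsilon>"
  proof -
    have "0 \<le> KJ * R"
      using KJ(1) R(1) by simp
    then show "0 < \<delta>" "KJ * (\<delta> * R) \<le> \<epsilon>"
      using \<epsilon> by (simp_all add: \<delta>_def field_simps)
  qed
  have "continuous_on (UNIV \<times> {0..T}) (\<lambda>p::'m \<times> real. B (\<phi> (snd p) (fst p)))"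
  proof (rule continuous_on_compose2[OF B(1)])
    have "continuous_on (UNIV \<times> {0..T}) (\<lambda>p::'m \<times> real. \<phi> (fst (snd p, fst p)) (snd (snd p, fst p)))"
      by (rule continuous_on_compose2[OF flow_continuous]) (auto intro!: continuous_intros)
    then show "continuous_on (UNIV \<times> {0..T}) (\<lambda>p::'m \<times> real. \<phi> (snd p) (fst p))"
      by simp
  qed auto
  then have "eventually (\<lambda>\<xi>. \<forall>t\<in>{0..T}. dist (B (\<phi> t \<xi>)) (B (\<phi> t \<xi>0)) < \<delta>) (nhds \<xi>0)"
    using \<delta>(1) by (intro eventually_uniform_on_compact[where f = "\<lambda>\<xi> t. B (\<phi> t \<xi>)"]) auto
  then show ?thesis
  proof eventually_elim
    case (elim \<xi>)
    show ?case
    proof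
      fix t assume t: "t \<in> {0..T}"
      define z where "z t = \<gamma> \<xi> t x - \<gamma> \<xi>0 t x" for t
      define z' where "z' t = - inv J (B (\<phi> t \<xi>) (\<gamma> \<xi> t x)) - - inv J (B (\<phi> t \<xi>0) (\<gamma> \<xi>0 t x))" for t
      have z: "(z has_vector_derivative z' t) (at t)" for t
        unfolding z_def[abs_def] z'_def by (rule has_vector_derivative_diff[OF \<gamma>_deriv \<gamma>_deriv])
      have "norm (z' s) \<le> K * norm (z s) + \<epsilon>" if s: "s \<in> {0..T}" for s
      proof -
        let ?w = "(B (\<phi> s \<xi>) - B (\<phi> s \<xi>0)) (\<gamma> \<xi>0 s x)"
        have add: "inv J (u + v) = inv J u + inv J v" for u v
          using inv_J_clinear unfolding clinear_iff by blast
        have "B (\<phi> s \<xi>) (\<gamma> \<xi> s x) = B (\<phi> s \<xi>) (z s) + ?w + B (\<phi> s \<xi>0) (\<gamma> \<xi>0 s x)"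
          by (simp add: z_def blinfun.diff_right blinfun.diff_left)
        then have "z' s = - inv J (B (\<phi> s \<xi>) (z s)) + - inv J ?w"
          by (simp add: z'_def add)
        moreover have "norm (- inv J ?w) \<le> \<epsilon>"
        proof -
          have "norm (- inv J ?w) \<le> KJ * norm ?w"
            by (rule KJ(2))
          also have "norm ?w \<le> norm (B (\<phi> s \<xi>) - B (\<phi> s \<xi>0)) * norm (\<gamma> \<xi>0 s x)"
            by (rule norm_blinfun)
          also have "\<dots> \<le> \<delta> * R"
            using elim s R by (intro mult_mono) (auto simp: dist_norm less_imp_le \<delta>(1))
          finally show ?thesis
            using \<delta>(2) KJ(1) by (meson mult_left_mono order_trans)
        qed
        ultimately show ?thesis
          using K[of "\<phi> s \<xi>" "z s"] norm_triangle_ineq[of "- inv J (B (\<phi> s \<xi>) (z s))" "- inv J ?w"] by simp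
      qed
      then have "(norm (z t))\<^sup>2 \<le> 2 * \<epsilon>\<^sup>2 * t * exp ((2 * K\<^sup>2 + 1) * t)"
        using t by (intro linear_growth_bound[OF S z]) (auto simp: z_def \<gamma>_zero)
      also have "\<dots> = \<epsilon>\<^sup>2 * (2 * t * exp ((2 * K\<^sup>2 + 1) * t))"
        by simp
      also have "\<dots> \<le> \<epsilon>\<^sup>2 * C"
        unfolding C_def using t by (intro mult_left_mono mult_mono) (auto intro!: mult_left_mono)
      also note \<epsilon>C
      finally have "norm (z t) < e"
        using assms by (simp add: power2_less_imp_less)
      then show "dist (\<gamma> \<xi> t x) (\<gamma> \<xi>0 t x) < e"
        by (simp add: dist_norm z_def)
    qed
  qed
qed

lemma \<gamma>_continuous: "continuous_on (UNIV \<times> {0..}) (\<lambda>p. \<gamma> (fst p) (snd p) x)"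
proof (rule joint_continuity[where f = "\<lambda>\<xi> t. \<gamma> \<xi> t x"])
  show "continuous_on {0..} (\<lambda>t. \<gamma> \<xi> t x)" for \<xi>
    by (intro continuous_at_imp_continuous_on ballI has_vector_derivative_continuous[OF \<gamma>_deriv])
qed (rule \<gamma>_uniform)

end

section \<open>The total angle of a Hamiltonian flow\<close>

context split_form
begin

lemma Y_component:
  assumes b: "onb Y N b" and "y \<in> Y" "z \<in> Z"
  shows "(\<Sum>i<N. h (z + y) (b i) *\<^sub>C b i) = y"
proof -
  have "(\<Sum>i<N. h (z + y) (b i) *\<^sub>C b i) = (\<Sum>i<N. h y (b i) *\<^sub>C b i)"
    using b assms(3) by (intro sum.cong) (auto simp: onb_def add_left cross')
  also have "\<dots> = y"
    using b assms(2) by (simp add: onb_def)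
  finally show ?thesis .
qed

end

lemma cdim_image_inj:
  fixes f :: "'v::complex_vector \<Rightarrow> 'x::complex_vector"
  assumes "finite S" "cspan S = (UNIV :: 'v set)" "clinear f" "inj f"
  shows "cdim (f ` U) = cdim U"
proof -
  obtain B where "finite_dimensional_vector_space (scaleC :: complex \<Rightarrow> 'v \<Rightarrow> 'v) B"
    using finite_dimensional_basis[OF assms(1,2)] .
  then interpret finite_dimensional_vector_space_pair_1 "scaleC :: complex \<Rightarrow> 'v \<Rightarrow> 'v" B "scaleC :: complex \<Rightarrow> 'x \<Rightarrow> 'x"
    by (simp add: finite_dimensional_vector_space_pair_1_def complex_vector.vector_space_axioms)
  show ?thesis
    using assms(3,4) by (intro dim_image_eq) (auto intro: inj_on_subset)
qed

text \<open>Both sides are the dimension of \<open>Gr (\<alpha> \<circ> A) \<inter> Gr \<alpha>\<close>.\<close>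

lemma cdim_fixed_pair_op_Gr:
  fixes \<omega> :: "'v::complex_vector \<Rightarrow> 'v \<Rightarrow> complex"
  assumes sf: "split_form (\<lambda>x y. - \<i> * direct_sum_form \<omega> x y) Y Z T"
    and b: "hermitian_form.onb (\<lambda>x y. - \<i> * direct_sum_form \<omega> x y) Y N b"
    and S: "finite S" "cspan S = (UNIV :: 'v set)" and \<alpha>: "clinear \<alpha>" "inj \<alpha>"
    and lag: "split_form.lagrangian (\<lambda>x y. - \<i> * direct_sum_form \<omega> x y) (Gr (\<lambda>u. \<alpha> (A u)))"
      "split_form.lagrangian (\<lambda>x y. - \<i> * direct_sum_form \<omega> x y) (Gr \<alpha>)"
  shows "cdim {y\<in>Y. split_form.pair_op Y Z (Gr (\<lambda>u. \<alpha> (A u))) (Gr \<alpha>) y = y} = cdim {u. A u = u}"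
proof -
  define h where "h x y = - \<i> * direct_sum_form \<omega> x y" for x y
  interpret split_form h Y Z T
    using sf by (simp add: h_def[abs_def])
  have b: "onb Y N b" and lag: "lagrangian (Gr (\<lambda>u. \<alpha> (A u)))" "lagrangian (Gr \<alpha>)"
    using b lag by (simp_all add: h_def[abs_def])
  have bY: "b i \<in> Y" if "i < N" for i
    using b that by (simp add: onb_def)
  have \<alpha>': "\<alpha> (x + y) = \<alpha> x + \<alpha> y" "\<alpha> (c *\<^sub>C x) = c *\<^sub>C \<alpha> x" for x y c
    using \<alpha>(1) unfolding clinear_iff by blast+
  \<comment> \<open>\<open>P u\<close> is the \<open>Y\<close>-component of the point of
    \<open>Gr \<alpha>\<close> above \<open>u\<close>. It is injective because
    \<open>Gr \<alpha>\<close> meets \<open>Z\<close> only in 0, so it carries the fixed space of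
    \<open>A\<close> isomorphically onto that of the pair operator.\<close>
  define P where "P u = (\<Sum>i<N. h (u, \<alpha> u) (b i) *\<^sub>C b i)" for u
  have P_eq: "P u = y" if "y \<in> Y" "z \<in> Z" "(u, \<alpha> u) = z + y" for u y z
    unfolding P_def that(3) by (rule Y_component[OF b that(1,2)])
  have P_split: "\<exists>z\<in>Z. (u, \<alpha> u) = z + P u \<and> P u \<in> Y" for u
  proof -
    obtain y z where "y \<in> Y" "z \<in> Z" "(u, \<alpha> u) = z + y"
      using decompose[of "(u, \<alpha> u)"] by blast
    then show ?thesis
      using P_eq by blast
  qed
  have "clinear P"
  proof -
    have "(u + v, \<alpha> (u + v)) = (u, \<alpha> u) + (v, \<alpha> v)" "(c *\<^sub>C u, \<alpha> (c *\<^sub>C u)) = c *\<^sub>C (u, \<alpha> u)" for u v c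
      by (simp_all add: \<alpha>' scaleC_prod_def)
    note eqs = this
    show ?thesis
      unfolding clinear_iff P_def eqs add_left scale_left
      by (simp add: scaleC_add_left sum.distrib complex_vector.scale_sum_right scaleC_scaleC)
  qed
  moreover have "inj P"
  proof (rule injI)
    fix u v assume uv: "P u = P v"
    obtain z w where "z \<in> Z" "w \<in> Z" "(u, \<alpha> u) = z + P u" "(v, \<alpha> v) = w + P v"
      using P_split by meson
    moreover from this have "(u, \<alpha> u) - (v, \<alpha> v) = z - w"
      by (simp add: uv)
    moreover have "(u, \<alpha> u) - (v, \<alpha> v) \<in> Gr \<alpha>"
      by (rule lagrangian_closed(2)[OF lag(2)]) (auto simp: Gr_def)
    ultimately have "(u, \<alpha> u) - (v, \<alpha> v) = 0"
      using lagrangian_Z[OF lag(2)] lin_closed(4) by metis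
    then show "u = v"
      by (simp add: zero_prod_def)
  qed
  ultimately have "cdim (P ` {u. A u = u}) = cdim {u. A u = u}"
    by (rule cdim_image_inj[OF S])
  moreover have "{y\<in>Y. pair_op (Gr (\<lambda>u. \<alpha> (A u))) (Gr \<alpha>) y = y} = P ` {u. A u = u}"
  proof (intro equalityI subsetI)
    fix y assume "y \<in> {y\<in>Y. pair_op (Gr (\<lambda>u. \<alpha> (A u))) (Gr \<alpha>) y = y}"
    then have y: "y \<in> Y" "pair_op (Gr (\<lambda>u. \<alpha> (A u))) (Gr \<alpha>) y = y"
      by auto
    then obtain z where z: "z \<in> Z" "z + y \<in> Gr (\<lambda>u. \<alpha> (A u))" "z + y \<in> Gr \<alpha>"
      using pair_op_fixed_iff[OF lag y(1)] by blast
    then obtain u where u: "z + y = (u, \<alpha> u)" "\<alpha> u = \<alpha> (A u)"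
      by (auto simp: Gr_def)
    then have "A u = u"
      using \<alpha>(2) by (metis injD)
    moreover have "P u = y"
      by (rule P_eq[OF y(1) z(1) u(1)[symmetric]])
    ultimately show "y \<in> P ` {u. A u = u}"
      by blast
  next
    fix y assume "y \<in> P ` {u. A u = u}"
    then obtain u where u: "y = P u" "A u = u"
      by blast
    obtain z where z: "z \<in> Z" "(u, \<alpha> u) = z + y" "y \<in> Y"
      using P_split[of u] u(1) by blast
    have "(u, \<alpha> u) \<in> Gr \<alpha>" "(u, \<alpha> u) \<in> Gr (\<lambda>u. \<alpha> (A u))"
      using u(2) by (auto simp: Gr_def intro!: exI[of _ u])
    then have "pair_op (Gr (\<lambda>u. \<alpha> (A u))) (Gr \<alpha>) y = y"
      using pair_op_fixed_iff[OF lag z(3)] z(1,2) by auto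
    with z(3) show "y \<in> {y\<in>Y. pair_op (Gr (\<lambda>u. \<alpha> (A u))) (Gr \<alpha>) y = y}"
      by blast
  qed
  ultimately show ?thesis
    by (simp add: h_def[abs_def])
qed

locale hamiltonian_maslov =
  hamiltonian_flow S \<omega> J \<phi> B \<gamma> +
  form: split_form "\<lambda>x y. - \<i> * direct_sum_form \<omega> x y" "Xplus G (direct_sum_form \<omega>)"
    "Xminus G (direct_sum_form \<omega>)" T
  for S :: "'v::complex_inner set" and \<omega> J and \<phi> :: "real \<Rightarrow> 'm::t2_space \<Rightarrow> 'm" and B \<gamma> G T +
  fixes N :: nat and b
  assumes b: "form.onb (Xplus G (direct_sum_form \<omega>)) N b"
begin

definition M :: "'m \<Rightarrow> real \<Rightarrow> nat \<Rightarrow> nat \<Rightarrow> complex"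
  where "M \<xi> t = form.opmat b (form.pair_op (Gr (\<gamma> \<xi> t)) (Gr id))"

lemma lagrangian_\<gamma>: "form.lagrangian (Gr (\<gamma> \<xi> t))"
  using lagrangian_Gr[where \<omega> = \<omega> and A = "\<gamma> \<xi> t", OF form.split_form_axioms \<omega> S \<gamma>_clinear]
    \<gamma>_symplectic by blast

lemma lagrangian_id: "form.lagrangian (Gr id)"
  using lagrangian_\<gamma>[of undefined 0] by (simp add: \<gamma>_zero)

lemma M_continuous:
  assumes "i < N" "j < N"
  shows "continuous_on (UNIV \<times> {0..}) (\<lambda>p. M (fst p) (snd p) i j)"
  unfolding continuous_on_def
proof
  fix p :: "'m \<times> real" assume p: "p \<in> UNIV \<times> {0..}"
  let ?F = "at p within UNIV \<times> {0..}"
  have lin: "bounded_linear (\<lambda>v. \<omega> v w)" for w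
    by (rule clinear_bounded_linear[OF S])
      (simp add: clinear_iff sesquilinearD[OF symplectic_formD(1)[OF \<omega>]] scaleC_complex_def)
  show "((\<lambda>p. M (fst p) (snd p) i j) \<longlongrightarrow> M (fst p) (snd p) i j) ?F"
    unfolding M_def
  proof (rule form.opmat_pair_op_tendsto[OF _ lagrangian_\<gamma> lagrangian_id b assms])
    fix l assume "l \<in> Gr (\<gamma> (fst p) (snd p))"
    then obtain u where l: "l = (u, \<gamma> (fst p) (snd p) u)"
      by (auto simp: Gr_def)
    \<comment> \<open>A fixed \<open>u\<close> gives a point in every nearby graph, varying
      continuously with the graph.\<close>
    let ?f = "\<lambda>p. (u, \<gamma> (fst p) (snd p) u)"
    have "((\<lambda>q. \<omega> (\<gamma> (fst q) (snd q) u) w) \<longlongrightarrow> \<omega> (\<gamma> (fst p) (snd p) u) w) ?F" for w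
      using \<gamma>_continuous[of u] p
      by (intro bounded_linear.tendsto[OF lin]) (auto simp: continuous_on_def)
    then have "((\<lambda>q. - \<i> * direct_sum_form \<omega> (?f q) x) \<longlongrightarrow> - \<i> * direct_sum_form \<omega> l x) ?F" for x
      unfolding direct_sum_form_def l by (auto intro!: tendsto_intros)
    then show "\<exists>f. (\<forall>p. f p \<in> Gr (\<gamma> (fst p) (snd p))) \<and>
        (\<forall>x. ((\<lambda>p. - \<i> * direct_sum_form \<omega> (f p) x) \<longlongrightarrow> - \<i> * direct_sum_form \<omega> l x) ?F)"
      by (intro exI[of _ ?f]) (auto simp: Gr_def)
  qed (intro always_eventually allI lagrangian_\<gamma>)
qed

lemma M_continuous_time:
  assumes "i < N" "j < N" "0 \<le> s"
  shows "continuous_on {0..t} (\<lambda>r. M \<xi> (s + r) i j)"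
proof -
  have "continuous_on {0..t} (\<lambda>r. M (fst (\<xi>, s + r)) (snd (\<xi>, s + r)) i j)"
    using assms(3) by (intro continuous_on_compose2[OF M_continuous[OF assms(1,2)]])
      (auto intro!: continuous_intros)
  then show ?thesis
    by simp
qed

definition D :: "'m \<Rightarrow> real \<Rightarrow> complex"
  where "D \<xi> t = cdet N (M \<xi> t)"

lemma D_continuous: "continuous_on (UNIV \<times> {0..}) (\<lambda>p. D (fst p) (snd p))"
  unfolding continuous_on_def D_def
proof (intro ballI tendsto_cdet)
  fix p :: "'m \<times> real" and i j assume "p \<in> UNIV \<times> {0..}" "i < N" "j < N"
  then show "((\<lambda>p. M (fst p) (snd p) i j) \<longlongrightarrow> M (fst p) (snd p) i j) (at p within UNIV \<times> {0..})"
    using M_continuous[of i j] by (simp only: continuous_on_def)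
qed

lemma norm_D: "cmod (D \<xi> t) = 1"
proof -
  obtain E \<theta> where "eigframe N (M \<xi> t) E \<theta>"
    using form.pair_op_eigframe_exists[OF lagrangian_\<gamma> lagrangian_id b] unfolding M_def by blast
  from cdet_eigframe[OF this] show ?thesis
    by (simp add: D_def)
qed

lemma D_zero: "D \<xi> 0 = 1"
proof -
  have "M \<xi> 0 i j = (if i = j then 1 else 0)" if "i < N" "j < N" for i j
  proof -
    have "b j \<in> Xplus G (direct_sum_form \<omega>)" and
      "- \<i> * direct_sum_form \<omega> (b j) (b i) = (if j = i then 1 else 0)"
      using b that unfolding form.onb_def form.orthonormal_def by blast+
    then show ?thesis
      unfolding M_def form.opmat_def \<gamma>_zero by (simp only: form.pair_op_self[OF lagrangian_id]) auto
  qed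
  then have "cdet N (M \<xi> 0) = (\<Prod>i<N. 1)"
    by (rule cdet_diagonal)
  then show ?thesis
    by (simp add: D_def)
qed

text \<open>The half-line is contractible, so \<open>D \<xi>\<close> has a continuous logarithm; it
  is purely imaginary because \<open>D\<close> is unimodular.\<close>

lemma angle_lift:
  "\<exists>\<theta>. continuous_on {0..} \<theta> \<and> \<theta> 0 = 0 \<and> (\<forall>t\<ge>0. D \<xi> t = exp (\<i> * complex_of_real (\<theta> t)))"
proof -
  have "continuous_on {0..} (\<lambda>t. D (fst (\<xi>, t)) (snd (\<xi>, t)))"
    by (rule continuous_on_compose2[OF D_continuous]) (auto intro!: continuous_intros)
  moreover have "contractible ({0..} :: real set)"
    by (intro convex_imp_contractible) simp
  moreover have "D \<xi> t \<noteq> 0" for t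
    using norm_D[of \<xi> t] by auto
  ultimately obtain g where g: "continuous_on {0..} g" "\<And>t. t \<in> {0..} \<Longrightarrow> D \<xi> t = exp (g t)"
    using continuous_logarithm_on_contractible[of "{0..}" "\<lambda>t. D \<xi> t"] by auto
  have "g t = \<i> * complex_of_real (Im (g t))" if "0 \<le> t" for t
  proof -
    have "exp (Re (g t)) = 1"
      using norm_D[of \<xi> t] g(2)[of t] that by simp
    then show ?thesis
      by (simp add: complex_eq_iff)
  qed
  then have "D \<xi> t = exp (\<i> * complex_of_real (Im (g t) - Im (g 0)))" if "0 \<le> t" for t
    using g(2)[of t] g(2)[of 0] D_zero[of \<xi>] that
    by (simp add: right_diff_distrib exp_diff)
  moreover have "continuous_on {0..} (\<lambda>t. Im (g t) - Im (g 0))"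
    by (intro continuous_intros g(1))
  ultimately show ?thesis
    by (intro exI[of _ "\<lambda>t. Im (g t) - Im (g 0)"]) simp
qed

text \<open>The lift is chosen separately for each \<open>\<xi>\<close>, so continuity in
  \<open>\<xi>\<close> has to be proved; it is available because all lifts are anchored at time
  0.\<close>

definition angle :: "'m \<Rightarrow> real \<Rightarrow> real"
  where "angle \<xi> = (SOME \<theta>. continuous_on {0..} \<theta> \<and> \<theta> 0 = 0 \<and>
    (\<forall>t\<ge>0. D \<xi> t = exp (\<i> * complex_of_real (\<theta> t))))"

lemma angle_continuous_time: "continuous_on {0..} (angle \<xi>)"
  and angle_zero: "angle \<xi> 0 = 0"
  and D_angle: "0 \<le> t \<Longrightarrow> D \<xi> t = exp (\<i> * complex_of_real (angle \<xi> t))"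
  using someI_ex[OF angle_lift[of \<xi>]] unfolding angle_def[symmetric] by blast+

text \<open>The difference of the two angles starts at 0. To become large it would have to pass
  through absolute value \<open>e'\<close>, where the quotient of the determinants is at distance
  exactly \<open>\<epsilon>\<close> from 1, and this is excluded by closeness of the
  determinants.\<close>

lemma angle_uniform:
  assumes "0 < e"
  shows "eventually (\<lambda>\<xi>. \<forall>t\<in>{0..\<tau>}. dist (angle \<xi> t) (angle \<xi>0 t) < e) (nhds \<xi>0)"
proof -
  \<comment> \<open>The cap at 1, below 2 \<pi>, ensures that \<open>exp (\<i> * e')\<close> is not
    1.\<close>
  define e' where "e' = min e 1"
  have e': "0 < e'" "e' \<le> e" "e' \<le> 1"
    using assms by (auto simp: e'_def)
  define \<epsilon> where "\<epsilon> = cmod (exp (\<i> * complex_of_real e') - 1)"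
  have \<epsilon>: "0 < \<epsilon>"
  proof -
    have "exp (\<i> * complex_of_real e') \<noteq> exp (\<i> * complex_of_real 0)"
    proof
      assume "exp (\<i> * complex_of_real e') = exp (\<i> * complex_of_real 0)"
      then obtain k :: int where k: "e' = 2 * pi * of_int k"
        unfolding exp_ii_eq_iff by auto
      then have "0 < k"
        using e'(1) by (simp add: zero_less_mult_iff)
      then have "2 * pi * 1 \<le> 2 * pi * real_of_int k"
        by (intro mult_left_mono) auto
      with k e'(3) pi_gt3 show False
        by linarith
    qed
    then show ?thesis
      by (simp add: \<epsilon>_def)
  qed
  have "continuous_on (UNIV \<times> {0..\<tau>}) (\<lambda>p. D (fst p) (snd p))"
    by (rule continuous_on_subset[OF D_continuous]) auto
  then have "eventually (\<lambda>\<xi>. \<forall>t\<in>{0..\<tau>}. dist (D \<xi> t) (D \<xi>0 t) < \<epsilon>) (nhds \<xi>0)"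
    using \<epsilon> by (intro eventually_uniform_on_compact) auto
  then show ?thesis
  proof eventually_elim
    case (elim \<xi>)
    define \<psi> where "\<psi> t = angle \<xi> t - angle \<xi>0 t" for t
    have \<psi>_cont: "continuous_on {0..} \<psi>"
      unfolding \<psi>_def by (intro continuous_intros angle_continuous_time)
    have \<psi>: "cmod (exp (\<i> * complex_of_real (\<psi> t)) - 1) < \<epsilon>" if t: "t \<in> {0..\<tau>}" for t
    proof -
      have "exp (\<i> * complex_of_real (\<psi> t)) - 1 = (D \<xi> t - D \<xi>0 t) / D \<xi>0 t"
        using t norm_D[of \<xi>0 t] by (simp add: \<psi>_def D_angle right_diff_distrib exp_diff diff_divide_distrib)
      then show ?thesis
        using elim t by (simp add: norm_divide norm_D dist_norm)
    qed
    show ?case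
    proof
      fix t assume t: "t \<in> {0..\<tau>}"
      show "dist (angle \<xi> t) (angle \<xi>0 t) < e"
      proof (rule ccontr)
        assume "\<not> ?thesis"
        then have "e' \<le> \<bar>\<psi> t\<bar>"
          using e' by (simp add: \<psi>_def dist_real_def)
        moreover have "continuous_on {0..t} (\<lambda>t. \<bar>\<psi> t\<bar>)"
          using t by (intro continuous_intros continuous_on_subset[OF \<psi>_cont]) auto
        ultimately obtain s where s: "0 \<le> s" "s \<le> t" "\<bar>\<psi> s\<bar> = e'"
          using IVT'[of "\<lambda>t. \<bar>\<psi> t\<bar>" 0 e' t] t e' by (auto simp: \<psi>_def angle_zero)
        have "cmod (exp (\<i> * complex_of_real (\<psi> s)) - 1) = \<epsilon>"
        proof (cases "0 \<le> \<psi> s")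
          case True
          then show ?thesis
            using s(3) by (simp add: \<epsilon>_def)
        next
          case False
          then have "\<psi> s = - e'"
            using s(3) by simp
          then have "exp (\<i> * complex_of_real (\<psi> s)) - 1 = cnj (exp (\<i> * complex_of_real e') - 1)"
            by (simp add: exp_cnj)
          then show ?thesis
            unfolding \<epsilon>_def by (simp only: complex_mod_cnj)
        qed
        then show False
          using \<psi>[of s] s t by simp
      qed
    qed
  qed
qed

lemma angle_continuous: "continuous_on (UNIV \<times> {0..}) (\<lambda>p. angle (fst p) (snd p))"
  by (rule joint_continuity[OF angle_uniform angle_continuous_time])

lemma angle_continuous_space:
  assumes "0 \<le> t"
  shows "continuous_on UNIV (\<lambda>\<xi>. angle \<xi> t)"
proof -
  have "continuous_on UNIV (\<lambda>\<xi>. angle (fst (\<xi>, t)) (snd (\<xi>, t)))"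
    using assms by (intro continuous_on_compose2[OF angle_continuous]) (auto intro!: continuous_intros)
  then show ?thesis
    by simp
qed

lemma angle_bounded:
  obtains K where "\<And>\<xi> t. 0 \<le> t \<Longrightarrow> t \<le> 1 \<Longrightarrow> \<bar>angle \<xi> t\<bar> \<le> K"
proof -
  have "compact ((UNIV :: 'm set) \<times> {0..1::real})"
    by (intro compact_Times compact) simp
  then have "compact ((\<lambda>p. angle (fst p) (snd p)) ` (UNIV \<times> {0..1}))"
    by (intro compact_continuous_image continuous_on_subset[OF angle_continuous]) auto
  then have "bounded ((\<lambda>p. angle (fst p) (snd p)) ` (UNIV \<times> {0..1}))"
    by (rule compact_imp_bounded)
  then obtain K where K: "\<forall>x\<in>(\<lambda>p. angle (fst p) (snd p)) ` (UNIV \<times> {0..1}). norm x \<le> K"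
    unfolding bounded_iff by (elim exE)
  have "\<bar>angle \<xi> t\<bar> \<le> K" if "0 \<le> t" "t \<le> 1" for \<xi> t
  proof -
    have "angle \<xi> t \<in> (\<lambda>p. angle (fst p) (snd p)) ` (UNIV \<times> {0..1})"
      using that by (intro image_eqI[of _ _ "(\<xi>, t)"]) auto
    with K have "norm (angle \<xi> t) \<le> K"
      by (rule bspec)
    then show ?thesis
      by simp
  qed
  then show thesis
    by (rule that)
qed

lemma \<gamma>_inj: "inj (\<gamma> \<xi> t)"
proof (rule injI)
  fix x y assume xy: "\<gamma> \<xi> t x = \<gamma> \<xi> t y"
  have "\<omega> (x - y) v = 0" for v
  proof -
    have "\<omega> x v = \<omega> y v"
      using \<gamma>_symplectic[of \<xi> t x v] \<gamma>_symplectic[of \<xi> t y v] xy by simp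
    then show ?thesis
      using sesquilinearD(1)[OF symplectic_formD(1)[OF \<omega>], of "x - y" y v] by simp
  qed
  then have "x - y = 0"
    by (rule symplectic_formD(3)[OF \<omega>])
  then show "x = y"
    by simp
qed

theorem angle_quasi_additive:
  assumes "0 \<le> s" "0 \<le> t"
  shows "\<bar>angle \<xi> (s + t) - angle \<xi> s - angle (\<phi> s \<xi>) t\<bar> \<le> 2 * pi * real N"
proof -
  \<comment> \<open>At time 0 the path over \<open>\<phi> s \<xi>\<close> is at the identity, so the
    initial difference is just \<open>angle \<xi> s\<close>.\<close>
  have "\<bar>(angle \<xi> (s + t) - angle (\<phi> s \<xi>) t) - (angle \<xi> (s + 0) - angle (\<phi> s \<xi>) 0)\<bar> \<le> 2 * pi * real N"
  proof (rule form.total_angle_difference[OF assms(2) _ lagrangian_id b])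
    show "form.lagrangian (Gr (\<gamma> \<xi> (s + r))) \<and> form.lagrangian (Gr (\<gamma> (\<phi> s \<xi>) r))" for r
      by (intro conjI lagrangian_\<gamma>)
    show "continuous_on {0..t} (\<lambda>r. form.opmat b (form.pair_op (Gr (\<gamma> \<xi> (s + r))) (Gr id)) i j)"
      "continuous_on {0..t} (\<lambda>r. form.opmat b (form.pair_op (Gr (\<gamma> (\<phi> s \<xi>) r)) (Gr id)) i j)"
      if "i < N" "j < N" for i j
      using M_continuous_time[OF that assms(1), of t \<xi>] M_continuous_time[OF that order_refl, of t "\<phi> s \<xi>"]
      by (simp_all add: M_def)
    show "continuous_on {0..t} (\<lambda>r. angle \<xi> (s + r))"
      using assms by (intro continuous_on_compose2[OF angle_continuous_time]) (auto intro!: continuous_intros)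
    show "continuous_on {0..t} (angle (\<phi> s \<xi>))"
      by (rule continuous_on_subset[OF angle_continuous_time]) auto
    show "cdet N (form.opmat b (form.pair_op (Gr (\<gamma> \<xi> (s + r))) (Gr id)))
        = exp (\<i> * complex_of_real (angle \<xi> (s + r)))"
      "cdet N (form.opmat b (form.pair_op (Gr (\<gamma> (\<phi> s \<xi>) r)) (Gr id)))
        = exp (\<i> * complex_of_real (angle (\<phi> s \<xi>) r))" if "r \<in> {0..t}" for r
      using D_angle[of "s + r" \<xi>] D_angle[of r "\<phi> s \<xi>"] that assms(1) by (simp_all add: D_def M_def)
    show "cdim {y \<in> Xplus G (direct_sum_form \<omega>).
        form.pair_op (Gr (\<gamma> \<xi> (s + r))) (Gr (\<gamma> (\<phi> s \<xi>) r)) y = y} = cdim {u. \<gamma> \<xi> s u = u}"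
      if "r \<in> {0..t}" for r
    proof -
      have eq: "\<gamma> \<xi> (s + r) = (\<lambda>u. \<gamma> (\<phi> s \<xi>) r (\<gamma> \<xi> s u))"
        using that by (intro ext \<gamma>_cocycle) simp
      have "form.lagrangian (Gr (\<lambda>u. \<gamma> (\<phi> s \<xi>) r (\<gamma> \<xi> s u)))"
        using lagrangian_\<gamma>[of \<xi> "s + r"] by (simp add: eq)
      from cdim_fixed_pair_op_Gr[OF form.split_form_axioms b S \<gamma>_clinear \<gamma>_inj this lagrangian_\<gamma>]
      show ?thesis
        by (simp add: eq)
    qed
  qed
  then show ?thesis
    by (simp add: angle_zero algebra_simps)
qed

lemma sorted_frame_M:
  assumes "0 \<le> t"
  shows "\<exists>E \<theta>. sorted_frame N (M \<xi> t) (angle \<xi> t) E \<theta>"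
proof (cases "N = 0")
  case True
  have "exp (\<i> * complex_of_real (angle \<xi> s)) = exp (\<i> * complex_of_real 0)" if "s \<in> {0..t}" for s
  proof -
    have "cdet N (M \<xi> s) = (\<Prod>i<N. 1)"
      by (rule cdet_diagonal) (use True in simp)
    then show ?thesis
      using D_angle[of s \<xi>] that by (simp add: D_def)
  qed
  then have "angle \<xi> t - 0 = angle \<xi> 0 - 0"
    using assms
    by (intro continuous_exp_ii_eq[where f = "angle \<xi>" and g = "\<lambda>_. 0"]
        continuous_on_subset[OF angle_continuous_time]) auto
  then have "angle \<xi> t = 0"
    by (simp add: angle_zero)
  then show ?thesis
    by (simp add: True sorted_frame_def eigframe_def sorted_angles_def)
next
  case False
  then show ?thesis
    using form.pair_op_sorted_frame_exists[OF lagrangian_\<gamma> lagrangian_id b, of \<xi> t "angle \<xi> t"]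
      D_angle[OF assms, of \<xi>] by (simp add: D_def M_def)
qed

lemma index_eq:
  assumes "0 \<le> t" and frame: "sorted_frame N (M \<xi> t) (angle \<xi> t) E \<theta>"
  shows "maslov_i1 G \<omega> 0 t (\<gamma> \<xi>) = - floor_sum N \<theta> 0"
  unfolding maslov_i1_def
proof (rule maslov_index_eq[where M = "M \<xi>" and \<Theta> = "angle \<xi>", OF form.split_form_axioms b lagrangian_\<gamma> \<open>0 \<le> t\<close>])
  show "Gr (\<gamma> \<xi> 0) = Gr id"
    by (simp add: \<gamma>_zero)
  show "M \<xi> s i j = form.opmat b (form.pair_op (Gr (\<gamma> \<xi> s)) (Gr id)) i j" for s i j
    by (simp add: M_def)
  show "continuous_on {0..t} (\<lambda>s. M \<xi> s i j)" if "i < N" "j < N" for i j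
    using M_continuous_time[OF that order_refl, of t \<xi>] by simp
  show "continuous_on {0..t} (angle \<xi>)"
    by (rule continuous_on_subset[OF angle_continuous_time]) auto
  show "cdet N (M \<xi> s) = exp (\<i> * complex_of_real (angle \<xi> s))" if "s \<in> {0..t}" for s
    using D_angle[of s \<xi>] that by (simp add: D_def)
qed (fact angle_zero frame)+

text \<open>Each of the \<open>N\<close> roundings changes the sum of the angles over 2 \<pi> by at
  most 1.\<close>

lemma index_near_angle:
  assumes "0 \<le> t"
  shows "\<bar>real_of_int (maslov_i1 G \<omega> 0 t (\<gamma> \<xi>)) - angle \<xi> t / (2 * pi)\<bar> \<le> real N"
proof -
  obtain E \<theta> where fr: "sorted_frame N (M \<xi> t) (angle \<xi> t) E \<theta>"
    using sorted_frame_M[OF assms] by blast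
  let ?x = "\<lambda>j. (0 - \<theta> j) / (2 * pi)"
  have "(\<Sum>j<N. ?x j) = - angle \<xi> t / (2 * pi)"
    using fr by (simp add: sorted_frame_def sum_divide_distrib[symmetric] sum_negf)
  moreover have "real_of_int (floor_sum N \<theta> 0) \<le> (\<Sum>j<N. ?x j)"
    unfolding floor_sum_def of_int_sum by (intro sum_mono) (rule of_int_floor_le)
  moreover have "(\<Sum>j<N. ?x j - 1) \<le> real_of_int (floor_sum N \<theta> 0)"
    unfolding floor_sum_def of_int_sum by (intro sum_mono) linarith
  ultimately show ?thesis
    by (simp add: index_eq[OF assms fr] sum_subtractf)
qed

text \<open>At a fixed time the sorted angles are continuous in \<open>\<xi>\<close>, and the index
  is a finite sum of floors of continuous functions.\<close>

lemma index_measurable: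
  assumes "0 \<le> t"
  shows "(\<lambda>\<xi>. real_of_int (maslov_i1 G \<omega> 0 t (\<gamma> \<xi>))) \<in> borel_measurable borel"
proof -
  obtain E \<theta> where fr: "\<And>\<xi>. sorted_frame N (M \<xi> t) (angle \<xi> t) (E \<xi>) (\<theta> \<xi>)"
    using sorted_frame_M[OF assms] by metis
  have "continuous_on UNIV (\<lambda>\<xi>. \<theta> \<xi> j)" if "j < N" for j
  proof (rule form.sorted_angles_continuous[where \<Lambda> = "\<lambda>\<xi>. Gr (\<gamma> \<xi> t)" and \<Lambda>' = "\<lambda>_. Gr id"
        and \<Theta> = "\<lambda>\<xi>. angle \<xi> t" and E = E, OF _ b _ angle_continuous_space[OF assms] _ that])
    show "continuous_on UNIV (\<lambda>\<xi>. form.opmat b (form.pair_op (Gr (\<gamma> \<xi> t)) (Gr id)) i k)"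
      if "i < N" "k < N" for i k
    proof -
      have "continuous_on UNIV (\<lambda>\<xi>. M (fst (\<xi>, t)) (snd (\<xi>, t)) i k)"
        using assms by (intro continuous_on_compose2[OF M_continuous[OF that]]) (auto intro!: continuous_intros)
      then show ?thesis
        by (simp add: M_def)
    qed
    show "sorted_frame N (form.opmat b (form.pair_op (Gr (\<gamma> \<xi> t)) (Gr id))) (angle \<xi> t) (E \<xi>) (\<theta> \<xi>)" for \<xi>
      using fr[of \<xi>] by (simp add: M_def)
  qed (intro conjI lagrangian_\<gamma> lagrangian_id)
  then have "(\<lambda>\<xi>. real_of_int \<lfloor>(0 - \<theta> \<xi> j) / (2 * pi)\<rfloor>) \<in> borel_measurable borel" if "j < N" for j
    using that by (intro measurable_compose[OF _ borel_measurable_real_floor]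
        borel_measurable_continuous_onI continuous_intros) auto
  then have "(\<lambda>\<xi>. - (\<Sum>j<N. real_of_int \<lfloor>(0 - \<theta> \<xi> j) / (2 * pi)\<rfloor>)) \<in> borel_measurable borel"
    by (intro borel_measurable_uminus borel_measurable_sum) auto
  then show ?thesis
    by (simp add: index_eq[OF assms fr] floor_sum_def)
qed

end

section \<open>An ergodic theorem for quasi-additive sequences\<close>

locale measure_preserving_map = finite_measure M for M :: "'a measure" +
  fixes T :: "'a \<Rightarrow> 'a"
  assumes T_measurable [measurable]: "T \<in> measurable M M" and distr_T: "distr M M T = M"
begin

primrec bsum :: "('a \<Rightarrow> real) \<Rightarrow> nat \<Rightarrow> 'a \<Rightarrow> real"
  where "bsum f 0 x = 0" | "bsum f (Suc n) x = f x + bsum f n (T x)"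

text \<open>The maximum of \<open>bsum f k x\<close> over \<open>k \<le> n\<close>; the recursion is
  the identity on which the maximal inequality rests.\<close>

primrec maxsum :: "('a \<Rightarrow> real) \<Rightarrow> nat \<Rightarrow> 'a \<Rightarrow> real"
  where "maxsum f 0 x = 0" | "maxsum f (Suc n) x = max 0 (f x + maxsum f n (T x))"

lemma bsum_eq: "bsum f n x = (\<Sum>j<n. f ((T ^^ j) x))"
  by (induction n arbitrary: x) (simp_all add: sum.lessThan_Suc_shift funpow_swap1 del: sum.lessThan_Suc)

lemma bsum_measurable [measurable]: "f \<in> borel_measurable M \<Longrightarrow> bsum f n \<in> borel_measurable M"
  by (induction n) (simp_all cong: measurable_cong)

lemma maxsum_measurable [measurable]: "f \<in> borel_measurable M \<Longrightarrow> maxsum f n \<in> borel_measurable M"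
  by (induction n) (simp_all cong: measurable_cong)

lemma bsum_bound: "(\<And>x. \<bar>f x\<bar> \<le> K) \<Longrightarrow> \<bar>bsum f n x\<bar> \<le> real n * K"
proof (induction n arbitrary: x)
  case (Suc n)
  have "\<bar>bsum f n (T x)\<bar> \<le> real n * K"
    by (rule Suc.IH[OF Suc.prems])
  moreover have "real (Suc n) * K = K + real n * K"
    by (simp add: algebra_simps)
  ultimately show ?case
    using Suc.prems[of x] by simp
qed simp

lemma bsum_diff_const: "bsum (\<lambda>x. f x - c) n x = bsum f n x - real n * c"
  by (induction n arbitrary: x) (simp_all add: algebra_simps)

lemma bsum_const_diff: "bsum (\<lambda>x. c - f x) n x = real n * c - bsum f n x"
  by (induction n arbitrary: x) (simp_all add: algebra_simps)

lemma maxsum_nonneg: "0 \<le> maxsum f n x"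
  by (cases n) simp_all

lemma maxsum_mono: "maxsum f n x \<le> maxsum f (Suc n) x"
proof (induction n arbitrary: x)
  case (Suc n)
  show ?case
    using Suc.IH[of "T x"] by (simp add: max_def)
qed simp

lemma maxsum_mono_le: "m \<le> n \<Longrightarrow> maxsum f m x \<le> maxsum f n x"
  using lift_Suc_mono_le[of "\<lambda>n. maxsum f n x" m n] maxsum_mono by blast

lemma maxsum_bound: "(\<And>x. \<bar>f x\<bar> \<le> K) \<Longrightarrow> \<bar>maxsum f n x\<bar> \<le> real n * K"
proof (induction n arbitrary: x)
  case (Suc n)
  have "\<bar>maxsum f n (T x)\<bar> \<le> real n * K"
    by (rule Suc.IH[OF Suc.prems])
  moreover have "real (Suc n) * K = K + real n * K"
    by (simp add: algebra_simps)
  ultimately show ?case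
    using Suc.prems[of x] by (auto simp: max_def)
qed simp

lemma bsum_le_maxsum: "bsum f n x \<le> maxsum f n x"
proof (induction n arbitrary: x)
  case (Suc n)
  then show ?case
    using Suc.IH[of "T x"] by (simp add: le_max_iff_disj)
qed simp

lemma maxsum_pos: "0 < maxsum f n x \<Longrightarrow> \<exists>k. 0 < bsum f k x"
proof -
  have "\<exists>k. maxsum f n x = bsum f k x" for x
  proof (induction n arbitrary: x)
    case 0
    show ?case
      by (rule exI[of _ 0]) simp
  next
    case (Suc n)
    obtain k where "maxsum f n (T x) = bsum f k (T x)"
      using Suc.IH by blast
    then have "maxsum f (Suc n) x = bsum f (Suc k) x \<or> maxsum f (Suc n) x = bsum f 0 x"
      by (simp add: max_def)
    then show ?case
      by blast
  qed
  then show "0 < maxsum f n x \<Longrightarrow> \<exists>k. 0 < bsum f k x"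
    by metis
qed

text \<open>Garsia's argument: on \<open>{maxsum f (Suc n) > 0}\<close> the function \<open>f\<close> is
  \<open>maxsum f (Suc n) - maxsum f n \<circ> T\<close>.\<close>

lemma maximal_inequality_finite:
  assumes f [measurable]: "f \<in> borel_measurable M" and K: "\<And>x. \<bar>f x\<bar> \<le> K"
  shows "0 \<le> (\<integral>x. f x * indicator {x\<in>space M. 0 < maxsum f n x} x \<partial>M)"
proof (cases n)
  case (Suc m)
  let ?g = "maxsum f n"
  have g [measurable]: "?g \<in> borel_measurable M"
    by (rule maxsum_measurable) (rule f)
  have int_g: "integrable M ?g"
    using maxsum_bound[of f K n] K by (intro integrable_const_bound[of _ "real n * K"]) auto
  have int_gT: "integrable M (\<lambda>x. ?g (T x))"
    using maxsum_bound[of f K n] K by (intro integrable_const_bound[of _ "real n * K"]) auto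
  have int_f: "integrable M (\<lambda>x. f x * indicator {x\<in>space M. 0 < ?g x} x)"
    using K by (intro integrable_const_bound[of _ K]) (auto simp: indicator_def intro: order_trans[OF abs_ge_zero K])
  have "(\<integral>x. ?g (T x) \<partial>M) = (\<integral>x. ?g x \<partial>distr M M T)"
    by (rule integral_distr[symmetric]) measurable
  then have "0 = (\<integral>x. ?g x - ?g (T x) \<partial>M)"
    using int_g int_gT by (simp add: distr_T)
  also have "\<dots> \<le> (\<integral>x. f x * indicator {x\<in>space M. 0 < ?g x} x \<partial>M)"
  proof (rule integral_mono)
    fix x assume x: "x \<in> space M"
    show "?g x - ?g (T x) \<le> f x * indicator {x\<in>space M. 0 < ?g x} x"
    proof (cases "0 < ?g x")
      case True
      then have "?g x = f x + maxsum f m (T x)"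
        by (simp add: Suc max_def split: if_splits)
      then show ?thesis
        using maxsum_mono[of f m "T x"] True x by (simp add: Suc)
    next
      case False
      then show ?thesis
        using maxsum_nonneg[of f n "T x"] by simp
    qed
  qed (use int_g int_gT int_f in auto)
  finally show ?thesis .
qed simp

text \<open>The sets where \<open>maxsum f n\<close> is positive increase to the set where some
  Birkhoff sum is positive, so dominated convergence passes to the limit.\<close>

lemma maximal_inequality:
  assumes f [measurable]: "f \<in> borel_measurable M" and K: "\<And>x. \<bar>f x\<bar> \<le> K"
  shows "0 \<le> (\<integral>x. f x * indicator {x\<in>space M. \<exists>k. 0 < bsum f k x} x \<partial>M)"
proof (rule LIMSEQ_le_const)
  have K0: "0 \<le> K"
    using K[of undefined] by linarith
  show "(\<lambda>n. \<integral>x. f x * indicator {x\<in>space M. 0 < maxsum f n x} x \<partial>M)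
      \<longlonglongrightarrow> (\<integral>x. f x * indicator {x\<in>space M. \<exists>k. 0 < bsum f k x} x \<partial>M)"
  proof (rule integral_dominated_convergence[where w = "\<lambda>_. K"])
    show "AE x in M. (\<lambda>n. f x * indicator {x\<in>space M. 0 < maxsum f n x} x)
        \<longlonglongrightarrow> f x * indicator {x\<in>space M. \<exists>k. 0 < bsum f k x} x"
    proof (rule AE_I2)
      fix x assume x: "x \<in> space M"
      have "eventually (\<lambda>n. f x * indicator {x\<in>space M. 0 < maxsum f n x} x
          = f x * indicator {x\<in>space M. \<exists>k. 0 < bsum f k x} x) sequentially"
      proof (cases "\<exists>k. 0 < bsum f k x")
        case True
        then obtain k where "0 < bsum f k x"
          by blast
        then have "0 < maxsum f k x"
          using bsum_le_maxsum[of f k x] by linarith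
        then have "0 < maxsum f n x" if "k \<le> n" for n
          using maxsum_mono_le[OF that, of f x] by linarith
        then show ?thesis
          using True x by (intro eventually_sequentiallyI[of k]) simp
      next
        case False
        then show ?thesis
          using maxsum_pos[of f _ x] by (intro always_eventually) (auto simp: indicator_def)
      qed
      then show "(\<lambda>n. f x * indicator {x\<in>space M. 0 < maxsum f n x} x)
          \<longlonglongrightarrow> f x * indicator {x\<in>space M. \<exists>k. 0 < bsum f k x} x"
        by (rule tendsto_eventually)
    qed
    show "AE x in M. norm (f x * indicator {x\<in>space M. 0 < maxsum f n x} x) \<le> K" for n
      using K K0 by (auto simp: indicator_def)
  qed auto
  show "\<exists>N. \<forall>n\<ge>N. 0 \<le> (\<integral>x. f x * indicator {x\<in>space M. 0 < maxsum f n x} x \<partial>M)"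
    using maximal_inequality_finite[OF assms] by blast
qed

text \<open>Apply the inequality to \<open>f\<close> cut off outside \<open>A\<close>. By invariance
  the Birkhoff sums are cut off in the same way, and the set of positivity becomes
  \<open>A\<close>.\<close>

lemma maximal_inequality_invariant:
  assumes f [measurable]: "f \<in> borel_measurable M" and K: "\<And>x. \<bar>f x\<bar> \<le> K"
    and A [measurable]: "A \<in> sets M" and inv: "\<And>x. x \<in> space M \<Longrightarrow> T x \<in> A \<longleftrightarrow> x \<in> A"
    and pos: "\<And>x. x \<in> A \<Longrightarrow> \<exists>k. 0 < bsum f k x"
  shows "0 \<le> (\<integral>x. f x * indicator A x \<partial>M)"
proof -
  define g where "g x = f x * indicator A x" for x
  have K0: "0 \<le> K"
    using K[of undefined] by linarith
  have bsum_g: "bsum g k x = bsum f k x * indicator A x" if "x \<in> space M" for k x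
    using that
  proof (induction k arbitrary: x)
    case (Suc k)
    have "T x \<in> space M"
      using Suc.prems measurable_space[OF T_measurable] by blast
    then show ?case
      using Suc.IH[of "T x"] inv[OF Suc.prems] by (simp add: g_def indicator_def)
  qed simp
  have "0 \<le> (\<integral>x. g x * indicator {x\<in>space M. \<exists>k. 0 < bsum g k x} x \<partial>M)"
  proof (rule maximal_inequality)
    show "g \<in> borel_measurable M"
      unfolding g_def by measurable
    show "\<bar>g x\<bar> \<le> K" for x
      using K[of x] K0 by (simp add: g_def indicator_def)
  qed
  also have "(\<integral>x. g x * indicator {x\<in>space M. \<exists>k. 0 < bsum g k x} x \<partial>M) = (\<integral>x. f x * indicator A x \<partial>M)"
  proof (rule Bochner_Integration.integral_cong[OF refl])
    fix x assume "x \<in> space M"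
    then show "g x * indicator {x\<in>space M. \<exists>k. 0 < bsum g k x} x = f x * indicator A x"
      using pos[of x] by (auto simp: g_def indicator_def bsum_g)
  qed
  finally show ?thesis .
qed

section \<open>Birkhoff's ergodic theorem for bounded functions\<close>

lemma limsup_liminf_eq:
  fixes u v :: "nat \<Rightarrow> real"
  assumes "(\<lambda>n. u n - v n) \<longlonglongrightarrow> 0"
  shows "limsup (\<lambda>n. ereal (u n)) = limsup (\<lambda>n. ereal (v n))"
    and "liminf (\<lambda>n. ereal (u n)) = liminf (\<lambda>n. ereal (v n))"
proof -
  have lim: "(\<lambda>n. ereal (u n - v n)) \<longlonglongrightarrow> ereal 0"
    using assms by simp
  have eq: "(\<lambda>n. ereal (u n)) = (\<lambda>n. ereal (u n - v n) + ereal (v n))"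
    by simp
  show "limsup (\<lambda>n. ereal (u n)) = limsup (\<lambda>n. ereal (v n))"
    unfolding eq by (subst ereal_limsup_lim_add[OF lim]) simp_all
  show "liminf (\<lambda>n. ereal (u n)) = liminf (\<lambda>n. ereal (v n))"
    unfolding eq by (subst ereal_liminf_lim_add[OF lim]) simp_all
qed

text \<open>The difference equals \<open>(s / n - f x) / (n + 1)\<close> with
  \<open>s = bsum f n (T x)\<close>. It makes the upper and lower limits of the averages invariant
  under \<open>T\<close>.\<close>

lemma birkhoff_shift:
  assumes "\<And>x. \<bar>f x\<bar> \<le> K"
  shows "(\<lambda>n. bsum f n (T x) / real n - bsum f (Suc n) x / real (Suc n)) \<longlonglongrightarrow> 0"
proof (rule Lim_null_comparison)
  have K0: "0 \<le> K"
    using assms[of undefined] by linarith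
  show "eventually (\<lambda>n. norm (bsum f n (T x) / real n - bsum f (Suc n) x / real (Suc n)) \<le> 2 * K / real (Suc n)) sequentially"
  proof (rule eventually_sequentiallyI)
    fix n :: nat assume n: "1 \<le> n"
    let ?s = "bsum f n (T x)"
    have "?s / real n - bsum f (Suc n) x / real (Suc n) = (?s / real n - f x) / real (Suc n)"
      using n by (simp add: field_simps)
    moreover have "\<bar>?s / real n\<bar> \<le> K"
      using bsum_bound[of f K n "T x"] assms n by (simp add: field_simps)
    then have "\<bar>?s / real n - f x\<bar> \<le> 2 * K"
      using assms[of x] by linarith
    ultimately show "norm (?s / real n - bsum f (Suc n) x / real (Suc n)) \<le> 2 * K / real (Suc n)"
      by (simp add: divide_right_mono)
  qed
  show "(\<lambda>n. 2 * K / real (Suc n)) \<longlonglongrightarrow> 0"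
    using tendsto_mult_right_zero[OF LIMSEQ_inverse_real_of_nat, of "2 * K"] by (simp add: divide_inverse)
qed

text \<open>Let \<open>A\<close> be the invariant set where the lower limit is below
  \<open>c\<close> and the upper one above \<open>d\<close>, with \<open>c < d\<close>. The maximal
  inequality for \<open>f - d\<close> and for \<open>c - f\<close> bounds the integral of
  \<open>f\<close> over \<open>A\<close> below by \<open>d\<close> and above by \<open>c\<close>
  times the measure of \<open>A\<close>, so \<open>A\<close> is null.\<close>

theorem birkhoff:
  assumes f [measurable]: "f \<in> borel_measurable M" and K: "\<And>x. \<bar>f x\<bar> \<le> K"
  shows "AE x in M. convergent (\<lambda>n. bsum f n x / real n)"
proof -
  define L where "L x = limsup (\<lambda>n. ereal (bsum f n x / real n))" for x
  define l where "l x = liminf (\<lambda>n. ereal (bsum f n x / real n))" for x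
  have [measurable]: "L \<in> borel_measurable M" "l \<in> borel_measurable M"
    unfolding L_def l_def by measurable
  have K0: "0 \<le> K"
    using K[of undefined] by linarith
  have invariant: "L (T x) = L x" "l (T x) = l x" for x
    unfolding L_def l_def limsup_liminf_eq[OF birkhoff_shift[OF K]]
    using limsup_shift[of "\<lambda>n. ereal (bsum f n x / real n)"] liminf_shift[of "\<lambda>n. ereal (bsum f n x / real n)"]
    by simp_all
  have null: "AE x in M. \<not> (l x < ereal c \<and> ereal d < L x)" if "c < d" for c d :: real
  proof -
    define A where "A = {x\<in>space M. l x < ereal c \<and> ereal d < L x}"
    have A [measurable]: "A \<in> sets M"
      unfolding A_def by measurable
    have inv: "T x \<in> A \<longleftrightarrow> x \<in> A" if "x \<in> space M" for x
      using that measurable_space[OF T_measurable that] by (simp add: A_def invariant)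
    have up: "\<exists>k. 0 < bsum (\<lambda>x. f x - d) k x" if "x \<in> A" for x
    proof (rule ccontr)
      assume "\<not> ?thesis"
      then have "bsum f k x \<le> real k * d" for k
        by (auto simp: bsum_diff_const not_less)
      then have "eventually (\<lambda>k. ereal (bsum f k x / real k) \<le> ereal d) sequentially"
        by (intro eventually_sequentiallyI[of 1]) (simp add: field_simps)
      then have "L x \<le> ereal d"
        unfolding L_def by (rule Limsup_bounded)
      moreover have "ereal d < L x"
        using that by (simp add: A_def)
      ultimately show False
        using leD by blast
    qed
    have down: "\<exists>k. 0 < bsum (\<lambda>x. c - f x) k x" if "x \<in> A" for x
    proof (rule ccontr)
      assume "\<not> ?thesis"
      then have "real k * c \<le> bsum f k x" for k
        by (auto simp: bsum_const_diff not_less)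
      then have "eventually (\<lambda>k. ereal c \<le> ereal (bsum f k x / real k)) sequentially"
        by (intro eventually_sequentiallyI[of 1]) (simp add: field_simps)
      then have "ereal c \<le> l x"
        unfolding l_def by (rule Liminf_bounded)
      moreover have "l x < ereal c"
        using that by (simp add: A_def)
      ultimately show False
        using leD by blast
    qed
    have "0 \<le> (\<integral>x. (f x - d) * indicator A x \<partial>M)"
    proof (rule maximal_inequality_invariant[OF _ _ A inv up])
      show "\<bar>f x - d\<bar> \<le> K + \<bar>d\<bar>" for x
        using K[of x] by linarith
    qed measurable
    moreover have "0 \<le> (\<integral>x. (c - f x) * indicator A x \<partial>M)"
    proof (rule maximal_inequality_invariant[OF _ _ A inv down])
      show "\<bar>c - f x\<bar> \<le> K + \<bar>c\<bar>" for x
        using K[of x] by linarith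
    qed measurable
    moreover have int: "integrable M (\<lambda>x. f x * indicator A x)" "integrable M (\<lambda>x. e * indicator A x)" for e :: real
      using K K0
      by (intro integrable_const_bound[of _ K] integrable_const_bound[of _ "\<bar>e\<bar>"]; auto simp: indicator_def)+
    ultimately have "0 \<le> (\<integral>x. f x * indicator A x \<partial>M) - d * measure M A"
        "0 \<le> c * measure M A - (\<integral>x. f x * indicator A x \<partial>M)"
      by (simp_all add: left_diff_distrib)
    then have "0 \<le> (c - d) * measure M A"
      by (simp add: left_diff_distrib)
    then have "measure M A = 0"
      using that by (simp add: zero_le_mult_iff measure_le_0_iff)
    then have "emeasure M A = 0"
      by (simp add: emeasure_eq_measure)
    then have "AE x in M. x \<notin> A"
      using A by (intro AE_not_in) (simp add: null_sets_def)
    then show ?thesis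
      using AE_space by eventually_elim (auto simp: A_def)
  qed
  \<comment> \<open>Countably many rational pairs detect every gap between the lower and the upper
    limit.\<close>
  have "AE x in M. \<forall>c d::rat. c < d \<longrightarrow> \<not> (l x < ereal (of_rat c) \<and> ereal (of_rat d) < L x)"
    unfolding AE_all_countable using null by (auto simp: of_rat_less)
  then show ?thesis
  proof eventually_elim
    case (elim x)
    let ?u = "\<lambda>n. bsum f n x / real n"
    have "\<not> l x < L x"
    proof
      assume "l x < L x"
      then obtain c where c: "l x < ereal (of_rat c)" "ereal (of_rat c) < L x"
        using ereal_dense3 by blast
      then obtain d where d: "ereal (of_rat c) < ereal (of_rat d)" "ereal (of_rat d) < L x"
        using ereal_dense3[OF c(2)] by blast
      then show False
        using elim c(1) by (auto simp: of_rat_less)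
    qed
    moreover have "l x \<le> L x"
      unfolding l_def L_def by (rule Liminf_le_Limsup) simp
    ultimately have eq: "l x = L x"
      by simp
    have lim: "(\<lambda>n. ereal (?u n)) \<longlonglongrightarrow> L x"
      using eq by (simp add: tendsto_iff_Liminf_eq_Limsup l_def L_def)
    have u: "\<bar>?u n\<bar> \<le> K" for n
      using bsum_bound[of f K n x] K K0 by (cases "n = 0") (simp_all add: field_simps)
    have "L x \<le> ereal K"
    proof (rule LIMSEQ_le_const2[OF lim])
      have "?u n \<le> K" for n
        using u[of n] by linarith
      then show "\<exists>N. \<forall>n\<ge>N. ereal (?u n) \<le> ereal K"
        by simp
    qed
    moreover have "ereal (- K) \<le> L x"
    proof (rule LIMSEQ_le_const[OF lim])
      have "- K \<le> ?u n" for n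
        using u[of n] by linarith
      then show "\<exists>N. \<forall>n\<ge>N. ereal (- K) \<le> ereal (?u n)"
        by simp
    qed
    ultimately obtain r where "L x = ereal r"
      by (cases "L x") auto
    then show ?case
      using lim by (auto simp: convergent_def)
  qed
qed

text \<open>The sum of \<open>a (j + k) - a j\<close> over \<open>j < n\<close> is evaluated twice.
  Termwise it is within \<open>n C\<close> of the Birkhoff sum of \<open>a k\<close>; after
  cancellation it is a sum of \<open>k\<close> terms \<open>a (n + i) - a i\<close>, each within
  \<open>C + 2 R\<close> of \<open>a n\<close>.\<close>

lemma quasi_additive_bsum:
  fixes a :: "nat \<Rightarrow> 'a \<Rightarrow> real"
  assumes quasi: "\<And>m n x. \<bar>a (m + n) x - a m x - a n ((T ^^ m) x)\<bar> \<le> C"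
    and R: "\<And>i x. i \<le> k \<Longrightarrow> \<bar>a i x\<bar> \<le> R"
  shows "\<bar>real k * a n x - bsum (a k) n x\<bar> \<le> real n * C + real k * (C + 2 * R)"
proof -
  have 1: "(\<Sum>j<n. a (j + k) x - a j x) = (\<Sum>i<k. a (n + i) x - a i x)"
  proof (induction n)
    case (Suc n)
    have "(\<Sum>i<k. a (Suc n + i) x) + a n x = (\<Sum>i<k. a (n + i) x) + a (n + k) x"
      using sum.lessThan_Suc_shift[of "\<lambda>i. a (n + i) x" k] by simp
    then show ?case
      using Suc by (simp add: sum_subtractf algebra_simps)
  qed simp
  have "\<bar>(\<Sum>j<n. a (j + k) x - a j x) - bsum (a k) n x\<bar> \<le> real n * C"
  proof -
    have "\<bar>(\<Sum>j<n. a (j + k) x - a j x) - bsum (a k) n x\<bar> = \<bar>\<Sum>j<n. a (j + k) x - a j x - a k ((T ^^ j) x)\<bar>"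
      by (simp add: bsum_eq sum_subtractf)
    also have "\<dots> \<le> (\<Sum>j<n. \<bar>a (j + k) x - a j x - a k ((T ^^ j) x)\<bar>)"
      by (rule sum_abs)
    also have "\<dots> \<le> (\<Sum>j<n. C)"
      by (intro sum_mono quasi)
    finally show ?thesis
      by simp
  qed
  moreover have "\<bar>real k * a n x - (\<Sum>i<k. a (n + i) x - a i x)\<bar> \<le> real k * (C + 2 * R)"
  proof -
    have "real k * a n x - (\<Sum>i<k. a (n + i) x - a i x) = (\<Sum>i<k. a n x - (a (n + i) x - a i x))"
      by (simp add: sum_subtractf)
    also have "\<bar>\<dots>\<bar> \<le> (\<Sum>i<k. \<bar>a n x - (a (n + i) x - a i x)\<bar>)"
      by (rule sum_abs)
    also have "\<dots> \<le> (\<Sum>i<k. C + 2 * R)"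
    proof (rule sum_mono)
      fix i assume "i \<in> {..<k}"
      then show "\<bar>a n x - (a (n + i) x - a i x)\<bar> \<le> C + 2 * R"
        using quasi[of n i x] R[of i x] R[of i "(T ^^ n) x"] by auto
    qed
    finally show ?thesis
      by simp
  qed
  ultimately show ?thesis
    unfolding 1 by linarith
qed

text \<open>For every \<open>k\<close>, the averages \<open>a n / n\<close> differ from the Birkhoff averages of \<open>a k / k\<close> by at
  most \<open>C / k\<close> in the limit.\<close>

theorem quasi_additive_convergent:
  fixes a :: "nat \<Rightarrow> 'a \<Rightarrow> real"
  assumes a [measurable]: "\<And>n. a n \<in> borel_measurable M"
    and quasi: "\<And>m n x. \<bar>a (m + n) x - a m x - a n ((T ^^ m) x)\<bar> \<le> C"
    and bounded: "\<And>n. \<exists>R. \<forall>x. \<bar>a n x\<bar> \<le> R"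
  shows "AE x in M. convergent (\<lambda>n. a n x / real n)"
proof -
  have C0: "0 \<le> C"
    using quasi[of 0 0 undefined] by linarith
  have "AE x in M. \<forall>k. convergent (\<lambda>n. bsum (a k) n x / real n)"
    unfolding AE_all_countable
  proof
    fix k
    obtain R where "\<forall>x. \<bar>a k x\<bar> \<le> R"
      using bounded by blast
    then show "AE x in M. convergent (\<lambda>n. bsum (a k) n x / real n)"
      by (intro birkhoff[of _ R]) auto
  qed
  then show ?thesis
  proof eventually_elim
    case (elim x)
    have "Cauchy (\<lambda>n. a n x / real n)"
      unfolding Cauchy_def
    proof (intro allI impI)
      fix e :: real assume e: "0 < e"
      \<comment> \<open>\<open>k\<close> is fixed before \<open>R\<close> and \<open>n2\<close>,
        which depend on it. It makes the persistent error \<open>C / k\<close> at most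
        \<open>e / 8\<close>; \<open>n2\<close> does the same for the vanishing one.\<close>
      obtain k :: nat where k: "8 * (C + 1) / e < real k" "0 < k"
      proof -
        obtain k :: nat where k: "8 * (C + 1) / e < real k"
          using reals_Archimedean2 by blast
        moreover have "0 < 8 * (C + 1) / e"
          using C0 e by simp
        ultimately have "0 < k"
          by (metis gr0I less_trans of_nat_0 less_irrefl)
        with k show thesis
          by (rule that)
      qed
      have "\<exists>R. \<forall>i\<le>k. \<forall>x. \<bar>a i x\<bar> \<le> R"
      proof -
        obtain r where r: "\<And>n x. \<bar>a n x\<bar> \<le> r n"
          using bounded by metis
        have "\<bar>a i x\<bar> \<le> (\<Sum>i\<le>k. \<bar>r i\<bar>)" if "i \<le> k" for i x
          using r[of i x] member_le_sum[of i "{..k}" "\<lambda>i. \<bar>r i\<bar>"] that by fastforce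
        then show ?thesis
          by blast
      qed
      then obtain R where R: "\<And>i x. i \<le> k \<Longrightarrow> \<bar>a i x\<bar> \<le> R"
        by blast
      define v where "v n = bsum (a k) n x / real n / real k" for n
      obtain L where "(\<lambda>n. bsum (a k) n x / real n) \<longlonglongrightarrow> L"
        using elim unfolding convergent_def by blast
      then have "v \<longlonglongrightarrow> L / real k"
        unfolding v_def using k(2) by (intro tendsto_intros) auto
      then have "Cauchy v"
        by (rule LIMSEQ_imp_Cauchy)
      then obtain n1 where n1: "\<And>m n. n1 \<le> m \<Longrightarrow> n1 \<le> n \<Longrightarrow> \<bar>v m - v n\<bar> < e / 2"
        unfolding Cauchy_def dist_real_def using e half_gt_zero by metis
      obtain n2 :: nat where n2: "8 * (C + 2 * R) / e < real n2" "0 < n2"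
      proof -
        obtain n :: nat where "8 * (C + 2 * R) / e < real n"
          using reals_Archimedean2 by blast
        then have "8 * (C + 2 * R) / e < real (Suc n)"
          by simp
        then show thesis
          by (rule that) simp
      qed
      have close: "\<bar>a n x / real n - v n\<bar> \<le> e / 4" if "n2 \<le> n" for n
      proof -
        have n: "0 < real n" "8 * (C + 2 * R) / e < real n"
          using that n2 by auto
        have "\<bar>real k * a n x - bsum (a k) n x\<bar> \<le> real n * C + real k * (C + 2 * R)"
          by (rule quasi_additive_bsum[OF quasi R])
        then have "\<bar>real k * a n x - bsum (a k) n x\<bar> / (real k * real n) \<le> (real n * C + real k * (C + 2 * R)) / (real k * real n)"
          using k n by (intro divide_right_mono) auto
        also have "\<dots> = C / real k + (C + 2 * R) / real n"
          using k n by (simp add: field_simps)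
        also have "\<bar>real k * a n x - bsum (a k) n x\<bar> / (real k * real n) = \<bar>a n x / real n - v n\<bar>"
        proof -
          have "a n x / real n - v n = (real k * a n x - bsum (a k) n x) / (real k * real n)"
            using k n by (simp add: v_def field_simps)
          then show ?thesis
            using k n by simp
        qed
        finally have "\<bar>a n x / real n - v n\<bar> \<le> C / real k + (C + 2 * R) / real n" .
        moreover have "C / real k \<le> e / 8"
        proof -
          have "8 * (C + 1) < e * real k"
            using k e by (simp add: field_simps)
          then show ?thesis
            using k e by (simp add: field_simps)
        qed
        moreover have "(C + 2 * R) / real n \<le> e / 8"
          using n e by (simp add: field_simps)
        ultimately show ?thesis
          by linarith
      qed
      show "\<exists>n0. \<forall>m\<ge>n0. \<forall>n\<ge>n0. dist (a m x / real m) (a n x / real n) < e"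
      proof (intro exI allI impI)
        fix m n assume "max n1 n2 \<le> m" "max n1 n2 \<le> n"
        then have "\<bar>v m - v n\<bar> < e / 2" "\<bar>a m x / real m - v m\<bar> \<le> e / 4" "\<bar>a n x / real n - v n\<bar> \<le> e / 4"
          using n1[of m n] close[of m] close[of n] by auto
        then show "dist (a m x / real m) (a n x / real n) < e"
          unfolding dist_real_def by linarith
      qed
    qed
    then show ?case
      by (simp add: Cauchy_convergent_iff)
  qed
qed

end

section \<open>Quasi-additive functions over a flow\<close>

text \<open>Every unit of time costs at most \<open>K\<close> for the step and \<open>C\<close> for
  splitting it off.\<close>

lemma quasi_additive_growth:
  fixes a :: "'m::topological_space \<Rightarrow> real \<Rightarrow> real"
  assumes quasi: "\<And>\<xi> s t. 0 \<le> s \<Longrightarrow> 0 \<le> t \<Longrightarrow> \<bar>a \<xi> (s + t) - a \<xi> s - a (\<phi> s \<xi>) t\<bar> \<le> C"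
    and K: "\<And>\<xi> t. 0 \<le> t \<Longrightarrow> t \<le> 1 \<Longrightarrow> \<bar>a \<xi> t\<bar> \<le> K" and "0 \<le> t"
  shows "\<bar>a \<xi> t\<bar> \<le> (t + 1) * (K + C)"
proof -
  have KC: "0 \<le> K + C"
    using K[of 0 undefined] quasi[of 0 0 undefined] by simp
  have step: "\<bar>a \<xi> t\<bar> \<le> real (Suc n) * (K + C)" if "real n \<le> t" "t \<le> real n + 1" for n t \<xi>
    using that
  proof (induction n arbitrary: t \<xi>)
    case 0
    then have "\<bar>a \<xi> t\<bar> \<le> K"
      using K[of t \<xi>] by simp
    moreover have "0 \<le> C"
      using quasi[of 0 0 undefined] by simp
    ultimately show ?case
      by simp
  next
    case (Suc n)
    have "\<bar>a (\<phi> 1 \<xi>) (t - 1)\<bar> \<le> real (Suc n) * (K + C)"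
      using Suc.prems by (intro Suc.IH) auto
    moreover have "\<bar>a \<xi> (1 + (t - 1)) - a \<xi> 1 - a (\<phi> 1 \<xi>) (t - 1)\<bar> \<le> C"
      using Suc.prems by (intro quasi) auto
    moreover have "\<bar>a \<xi> 1\<bar> \<le> K"
      by (rule K) auto
    moreover have "real (Suc (Suc n)) * (K + C) = real (Suc n) * (K + C) + (K + C)"
      by (simp add: algebra_simps)
    ultimately show ?case
      by simp
  qed
  have n: "real (nat \<lfloor>t\<rfloor>) \<le> t" "t \<le> real (nat \<lfloor>t\<rfloor>) + 1"
    using \<open>0 \<le> t\<close> by linarith+
  have "\<bar>a \<xi> t\<bar> \<le> real (Suc (nat \<lfloor>t\<rfloor>)) * (K + C)"
    by (rule step[OF n])
  also have "\<dots> \<le> (t + 1) * (K + C)"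
    using n KC by (intro mult_right_mono) auto
  finally show ?thesis .
qed

text \<open>The discrete theorem applies to the time-one map; real times follow because
  quasi-additivity keeps \<open>a \<xi> t\<close> within \<open>C + K\<close> of its value at the
  integer part of \<open>t\<close>.\<close>

theorem quasi_additive_flow:
  fixes a :: "'m::topological_space \<Rightarrow> real \<Rightarrow> real" and \<mu> :: "'m measure"
  assumes sets: "sets \<mu> = sets borel" and finite: "emeasure \<mu> UNIV < \<infinity>"
    and flow: "continuous_flow \<phi>"
    and inv: "\<And>t A. A \<in> sets \<mu> \<Longrightarrow> emeasure \<mu> (\<phi> t -` A) = emeasure \<mu> A"
    and a: "\<And>t. 0 \<le> t \<Longrightarrow> (\<lambda>\<xi>. a \<xi> t) \<in> borel_measurable borel"
    and quasi: "\<And>\<xi> s t. 0 \<le> s \<Longrightarrow> 0 \<le> t \<Longrightarrow> \<bar>a \<xi> (s + t) - a \<xi> s - a (\<phi> s \<xi>) t\<bar> \<le> C"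
    and K: "\<And>\<xi> t. 0 \<le> t \<Longrightarrow> t \<le> 1 \<Longrightarrow> \<bar>a \<xi> t\<bar> \<le> K"
  obtains F where "F \<in> borel_measurable borel" "\<And>t. 0 \<le> t \<Longrightarrow> F \<circ> \<phi> t = F"
    "\<And>\<xi>. \<bar>F \<xi>\<bar> \<le> 2 * (K + C)" "AE \<xi> in \<mu>. ((\<lambda>t. a \<xi> t / t) \<longlongrightarrow> F \<xi>) at_top"
proof -
  have flow_add: "\<phi> (s + t) \<xi> = \<phi> s (\<phi> t \<xi>)" and flow_zero: "\<phi> 0 \<xi> = \<xi>" for s t \<xi>
    using flow unfolding continuous_flow_def by blast+
  have space: "space \<mu> = UNIV"
    using sets_eq_imp_space_eq[OF sets] by simp
  have growth: "\<bar>a \<xi> t\<bar> \<le> (t + 1) * (K + C)" if "0 \<le> t" for \<xi> t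
    by (rule quasi_additive_growth[where \<phi> = \<phi>, OF quasi K that])
  have C0: "0 \<le> C" and KC: "0 \<le> K + C"
    using K[of 0 undefined] quasi[of 0 0 undefined] by simp_all
  have cont: "continuous_on UNIV (\<phi> 1)"
  proof -
    have "continuous_on UNIV (\<lambda>p. \<phi> (fst p) (snd p))"
      using flow unfolding continuous_flow_def by blast
    moreover have "continuous_on UNIV (\<lambda>\<xi>::'m. (1::real, \<xi>))"
      by (intro continuous_intros)
    ultimately show ?thesis
      using continuous_on_compose2[of UNIV _ UNIV "\<lambda>\<xi>. (1, \<xi>)"] by fastforce
  qed
  have meas: "\<phi> 1 \<in> measurable \<mu> \<mu>"
    using borel_measurable_continuous_onI[OF cont] by (simp add: measurable_cong_sets[OF sets sets])
  interpret finite_measure \<mu>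
    by (rule finite_measureI) (use finite in \<open>simp add: space\<close>)
  interpret measure_preserving_map \<mu> "\<phi> 1"
  proof
    show "\<phi> 1 \<in> measurable \<mu> \<mu>"
      by (rule meas)
    show "distr \<mu> \<mu> (\<phi> 1) = \<mu>"
      by (rule measure_eqI) (simp_all add: emeasure_distr[OF meas] inv space)
  qed
  have iterate: "(\<phi> 1 ^^ m) \<xi> = \<phi> (real m) \<xi>" for m \<xi>
    by (induction m) (simp_all add: flow_zero flow_add)
  have conv: "AE \<xi> in \<mu>. convergent (\<lambda>n. a \<xi> (real n) / real n)"
  proof (rule quasi_additive_convergent)
    show "(\<lambda>\<xi>. a \<xi> (real n)) \<in> borel_measurable \<mu>" for n
      using a[of "real n"] by (simp add: measurable_cong_sets[OF sets refl])
    show "\<bar>a \<xi> (real (m + n)) - a \<xi> (real m) - a ((\<phi> 1 ^^ m) \<xi>) (real n)\<bar> \<le> C" for m n \<xi>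
      using quasi[of "real m" "real n" \<xi>] by (simp add: iterate)
    show "\<exists>R. \<forall>\<xi>. \<bar>a \<xi> (real n)\<bar> \<le> R" for n
      using growth[of "real n"] by (intro exI[of _ "(real n + 1) * (K + C)"]) simp
  qed
  define R where "R = 2 * (K + C)"
  \<comment> \<open>Existing limits lie in \<open>[- R, R]\<close>, because
    \<open>n + 1 \<le> 2 n\<close> in the growth bound. Clipping leaves them unchanged and bounds
    \<open>F\<close> also where the limit does not exist.\<close>
  define F where "F \<xi> = max (- R) (min R (lim (\<lambda>n. a \<xi> (real n) / real n)))" for \<xi>
  have R0: "0 \<le> R"
    using KC by (simp add: R_def)
  have F_lim: "(\<lambda>n. a \<xi> (real n) / real n) \<longlonglongrightarrow> F \<xi>" if "convergent (\<lambda>n. a \<xi> (real n) / real n)" for \<xi>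
  proof -
    let ?L = "lim (\<lambda>n. a \<xi> (real n) / real n)"
    have L: "(\<lambda>n. a \<xi> (real n) / real n) \<longlonglongrightarrow> ?L"
      using that by (simp add: convergent_LIMSEQ_iff)
    have bnd: "\<bar>a \<xi> (real n) / real n\<bar> \<le> R" if "1 \<le> n" for n
    proof -
      have "\<bar>a \<xi> (real n)\<bar> \<le> (real n + 1) * (K + C)"
        by (rule growth) simp
      also have "\<dots> \<le> (2 * real n) * (K + C)"
        using that KC by (intro mult_right_mono) auto
      finally show ?thesis
        using that by (simp add: R_def field_simps)
    qed
    have "?L \<le> R" "- R \<le> ?L"
    proof -
      show "?L \<le> R"
      proof (intro LIMSEQ_le_const2[OF L] exI[of _ 1] allI impI)
        show "a \<xi> (real n) / real n \<le> R" if "1 \<le> n" for n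
          using bnd[OF that] by linarith
      qed
      show "- R \<le> ?L"
      proof (intro LIMSEQ_le_const[OF L] exI[of _ 1] allI impI)
        show "- R \<le> a \<xi> (real n) / real n" if "1 \<le> n" for n
          using bnd[OF that] by linarith
      qed
    qed
    then have "F \<xi> = ?L"
      by (simp add: F_def)
    with L show ?thesis
      by simp
  qed
  have F_meas: "F \<in> borel_measurable borel"
    unfolding F_def using a by (intro borel_measurable_max borel_measurable_min
        borel_measurable_const borel_measurable_lim_metric borel_measurable_divide) auto
  moreover have "F \<circ> \<phi> t = F" if t: "0 \<le> t" for t
  proof
    fix \<xi>
    have "(\<lambda>n. a (\<phi> t \<xi>) (real n) / real n - a \<xi> (real n) / real n) \<longlonglongrightarrow> 0"
    proof (rule Lim_null_comparison)
      let ?B = "2 * C + 2 * ((t + 1) * (K + C))"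
      \<comment> \<open>Split \<open>a \<xi> (t + n)\<close> once after time \<open>t\<close> and
        once after time \<open>n\<close>; each splitting costs \<open>C\<close>, and each leaves one
        value of \<open>a\<close> at time \<open>t\<close>.\<close>
      have "\<bar>a (\<phi> t \<xi>) (real n) - a \<xi> (real n)\<bar> \<le> ?B" for n
        using quasi[OF t of_nat_0_le_iff[of n], of \<xi>] quasi[OF of_nat_0_le_iff[of n] t, of \<xi>]
          growth[OF t, of \<xi>] growth[OF t, of "\<phi> (real n) \<xi>"]
        by (simp add: add.commute[of "real n"])
      then have "\<bar>a (\<phi> t \<xi>) (real n) - a \<xi> (real n)\<bar> / real n \<le> ?B / real n" for n
        by (rule divide_right_mono) simp
      then show "eventually (\<lambda>n. norm (a (\<phi> t \<xi>) (real n) / real n - a \<xi> (real n) / real n) \<le> ?B / real n) sequentially"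
        by (simp add: diff_divide_distrib[symmetric])
      show "(\<lambda>n. ?B / real n) \<longlonglongrightarrow> 0"
        by (rule lim_const_over_n)
    qed
    \<comment> \<open>The two sequences have the same limits, possibly none, so \<open>lim\<close>
      agrees in either case and \<open>F\<close> is invariant at every point.\<close>
    then have "(\<lambda>n. a (\<phi> t \<xi>) (real n) / real n) \<longlonglongrightarrow> L \<longleftrightarrow> (\<lambda>n. a \<xi> (real n) / real n) \<longlonglongrightarrow> L" for L
      by (rule Lim_transform_eq)
    then show "(F \<circ> \<phi> t) \<xi> = F \<xi>"
      by (simp add: F_def lim_def)
  qed
  moreover have "\<bar>F \<xi>\<bar> \<le> 2 * (K + C)" for \<xi>
    using R0 unfolding F_def R_def[symmetric] by (auto simp: max_def min_def)
  moreover have "AE \<xi> in \<mu>. ((\<lambda>t. a \<xi> t / t) \<longlongrightarrow> F \<xi>) at_top"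
    using conv
  proof eventually_elim
    case (elim \<xi>)
    let ?n = "\<lambda>t::real. nat \<lfloor>t\<rfloor>"
    have n: "real (?n t) \<le> t" "t \<le> real (?n t) + 1" if "0 \<le> t" for t
      using that by linarith+
    have inverse: "((\<lambda>t::real. c / t) \<longlongrightarrow> 0) at_top" for c :: real
      by (rule real_tendsto_divide_at_top[OF tendsto_const filterlim_ident])
    have "filterlim ?n sequentially at_top"
      by (rule filterlim_compose[OF filterlim_nat_sequentially filterlim_floor_sequentially])
    from filterlim_compose[OF F_lim[OF elim] this]
    have 1: "((\<lambda>t. a \<xi> (real (?n t)) / real (?n t)) \<longlongrightarrow> F \<xi>) at_top" .
    have "((\<lambda>t. real (?n t) / t - 1) \<longlongrightarrow> 0) at_top"
    proof (rule Lim_null_comparison[OF _ inverse[of 1]])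
      show "eventually (\<lambda>t. norm (real (?n t) / t - 1) \<le> 1 / t) at_top"
        using eventually_gt_at_top[of 0]
      proof eventually_elim
        case (elim t)
        have "real (?n t) / t - 1 = (real (?n t) - t) / t"
          using elim by (simp add: field_simps)
        moreover have "\<bar>real (?n t) - t\<bar> / t \<le> 1 / t"
        proof (rule divide_right_mono)
          show "\<bar>real (?n t) - t\<bar> \<le> 1"
            using n[of t] elim by linarith
        qed (use elim in simp)
        ultimately show ?case
          using elim by simp
      qed
    qed
    then have 2: "((\<lambda>t. real (?n t) / t) \<longlongrightarrow> 1) at_top"
      by (simp add: LIM_zero_iff)
    have 3: "((\<lambda>t. a \<xi> t / t - a \<xi> (real (?n t)) / real (?n t) * (real (?n t) / t)) \<longlongrightarrow> 0) at_top"
    proof (rule Lim_null_comparison[OF _ inverse[of "C + K"]])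
      show "eventually (\<lambda>t. norm (a \<xi> t / t - a \<xi> (real (?n t)) / real (?n t) * (real (?n t) / t)) \<le> (C + K) / t) at_top"
        using eventually_ge_at_top[of 1]
      proof eventually_elim
        case (elim t)
        have n': "0 \<le> t - real (?n t)" "t - real (?n t) \<le> 1"
          using n[of t] elim by linarith+
        have "0 < real (?n t)"
          using elim by simp
        then have "a \<xi> (real (?n t)) / real (?n t) * (real (?n t) / t) = a \<xi> (real (?n t)) / t"
          by (metis nonzero_eq_divide_eq less_irrefl times_divide_eq_right)
        then have eq: "a \<xi> t / t - a \<xi> (real (?n t)) / real (?n t) * (real (?n t) / t) = (a \<xi> t - a \<xi> (real (?n t))) / t"
          by (simp add: diff_divide_distrib)
        have "\<bar>a \<xi> t - a \<xi> (real (?n t)) - a (\<phi> (real (?n t)) \<xi>) (t - real (?n t))\<bar> \<le> C"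
          using quasi[OF of_nat_0_le_iff[of "?n t"] n'(1), of \<xi>] by simp
        moreover have "\<bar>a (\<phi> (real (?n t)) \<xi>) (t - real (?n t))\<bar> \<le> K"
          by (rule K[OF n'])
        ultimately have "\<bar>a \<xi> t - a \<xi> (real (?n t))\<bar> \<le> C + K"
          by linarith
        then show ?case
          unfolding eq using elim by (simp add: divide_right_mono)
      qed
    qed
    from tendsto_add[OF 3 tendsto_mult[OF 1 2]] show ?case
      by simp
  qed
  ultimately show thesis
    by (rule that[unfolded R_def])
qed

text \<open>Convergence in the mean is stated together with integrability, because the integral of a
  non-integrable function is 0 by convention. The inner product \<open>G\<close> is arbitrary, so
  the result holds for every choice entering the index.\<close>

theorem theorem5p7:
  fixes m :: nat
    and \<omega> :: "'v::complex_inner \<Rightarrow> 'v \<Rightarrow> complex"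
    and J :: "'v \<Rightarrow> 'v"
    and G :: "'v \<times> 'v \<Rightarrow> 'v \<times> 'v \<Rightarrow> complex"
    and \<phi> :: "real \<Rightarrow> 'm::t2_space \<Rightarrow> 'm"
    and \<mu> :: "'m measure"
    and B :: "'m \<Rightarrow> 'v \<Rightarrow>\<^sub>L 'v"
    and \<gamma> :: "'m \<Rightarrow> real \<Rightarrow> 'v \<Rightarrow> 'v"
    and i :: "real \<Rightarrow> 'm \<Rightarrow> int"
  assumes "\<exists>S::'v set. finite S \<and> cspan S = UNIV"
    and "cdim (UNIV :: 'v set) = m"
    and "symplectic_form \<omega>"
    and "clinear J" and "bij J"
    and "\<forall>x y. \<omega> x y = cinner (J x) y"
    and "inner_product G"
    and "compact (UNIV :: 'm set)"
    and "continuous_flow \<phi>"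
    and "sets \<mu> = sets borel"
    and "\<forall>t. \<forall>A\<in>sets \<mu>. emeasure \<mu> (\<phi> t -` A) = emeasure \<mu> A"
    and "0 < emeasure \<mu> UNIV" and "emeasure \<mu> UNIV < \<infinity>"
    and "continuous_on UNIV B"
    and "\<forall>\<xi>. self_adjoint (blinfun_apply (B \<xi>))"
    and "\<forall>\<xi>. fundamental_solution (\<lambda>t x. - inv J (B (\<phi> t \<xi>) x)) (\<gamma> \<xi>)"
    and "\<forall>\<tau>>0. \<forall>\<xi>. i \<tau> \<xi> = maslov_i1 G \<omega> 0 \<tau> (\<gamma> \<xi>)"
  shows "\<exists>F :: 'm \<Rightarrow> real.
    F \<in> borel_measurable borel \<and>
    (\<forall>t\<ge>0. F \<circ> \<phi> t = F) \<and>
    integrable \<mu> F \<and> (\<forall>\<tau>>0. integrable \<mu> (\<lambda>\<xi>. real_of_int (i \<tau> \<xi>) / \<tau>)) \<and>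
    ((\<lambda>\<tau>. \<integral>\<xi>. \<bar>real_of_int (i \<tau> \<xi>) / \<tau> - F \<xi>\<bar> \<partial>\<mu>) \<longlongrightarrow> 0) at_top \<and>
    (AE \<xi> in \<mu>. ((\<lambda>\<tau>. real_of_int (i \<tau> \<xi>) / \<tau>) \<longlongrightarrow> F \<xi>) at_top)"
proof -
  obtain S :: "'v set" where S: "finite S" "cspan S = UNIV"
    using assms(1) by blast
  obtain T :: "('v \<times> 'v) set" where T: "finite T" "cspan T = UNIV"
    using finite_span_prod[OF S] .
  interpret form: split_form "\<lambda>x y. - \<i> * direct_sum_form \<omega> x y" "Xplus G (direct_sum_form \<omega>)"
      "Xminus G (direct_sum_form \<omega>)" T
    by (rule split_form_symplectic[OF assms(7) symplectic_direct_sum[OF assms(3)] T])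
  obtain N b where b: "form.onb (Xplus G (direct_sum_form \<omega>)) N b"
    using form.exists_onb[OF form.subspaces(1) _ T(1) form.pos] T(2) by auto
  have "hamiltonian_flow S \<omega> J \<phi> B \<gamma>"
    by (rule hamiltonian_flow.intro) (use S assms in blast)+
  then interpret hamiltonian_maslov S \<omega> J \<phi> B \<gamma> G T N b
    by (intro hamiltonian_maslov.intro form.split_form_axioms hamiltonian_maslov_axioms.intro b)
  obtain K where K: "\<And>\<xi> t. 0 \<le> t \<Longrightarrow> t \<le> 1 \<Longrightarrow> \<bar>angle \<xi> t\<bar> \<le> K"
    using angle_bounded by metis
  define C where "C = 2 * pi * real N"
  obtain F0 where F0: "F0 \<in> borel_measurable borel" "\<And>t. 0 \<le> t \<Longrightarrow> F0 \<circ> \<phi> t = F0"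
      "\<And>\<xi>. \<bar>F0 \<xi>\<bar> \<le> 2 * (K + C)" "AE \<xi> in \<mu>. ((\<lambda>t. angle \<xi> t / t) \<longlongrightarrow> F0 \<xi>) at_top"
  proof (rule quasi_additive_flow[OF assms(10,13,9)])
    show "emeasure \<mu> (\<phi> t -` A) = emeasure \<mu> A" if "A \<in> sets \<mu>" for t A
      using assms(11) that by blast
    show "(\<lambda>\<xi>. angle \<xi> t) \<in> borel_measurable borel" if "0 \<le> t" for t
      by (rule borel_measurable_continuous_onI[OF angle_continuous_space[OF that]])
    show "\<bar>angle \<xi> (s + t) - angle \<xi> s - angle (\<phi> s \<xi>) t\<bar> \<le> C" if "0 \<le> s" "0 \<le> t" for \<xi> s t
      unfolding C_def by (rule angle_quasi_additive[OF that])
    show "\<bar>angle \<xi> t\<bar> \<le> K" if "0 \<le> t" "t \<le> 1" for \<xi> t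
      by (rule K[OF that])
  qed blast
  have space: "space \<mu> = UNIV"
    using sets_eq_imp_space_eq[OF assms(10)] by simp
  interpret finite_measure \<mu>
    by (rule finite_measureI) (use assms(13) in \<open>simp add: space\<close>)
  have borel: "f \<in> borel_measurable \<mu> \<longleftrightarrow> f \<in> borel_measurable borel" for f :: "'m \<Rightarrow> real"
    by (simp add: measurable_cong_sets[OF assms(10) refl])
  \<comment> \<open>\<open>i\<close> is prescribed only for positive times; the default 0 makes
    \<open>u \<tau>\<close> measurable for every \<open>\<tau>\<close>, as dominated convergence
    asks.\<close>
  define u where "u \<tau> \<xi> = (if 0 < \<tau> then real_of_int (i \<tau> \<xi>) / \<tau> else 0)" for \<tau> \<xi>
  define F where "F \<xi> = F0 \<xi> / (2 * pi)" for \<xi>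
  have KC: "0 \<le> K + C"
    using K[of 0 undefined] by (simp add: C_def)
  have near: "\<bar>u \<tau> \<xi> - angle \<xi> \<tau> / \<tau> / (2 * pi)\<bar> \<le> real N / \<tau>" if "0 < \<tau>" for \<tau> \<xi>
  proof -
    have "u \<tau> \<xi> - angle \<xi> \<tau> / \<tau> / (2 * pi) = (real_of_int (maslov_i1 G \<omega> 0 \<tau> (\<gamma> \<xi>)) - angle \<xi> \<tau> / (2 * pi)) / \<tau>"
      using that assms(17) by (simp add: u_def diff_divide_distrib mult.commute)
    then show ?thesis
      using index_near_angle[of \<tau> \<xi>] that by (simp add: divide_right_mono)
  qed
  have shrink: "\<bar>x / (2 * pi)\<bar> \<le> \<bar>x\<bar>" for x
  proof -
    have "1 * \<bar>x\<bar> \<le> (2 * pi) * \<bar>x\<bar>"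
      using pi_ge_two by (intro mult_right_mono) auto
    then show ?thesis
      by (simp add: divide_le_eq mult.commute)
  qed
  have u_bound: "\<bar>u \<tau> \<xi>\<bar> \<le> (real N + (\<tau> + 1) * (K + C)) / \<tau>" if "0 < \<tau>" for \<tau> \<xi>
  proof -
    have "\<bar>angle \<xi> \<tau>\<bar> \<le> (\<tau> + 1) * (K + C)"
      using that by (intro quasi_additive_growth[where \<phi> = \<phi>] K) (auto simp: C_def intro: angle_quasi_additive)
    moreover have "\<bar>angle \<xi> \<tau> / \<tau> / (2 * pi)\<bar> \<le> \<bar>angle \<xi> \<tau>\<bar> / \<tau>"
      using shrink[of "angle \<xi> \<tau> / \<tau>"] that by simp
    ultimately have "\<bar>angle \<xi> \<tau> / \<tau> / (2 * pi)\<bar> \<le> (\<tau> + 1) * (K + C) / \<tau>"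
      using that by (meson divide_right_mono less_imp_le order_trans)
    moreover have "\<bar>x\<bar> \<le> c + d" if "\<bar>y\<bar> \<le> d" "\<bar>x - y\<bar> \<le> c" for x y c d :: real
      using that by linarith
    ultimately show ?thesis
      using near[OF that, of \<xi>] unfolding add_divide_distrib by blast
  qed
  have u_meas: "u \<tau> \<in> borel_measurable \<mu>" for \<tau>
  proof (cases "0 < \<tau>")
    case True
    then have "u \<tau> = (\<lambda>\<xi>. real_of_int (maslov_i1 G \<omega> 0 \<tau> (\<gamma> \<xi>)) / \<tau>)"
      using assms(17) by (auto simp: u_def)
    then show ?thesis
      using index_measurable[of \<tau>] True unfolding borel by (simp add: borel_measurable_divide)
  qed (simp add: u_def[abs_def])
  have F_meas: "F \<in> borel_measurable borel"
    unfolding F_def using F0(1) by simp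
  have F_bound: "\<bar>F \<xi>\<bar> \<le> 2 * (K + C)" for \<xi>
  proof -
    have "\<bar>F \<xi>\<bar> \<le> \<bar>F0 \<xi>\<bar>"
      unfolding F_def by (rule shrink)
    with F0(3)[of \<xi>] show ?thesis
      by linarith
  qed
  have F_inv: "F \<circ> \<phi> t = F" if "0 \<le> t" for t
    using fun_cong[OF F0(2)[OF that]] by (auto simp: F_def)
  have u_lim: "AE \<xi> in \<mu>. ((\<lambda>\<tau>. u \<tau> \<xi>) \<longlongrightarrow> F \<xi>) at_top"
    using F0(4)
  proof eventually_elim
    case (elim \<xi>)
    have "((\<lambda>\<tau>. u \<tau> \<xi> - angle \<xi> \<tau> / \<tau> / (2 * pi)) \<longlongrightarrow> 0) at_top"
    proof (rule Lim_null_comparison)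
      show "eventually (\<lambda>\<tau>. norm (u \<tau> \<xi> - angle \<xi> \<tau> / \<tau> / (2 * pi)) \<le> real N / \<tau>) at_top"
        using eventually_gt_at_top[of 0] by eventually_elim (simp only: real_norm_def near)
      show "((\<lambda>\<tau>::real. real N / \<tau>) \<longlongrightarrow> 0) at_top"
        by (rule real_tendsto_divide_at_top[OF tendsto_const filterlim_ident])
    qed
    moreover have "((\<lambda>\<tau>. angle \<xi> \<tau> / \<tau> / (2 * pi)) \<longlongrightarrow> F \<xi>) at_top"
      unfolding F_def by (intro tendsto_intros elim) simp
    ultimately show ?case
      using tendsto_add by fastforce
  qed
  have u_i: "eventually (\<lambda>\<tau>. \<forall>\<xi>. u \<tau> \<xi> = real_of_int (i \<tau> \<xi>) / \<tau>) at_top"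
    using eventually_gt_at_top[of 0] by eventually_elim (simp add: u_def)
  have "((\<lambda>\<tau>. \<integral>\<xi>. \<bar>u \<tau> \<xi> - F \<xi>\<bar> \<partial>\<mu>) \<longlongrightarrow> (\<integral>\<xi>. 0 \<partial>\<mu>)) at_top"
  \<comment> \<open>For \<open>\<tau> \<ge> 1\<close> the averages are bounded by
    \<open>N + 2 (K + C)\<close>, and \<open>F\<close> contributes another
    \<open>2 (K + C)\<close>.\<close>
  proof (rule integral_dominated_convergence_at_top[where w = "\<lambda>_. real N + 4 * (K + C)"])
    show "(\<lambda>\<xi>. \<bar>u \<tau> \<xi> - F \<xi>\<bar>) \<in> borel_measurable \<mu>" for \<tau>
      using u_meas F_meas[folded borel] by simp
    show "AE \<xi> in \<mu>. ((\<lambda>\<tau>. \<bar>u \<tau> \<xi> - F \<xi>\<bar>) \<longlongrightarrow> 0) at_top"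
      using u_lim by eventually_elim (simp add: LIM_zero tendsto_rabs_zero)
    show "eventually (\<lambda>\<tau>. AE \<xi> in \<mu>. norm \<bar>u \<tau> \<xi> - F \<xi>\<bar> \<le> real N + 4 * (K + C)) at_top"
      using eventually_ge_at_top[of 1]
    proof eventually_elim
      case (elim \<tau>)
      have "(real N + (\<tau> + 1) * (K + C)) / \<tau> \<le> real N + 2 * (K + C)"
      proof -
        have "real N * 1 \<le> real N * \<tau>"
          using elim by (intro mult_left_mono) auto
        moreover have "(\<tau> + 1) * (K + C) \<le> (2 * \<tau>) * (K + C)"
          using elim KC by (intro mult_right_mono) auto
        ultimately have "real N + (\<tau> + 1) * (K + C) \<le> (real N + 2 * (K + C)) * \<tau>"
          by (simp add: algebra_simps)
        then show ?thesis
          using elim by (simp add: divide_le_eq)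
      qed
      then have "norm \<bar>u \<tau> \<xi> - F \<xi>\<bar> \<le> real N + 4 * (K + C)" for \<xi>
        using u_bound[of \<tau> \<xi>] F_bound[of \<xi>] elim unfolding real_norm_def by linarith
      then show ?case
        by simp
    qed
  qed simp_all
  moreover have "eventually (\<lambda>\<tau>. (\<integral>\<xi>. \<bar>u \<tau> \<xi> - F \<xi>\<bar> \<partial>\<mu>) = (\<integral>\<xi>. \<bar>real_of_int (i \<tau> \<xi>) / \<tau> - F \<xi>\<bar> \<partial>\<mu>)) at_top"
    using u_i by eventually_elim simp
  ultimately have "((\<lambda>\<tau>. \<integral>\<xi>. \<bar>real_of_int (i \<tau> \<xi>) / \<tau> - F \<xi>\<bar> \<partial>\<mu>) \<longlongrightarrow> (\<integral>\<xi>. 0 \<partial>\<mu>)) at_top"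
    by (rule Lim_transform_eventually)
  then have L1: "((\<lambda>\<tau>. \<integral>\<xi>. \<bar>real_of_int (i \<tau> \<xi>) / \<tau> - F \<xi>\<bar> \<partial>\<mu>) \<longlongrightarrow> 0) at_top"
    by simp
  have AE: "AE \<xi> in \<mu>. ((\<lambda>\<tau>. real_of_int (i \<tau> \<xi>) / \<tau>) \<longlongrightarrow> F \<xi>) at_top"
    using u_lim
  proof eventually_elim
    case (elim \<xi>)
    then show ?case
      by (rule Lim_transform_eventually) (use u_i in \<open>auto elim!: eventually_mono\<close>)
  qed
  have "integrable \<mu> (\<lambda>\<xi>. real_of_int (i \<tau> \<xi>) / \<tau>)" if "0 < \<tau>" for \<tau>
  proof -
    have "integrable \<mu> (u \<tau>)"
      using u_bound[OF that] u_meas by (intro integrable_const_bound) auto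
    then show ?thesis
      using that by (simp add: u_def[abs_def])
  qed
  moreover have "integrable \<mu> F"
    using F_bound F_meas[folded borel] by (intro integrable_const_bound[of _ "2 * (K + C)"]) auto
  ultimately show ?thesis
    using F_meas F_inv L1 AE by blast
qed

end
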